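(* Let $c\in\mathbb{C}$ and let $M$ be a simple $\mathfrak{b}$-module. Assume that there exists $u\in\frac12+\mathbb{Z}_+$ such that (i) the action of $T_u$ on $M$ is injective; and (ii) $G_uM=0$. Then $\mathrm{Ind}_{\mathfrak{b},c}(M)$ is a simple $\mathcal{T}$-module.
   Context: $\mathbb{N}$ denotes nonnegative integers, $\mathbb{Z}_+$ positive integers (so $u\ge\frac32$). Everything is over $\mathbb{C}$; all modules over Lie superalgebras are $\mathbb{Z}_2$-graded and all simple modules are non-trivial. The twisted $N=2$ superconformal algebra $\mathcal{T}$ is the Lie superalgebra with basis $L_m\ (m\in\mathbb{Z})$, $T_r\ (r\in\frac12+\mathbb{Z})$, $G_p\ (p\in\frac12\mathbb{Z})$, $C$, with $L_m,T_r,C$ even, $G_p$ odd, $C$ central, and super-brackets $[L_m,L_n]=(m-n)L_{m+n}+\frac{m^3-m}{12}\delta_{m+n,0}C$, $[L_m,T_r]=-rT_{m+r}$, $[T_r,T_s]=\frac r3\delta_{r+s,0}C$, $[L_m,G_p]=(\frac m2-p)G_{m+p}$, $[T_r,G_p]=G_{r+p}$, $[G_p,G_q]=(-1)^{2p}\big(2L_{p+q}+\frac{4p^2-1}{12}\delta_{p+q,0}C\big)$ if $p+q\in\mathbb{Z}$, and $[G_p,G_q]=(-1)^{2p+1}(p-q)T_{p+q}$ if $p+q\in\frac12+\mathbb{Z}$. $\mathfrak{b}=\mathcal{T}_+=\mathrm{span}\{L_m,T_r,G_p\mid m\in\mathbb{Z}_+,\ r\in\frac12+\mathbb{N},\ p\in\frac12\mathbb{Z}_+\}$.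 For a $\mathfrak{b}$-module $M$ and $c\in\mathbb{C}$, let $C$ act on $M$ as the scalar $c$ and set $\mathrm{Ind}_{\mathfrak{b},c}(M)=U(\mathcal{T})\otimes_{U(\mathfrak{b}\oplus\mathbb{C}C)}M$. *)

theory Defs
  imports Complex_Main "HOL-Library.Poly_Mapping" "HOL-Library.Z2" "HOL-Algebra.Module" "HOL-Algebra.AbelCoset"
begin

section \<open>Formal linear combinations over the complex numbers\<close>

definition psmult :: "complex \<Rightarrow> ('a \<Rightarrow>\<^sub>0 complex) \<Rightarrow> ('a \<Rightarrow>\<^sub>0 complex)" where
  "psmult z f = Poly_Mapping.map ((*) z) f"

lemma lookup_psmult [simp]: "Poly_Mapping.lookup (psmult z f) a = z * Poly_Mapping.lookup f a"
  by (simp add: psmult_def Poly_Mapping.map.rep_eq when_def)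

global_interpretation pm: vector_space "psmult :: complex \<Rightarrow> ('a \<Rightarrow>\<^sub>0 complex) \<Rightarrow> _"
  by unfold_locales (auto intro!: poly_mapping_eqI simp: lookup_add algebra_simps)


section \<open>The twisted N=2 superconformal algebra\<close>

text \<open>
  Half-integral indices are encoded by integers:
  \<open>Lg m\<close> is $L_m$, \<open>Tg k\<close> is $T_{k+1/2}$, \<open>Gg q\<close> is $G_{q/2}$, and \<open>Cg\<close> is the central element.
  Degrees live in the two-element field \<^typ>\<open>bit\<close>.
\<close>

datatype gen = Lg int | Tg int | Gg int | Cg

type_synonym tw = "gen \<Rightarrow>\<^sub>0 complex"

fun parity :: "gen \<Rightarrow> bit" where
  "parity (Gg q) = 1"
| "parity (Lg m) = 0"
| "parity (Tg k) = 0"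
| "parity Cg = 0"

abbreviation basis :: "gen \<Rightarrow> tw" where
  "basis a \<equiv> Poly_Mapping.single a 1"

definition hf :: "int \<Rightarrow> complex" where
  "hf k = of_int k / 2"

text \<open>
  Below \<open>r = hf (2*k+1)\<close> is the index of \<open>Tg k\<close> and \<open>p = hf q\<close> that of \<open>Gg q\<close>.
  If \<open>p + q\<close> is odd then \<open>Tg ((p + q) div 2)\<close> has index \<open>hf (p + q)\<close>.
  The brackets that are not listed in the usual presentation come from super skew-symmetry.
\<close>

fun gbracket :: "gen \<Rightarrow> gen \<Rightarrow> tw" where
  "gbracket (Lg m) (Lg n) = psmult (of_int (m - n)) (basis (Lg (m + n)))
     + (if m + n = 0 then psmult (of_int (m^3 - m) / 12) (basis Cg) else 0)"
| "gbracket (Lg m) (Tg k) = psmult (- hf (2*k+1)) (basis (Tg (m + k)))"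
| "gbracket (Tg k) (Lg m) = psmult (hf (2*k+1)) (basis (Tg (m + k)))"
| "gbracket (Tg j) (Tg k) =
     (if (2*j+1) + (2*k+1) = 0 then psmult (hf (2*j+1) / 3) (basis Cg) else 0)"
| "gbracket (Lg m) (Gg q) = psmult (of_int m / 2 - hf q) (basis (Gg (2*m + q)))"
| "gbracket (Gg q) (Lg m) = psmult (- (of_int m / 2 - hf q)) (basis (Gg (2*m + q)))"
| "gbracket (Tg k) (Gg q) = basis (Gg ((2*k+1) + q))"
| "gbracket (Gg q) (Tg k) = - basis (Gg ((2*k+1) + q))"
| "gbracket (Gg p) (Gg q) =
     (if even (p + q)
      then psmult ((-1) powi p)
             (psmult 2 (basis (Lg ((p + q) div 2)))
              + (if p + q = 0 then psmult ((4 * (hf p)\<^sup>2 - 1) / 12) (basis Cg) else 0))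
      else psmult ((-1) powi (p + 1) * (hf p - hf q)) (basis (Tg ((p + q) div 2))))"
| "gbracket _ _ = 0"

definition bracket :: "tw \<Rightarrow> tw \<Rightarrow> tw" where
  "bracket x y = (\<Sum>a\<in>Poly_Mapping.keys x. \<Sum>b\<in>Poly_Mapping.keys y.
     psmult (Poly_Mapping.lookup x a * Poly_Mapping.lookup y b) (gbracket a b))"

definition tw_part :: "bit \<Rightarrow> tw set" where
  "tw_part i = {x. \<forall>a\<in>Poly_Mapping.keys x. parity a = i}"

definition ssign :: "bit \<Rightarrow> bit \<Rightarrow> complex" where
  "ssign i j = (if i = 1 \<and> j = 1 then -1 else 1)"

definition bgens :: "gen set" where
  "bgens = {Lg m | m. m > 0} \<union> {Tg k | k. k \<ge> 0} \<union> {Gg q | q. q > 0}"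

definition b_alg :: "tw set" where
  "b_alg = {x. Poly_Mapping.keys x \<subseteq> bgens}"


section \<open>Modules over graded subalgebras\<close>

text \<open>The ring multiplication and unit inherited from \<^theory>\<open>HOL-Algebra.Module\<close> play no role.\<close>

record 'v super_module = "(complex, 'v) module" +
  part :: "bit \<Rightarrow> 'v set"
  act :: "tw \<Rightarrow> 'v \<Rightarrow> 'v"

definition complex_field :: "complex ring" where
  "complex_field = \<lparr>carrier = UNIV, mult = (*), one = 1, zero = 0, add = (+)\<rparr>"

locale supermodule = Module.module complex_field M
  for g :: "tw set" and M :: "'v super_module" (structure) +
  assumes part_submodule: "submodule (part M i) complex_field M"
    and part_disjoint: "part M 0 \<inter> part M 1 = {\<zero>}"
    and part_sum: "carrier M = part M 0 <+>\<^bsub>M\<^esub> part M 1"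
    and act_closed: "\<lbrakk>x \<in> g; v \<in> carrier M\<rbrakk> \<Longrightarrow> act M x v \<in> carrier M"
    and act_add_left: "\<lbrakk>x \<in> g; y \<in> g; v \<in> carrier M\<rbrakk> \<Longrightarrow> act M (x + y) v = act M x v \<oplus> act M y v"
    and act_smult_left: "\<lbrakk>x \<in> g; v \<in> carrier M\<rbrakk> \<Longrightarrow> act M (psmult z x) v = z \<odot>\<^bsub>M\<^esub> act M x v"
    and act_add_right: "\<lbrakk>x \<in> g; v \<in> carrier M; w \<in> carrier M\<rbrakk> \<Longrightarrow> act M x (v \<oplus> w) = act M x v \<oplus> act M x w"
    and act_smult_right: "\<lbrakk>x \<in> g; v \<in> carrier M\<rbrakk> \<Longrightarrow> act M x (z \<odot>\<^bsub>M\<^esub> v) = z \<odot>\<^bsub>M\<^esub> act M x v"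
    and act_parity: "\<lbrakk>x \<in> g \<inter> tw_part i; v \<in> part M j\<rbrakk> \<Longrightarrow> act M x v \<in> part M (i + j)"
    and act_bracket: "\<lbrakk>x \<in> g \<inter> tw_part i; y \<in> g \<inter> tw_part j; v \<in> carrier M\<rbrakk> \<Longrightarrow>
          act M (bracket x y) v = act M x (act M y v) \<ominus> ssign i j \<odot>\<^bsub>M\<^esub> act M y (act M x v)"

definition subsupermodule :: "tw set \<Rightarrow> 'v super_module \<Rightarrow> 'v set \<Rightarrow> bool" where
  "subsupermodule g M W \<longleftrightarrow> submodule W complex_field M
     \<and> (\<forall>x\<in>g. \<forall>w\<in>W. act M x w \<in> W)
     \<and> W = (W \<inter> part M 0) <+>\<^bsub>M\<^esub> (W \<inter> part M 1)"

text \<open>Simple modules are by convention non-trivial: the action is not identically zero.\<close>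

definition simple_supermodule :: "tw set \<Rightarrow> 'v super_module \<Rightarrow> bool" where
  "simple_supermodule g M \<longleftrightarrow> supermodule g M \<and> carrier M \<noteq> {\<zero>\<^bsub>M\<^esub>}
     \<and> (\<forall>W. subsupermodule g M W \<longrightarrow> W = {\<zero>\<^bsub>M\<^esub>} \<or> W = carrier M)
     \<and> (\<exists>x\<in>g. \<exists>v\<in>carrier M. act M x v \<noteq> \<zero>\<^bsub>M\<^esub>)"


section \<open>The universal enveloping algebra\<close>

text \<open>
  With concatenation as (non-commutative) addition on words, \<open>'a list \<Rightarrow>\<^sub>0 complex\<close> carries the
  convolution product of a monoid algebra, i.e. it is the free associative algebra on \<open>'a\<close>,
  which is the tensor algebra of the vector space with basis \<open>'a\<close>.
\<close>

instantiation list :: (type) monoid_add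
begin
definition zero_list :: "'a list" where "zero_list = []"
definition plus_list :: "'a list \<Rightarrow> 'a list \<Rightarrow> 'a list" where "plus_list = (@)"
instance by standard (auto simp: zero_list_def plus_list_def)
end

type_synonym falg = "gen list \<Rightarrow>\<^sub>0 complex"

definition letter :: "gen \<Rightarrow> falg" where
  "letter a = Poly_Mapping.single [a] 1"

definition tw_to_falg :: "tw \<Rightarrow> falg" where
  "tw_to_falg x = (\<Sum>a\<in>Poly_Mapping.keys x. psmult (Poly_Mapping.lookup x a) (letter a))"

definition env_rel :: "gen \<Rightarrow> gen \<Rightarrow> falg" where
  "env_rel a b = letter a * letter b
     - psmult (ssign (parity a) (parity b)) (letter b * letter a) - tw_to_falg (gbracket a b)"

inductive_set env_ideal :: "falg set" where
  zero: "0 \<in> env_ideal"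
| rel: "p * env_rel a b * q \<in> env_ideal"
| add: "x \<in> env_ideal \<Longrightarrow> y \<in> env_ideal \<Longrightarrow> x + y \<in> env_ideal"

lemma env_ideal_mult_left: "x \<in> env_ideal \<Longrightarrow> p * x \<in> env_ideal"
proof (induction rule: env_ideal.induct)
  case (rel p' a b q)
  show ?case using env_ideal.rel[of "p * p'" a b q] by (simp add: mult.assoc)
qed (auto simp: distrib_left intro: env_ideal.intros)

lemma env_ideal_mult_right: "x \<in> env_ideal \<Longrightarrow> x * p \<in> env_ideal"
proof (induction rule: env_ideal.induct)
  case (rel p' a b q)
  show ?case using env_ideal.rel[of p' a b "q * p"] by (simp add: mult.assoc)
qed (auto simp: distrib_right intro: env_ideal.intros)

lemma env_ideal_uminus: "x \<in> env_ideal \<Longrightarrow> - x \<in> env_ideal"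
  using env_ideal_mult_left[of x "-1"] by simp

lemma env_ideal_diff: "x \<in> env_ideal \<Longrightarrow> y \<in> env_ideal \<Longrightarrow> x - y \<in> env_ideal"
  using env_ideal.add[of x "- y"] env_ideal_uminus[of y] by simp

definition env_eq :: "falg \<Rightarrow> falg \<Rightarrow> bool" where
  "env_eq x y \<longleftrightarrow> x - y \<in> env_ideal"

lemma equivp_env_eq: "equivp env_eq"
proof (intro equivpI reflpI sympI transpI)
  show "env_eq x x" for x by (simp add: env_eq_def env_ideal.zero)
  show "env_eq y x" if "env_eq x y" for x y
    using env_ideal_uminus[of "x - y"] that by (simp add: env_eq_def)
  show "env_eq x z" if "env_eq x y" "env_eq y z" for x y z
    using env_ideal.add[of "x - y" "y - z"] that by (simp add: env_eq_def)
qed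

quotient_type U = falg / env_eq
  by (rule equivp_env_eq)

instantiation U :: ring
begin

lift_definition zero_U :: U is 0 .

lift_definition plus_U :: "U \<Rightarrow> U \<Rightarrow> U" is "(+)"
proof -
  fix x x' y y' :: falg
  assume "env_eq x x'" "env_eq y y'"
  then show "env_eq (x + y) (x' + y')"
    using env_ideal.add[of "x - x'" "y - y'"] by (simp add: env_eq_def algebra_simps)
qed

lift_definition minus_U :: "U \<Rightarrow> U \<Rightarrow> U" is "(-)"
proof -
  fix x x' y y' :: falg
  assume "env_eq x x'" "env_eq y y'"
  then show "env_eq (x - y) (x' - y')"
    using env_ideal_diff[of "x - x'" "y - y'"] by (simp add: env_eq_def algebra_simps)
qed

lift_definition uminus_U :: "U \<Rightarrow> U" is uminus
proof -
  fix x x' :: falg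
  assume "env_eq x x'"
  then show "env_eq (- x) (- x')"
    using env_ideal_uminus[of "x - x'"] by (simp add: env_eq_def)
qed

lift_definition times_U :: "U \<Rightarrow> U \<Rightarrow> U" is "(*)"
proof -
  fix x x' y y' :: falg
  assume *: "env_eq x x'" "env_eq y y'"
  have "x * y - x' * y' = (x - x') * y + x' * (y - y')" by (simp add: algebra_simps)
  then show "env_eq (x * y) (x' * y')"
    using * env_ideal.add[OF env_ideal_mult_right env_ideal_mult_left, of "x - x'" "y - y'" y x']
    by (simp add: env_eq_def)
qed

instance
  by standard (transfer; simp add: env_eq_def algebra_simps env_ideal.zero)+

end

instantiation U :: monoid_mult
begin

lift_definition one_U :: U is 1 .

instance
  by standard (transfer; simp add: env_eq_def env_ideal.zero)+

end

abbreviation env :: "falg \<Rightarrow> U" where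
  "env \<equiv> abs_U"

text \<open>The degree of a word is the sum of the degrees of its letters; the ideal is homogeneous.\<close>

definition U_part :: "bit \<Rightarrow> U set" where
  "U_part i = env ` {p. \<forall>w\<in>Poly_Mapping.keys p. (\<Sum>a\<leftarrow>w. parity a) = i}"


section \<open>The induced module\<close>

text \<open>
  \<open>falg_act c M\<close> is the action on a \<open>b_alg\<close>-module \<open>M\<close> of the free associative algebra on the
  basis of $\mathfrak b \oplus \mathbb C C$, with \<open>Cg\<close> acting as the scalar \<open>c\<close>.  It factors through
  the quotient $U(\mathfrak b \oplus \mathbb C C)$ of this free algebra.
\<close>

definition gen_act :: "complex \<Rightarrow> 'v super_module \<Rightarrow> gen \<Rightarrow> 'v \<Rightarrow> 'v" where
  "gen_act c M a v = (if a = Cg then c \<odot>\<^bsub>M\<^esub> v else act M (basis a) v)"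

definition word_act :: "complex \<Rightarrow> 'v super_module \<Rightarrow> gen list \<Rightarrow> 'v \<Rightarrow> 'v" where
  "word_act c M w v = foldr (gen_act c M) w v"

definition falg_act :: "complex \<Rightarrow> 'v super_module \<Rightarrow> falg \<Rightarrow> 'v \<Rightarrow> 'v" where
  "falg_act c M p v = finsum M (\<lambda>w. Poly_Mapping.lookup p w \<odot>\<^bsub>M\<^esub> word_act c M w v) (Poly_Mapping.keys p)"

definition falg_bC :: "falg set" where
  "falg_bC = {p. \<forall>w\<in>Poly_Mapping.keys p. set w \<subseteq> insert Cg bgens}"

text \<open>
  The tensor product over $U(\mathfrak b \oplus \mathbb C C)$ is the free vector space on pairs
  \<open>(u, m)\<close> modulo the span of the bilinearity and balancing relations.
  An element of $U(\mathfrak b \oplus \mathbb C C)$ is given by a representative \<open>p \<in> falg_bC\<close>.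
\<close>

abbreviation tens :: "U \<Rightarrow> 'v \<Rightarrow> (U \<times> 'v) \<Rightarrow>\<^sub>0 complex" where
  "tens u m \<equiv> Poly_Mapping.single (u, m) 1"

definition tensor_rels :: "complex \<Rightarrow> 'v super_module \<Rightarrow> ((U \<times> 'v) \<Rightarrow>\<^sub>0 complex) set" where
  "tensor_rels c M =
     {tens (u + u') m - tens u m - tens u' m | u u' m. m \<in> carrier M}
   \<union> {tens u (m \<oplus>\<^bsub>M\<^esub> m') - tens u m - tens u m' | u m m'. m \<in> carrier M \<and> m' \<in> carrier M}
   \<union> {tens (env (psmult z p)) m - psmult z (tens (env p) m) | z p m. m \<in> carrier M}
   \<union> {tens u (z \<odot>\<^bsub>M\<^esub> m) - psmult z (tens u m) | z u m. m \<in> carrier M}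
   \<union> {tens (u * env p) m - tens u (falg_act c M p m) | u p m. p \<in> falg_bC \<and> m \<in> carrier M}"

text \<open>
  Vectors of \<open>Ind c M\<close> are cosets of the span of the relations; all operations are the induced
  operations on cosets, and a homogeneous pure tensor has degree the sum of the two degrees.
\<close>

definition tensor_class ::
    "complex \<Rightarrow> 'v super_module \<Rightarrow> ((U \<times> 'v) \<Rightarrow>\<^sub>0 complex) \<Rightarrow> ((U \<times> 'v) \<Rightarrow>\<^sub>0 complex) set" where
  "tensor_class c M t = {t + n | n. n \<in> pm.span (tensor_rels c M)}"

definition left_mult :: "U \<Rightarrow> ((U \<times> 'v) \<Rightarrow>\<^sub>0 complex) \<Rightarrow> ((U \<times> 'v) \<Rightarrow>\<^sub>0 complex)" where
  "left_mult x t = (\<Sum>(u, m)\<in>Poly_Mapping.keys t. psmult (Poly_Mapping.lookup t (u, m)) (tens (x * u) m))"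

definition Ind :: "complex \<Rightarrow> 'v super_module \<Rightarrow> ((U \<times> 'v) \<Rightarrow>\<^sub>0 complex) set super_module" where
  "Ind c M =
    \<lparr>carrier = tensor_class c M ` pm.span {tens u m | u m. m \<in> carrier M},
     mult = undefined, one = undefined,
     zero = tensor_class c M 0,
     add = (\<lambda>A B. \<Union>a\<in>A. \<Union>b\<in>B. tensor_class c M (a + b)),
     smult = (\<lambda>z A. \<Union>a\<in>A. tensor_class c M (psmult z a)),
     part = (\<lambda>i. tensor_class c M `
               pm.span {tens u m | u m j k. u \<in> U_part j \<and> m \<in> part M k \<and> j + k = i}),
     act = (\<lambda>x A. \<Union>a\<in>A. tensor_class c M (left_mult (env (tw_to_falg x)) a))\<rparr>"

end

theory Submission
  imports Defs "HOL-Analysis.Continuum_Not_Denumerable"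
    "HOL-Computational_Algebra.Fundamental_Theorem_Algebra"
begin

text \<open>
  Write \<open>u = k + 1/2\<close>.  The brackets \<open>[L\<^sub>m, G\<^sub>u]\<close>, \<open>[T\<^sub>r, G\<^sub>p]\<close> and \<open>[G\<^sub>u, G\<^sub>p]\<close> show that on \<open>M\<close> every basis element
  of degree larger than \<open>u\<close> vanishes, and so does \<open>G\<^sub>u\<close> (\<open>kills_high\<close>).  Hence \<open>T\<^sub>u\<close> commutes with
  \<open>\<bb>\<close> on \<open>M\<close>, and by the Schur-Dixmier lemma it acts as a scalar \<open>\<lambda>\<close>
  (\<open>central_generator_scalar\<close>), which is nonzero because \<open>T\<^sub>u\<close> is injective.

  For every basis element \<open>y\<close> of degree \<open>-d \<le> 0\<close>, \<open>y \<noteq> C\<close>, there is a partner \<open>y*\<close> of degree \<open>u + d\<close> and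
  of the same parity such that \<open>[y*, y]\<close> is a nonzero multiple of \<open>T\<^sub>u\<close>; on \<open>1 \<otimes> M\<close> the element \<open>y*\<close>
  (or \<open>T\<^sub>u - \<lambda>\<close>, if \<open>y* = T\<^sub>u\<close>) is zero.  The induced module is filtered by the words in such \<open>y\<close>
  applied to \<open>1 \<otimes> M\<close>, ordered by total degree first and by length second.  In the associated graded
  module \<open>y*\<close> acts like \<open>\<lambda> \<partial>/\<partial>y\<close> up to a nonzero factor, so that a suitable combination of the
  operators \<open>y y*\<close> is an Euler operator: it multiplies a word of length \<open>n\<close> by \<open>n\<close>, up to terms of
  lower order (\<open>euler_wv\<close>).  If a submodule meets \<open>1 \<otimes> M\<close> only in zero, then a nonzero element of lowest order in
  it is annihilated by all \<open>y*\<close>, therefore by the Euler operator, and so is of still lower order; thus the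
  submodule is zero (\<open>trivial_intersection\<close>).  If it meets \<open>1 \<otimes> M\<close> nontrivially, it contains
  \<open>1 \<otimes> M\<close> because \<open>M\<close> is simple, and \<open>1 \<otimes> M\<close> generates the induced module.  This
  argument does not need linear independence of the words.

  What remains is that the induced module is a nonzero supermodule.  The grading is a direct sum because
  the parity automorphism of \<open>U \<otimes> M\<close> respects the tensor relations (\<open>tensor_part_disjoint\<close>).  That
  \<open>M\<close> embeds as \<open>1 \<otimes> M\<close> (\<open>tens_one_eq_zero\<close>) is a consequence of the Poincare-Birkhoff-Witt theorem,
  which is proved for a Lie superalgebra with a totally ordered homogeneous basis by rewriting words to
  normal form; confluence of the rewriting is the super Jacobi identity (\<open>overlap_resolves\<close>).  With a
  basis order that puts the elements outside \<open>\<bb> \<oplus> \<complex>C\<close> first, taking the component in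
  \<open>U(\<bb> \<oplus> \<complex>C)\<close> of a normal form and letting it act on \<open>M\<close> is a linear map on the induced module
  that restricts to the identity on \<open>1 \<otimes> M\<close>.
\<close>


section \<open>Linear maps given on a basis\<close>

text \<open>The linear extension of a map defined on the basis of a space of formal linear combinations.\<close>

definition lin_ext :: "('a \<Rightarrow> ('b \<Rightarrow>\<^sub>0 complex)) \<Rightarrow> ('a \<Rightarrow>\<^sub>0 complex) \<Rightarrow> ('b \<Rightarrow>\<^sub>0 complex)" where
  "lin_ext f x = (\<Sum>a\<in>Poly_Mapping.keys x. psmult (Poly_Mapping.lookup x a) (f a))"

lemma lin_ext_superset:
  assumes "finite S" "Poly_Mapping.keys x \<subseteq> S"
  shows "lin_ext f x = (\<Sum>a\<in>S. psmult (Poly_Mapping.lookup x a) (f a))"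
  unfolding lin_ext_def
  by (rule sum.mono_neutral_left[OF assms]) (auto simp: in_keys_iff)

lemma lin_ext_zero [simp]: "lin_ext f 0 = 0"
  by (simp add: lin_ext_def)

lemma lin_ext_add: "lin_ext f (x + y) = lin_ext f x + lin_ext f y"
proof -
  let ?S = "Poly_Mapping.keys x \<union> Poly_Mapping.keys y"
  have "Poly_Mapping.keys (x + y) \<subseteq> ?S" by (rule keys_add)
  then show ?thesis
    by (simp add: lin_ext_superset[of ?S] lookup_add pm.scale_left_distrib sum.distrib)
qed

lemma keys_psmult: "Poly_Mapping.keys (psmult z x) \<subseteq> Poly_Mapping.keys x"
  by (auto simp: in_keys_iff)

lemma lin_ext_psmult: "lin_ext f (psmult z x) = psmult z (lin_ext f x)"
  using lin_ext_superset[of "Poly_Mapping.keys x" "psmult z x" f] keys_psmult[of z x]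
  by (simp add: lin_ext_def pm.scale_sum_right)

lemma psmult_minus_one: "psmult (-1) x = - x"
  by (rule poly_mapping_eqI) simp

lemma lin_ext_uminus: "lin_ext f (- x) = - lin_ext f x"
  using lin_ext_psmult[of f "-1" x] by (simp add: psmult_minus_one)

lemma lin_ext_diff: "lin_ext f (x - y) = lin_ext f x - lin_ext f y"
  using lin_ext_add[of f x "- y"] by (simp add: lin_ext_uminus)

lemma lin_ext_single: "lin_ext f (Poly_Mapping.single a z) = psmult z (f a)"
  by (simp add: lin_ext_superset[of "{a}"])

lemma lin_ext_basis [simp]: "lin_ext f (Poly_Mapping.single a 1) = f a"
  by (simp add: lin_ext_single)

lemmas lin_ext_simps = lin_ext_add lin_ext_diff lin_ext_psmult lin_ext_uminus

lemma expand_basis: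
  "x = (\<Sum>a\<in>Poly_Mapping.keys x. psmult (Poly_Mapping.lookup x a) (Poly_Mapping.single a 1))"
proof (rule poly_mapping_eqI)
  fix k
  have "(\<Sum>a\<in>Poly_Mapping.keys x. Poly_Mapping.lookup x a * (1 when a = k))
      = (\<Sum>a\<in>Poly_Mapping.keys x. if a = k then Poly_Mapping.lookup x k else 0)"
    by (intro sum.cong) (auto simp: when_def)
  then show "Poly_Mapping.lookup x k = Poly_Mapping.lookup
     (\<Sum>a\<in>Poly_Mapping.keys x. psmult (Poly_Mapping.lookup x a) (Poly_Mapping.single a 1)) k"
    by (simp add: lookup_sum lookup_single sum.delta in_keys_iff)
qed

lemma lin_ext_cong:
  "(\<And>a. a \<in> Poly_Mapping.keys x \<Longrightarrow> f a = g a) \<Longrightarrow> lin_ext f x = lin_ext g x"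
  by (simp add: lin_ext_def)

lemma lin_ext_in_subspace:
  assumes "pm.subspace S" "\<And>a. a \<in> Poly_Mapping.keys x \<Longrightarrow> f a \<in> S"
  shows "lin_ext f x \<in> S"
  unfolding lin_ext_def by (intro pm.subspace_sum pm.subspace_scale assms)

lemma lin_ext_eqI:
  assumes "\<And>x y. h (x + y) = h x + h y" "\<And>z x. h (psmult z x) = psmult z (h x)"
    "\<And>a. a \<in> Poly_Mapping.keys x \<Longrightarrow> h (Poly_Mapping.single a 1) = f a"
  shows "h x = lin_ext f x"
proof -
  have z: "h 0 = 0" using assms(2)[of 0 0] by simp
  have s: "h (sum g S) = (\<Sum>i\<in>S. h (g i))" for g and S :: "'a set"
    by (induction S rule: infinite_finite_induct) (simp_all add: z assms(1))
  have "h x = h (\<Sum>a\<in>Poly_Mapping.keys x. psmult (Poly_Mapping.lookup x a) (Poly_Mapping.single a 1))"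
    by (rule arg_cong[OF expand_basis])
  also have "\<dots> = lin_ext f x"
    unfolding s lin_ext_def by (intro sum.cong) (simp_all add: assms(2,3))
  finally show ?thesis .
qed

lemma lin_ext_lin_ext: "lin_ext f (lin_ext g x) = lin_ext (\<lambda>a. lin_ext f (g a)) x"
  by (rule lin_ext_eqI[of "\<lambda>x. lin_ext f (lin_ext g x)" x]) (simp_all add: lin_ext_simps)

lemma lin_ext_pointwise:
  "lin_ext (\<lambda>a. f a + g a) x = lin_ext f x + lin_ext g x"
  "lin_ext (\<lambda>a. f a - g a) x = lin_ext f x - lin_ext g x"
  "lin_ext (\<lambda>a. psmult z (f a)) x = psmult z (lin_ext f x)"
  by (simp_all add: lin_ext_def sum.distrib sum_subtractf pm.scale_sum_right
      pm.scale_right_distrib pm.scale_right_diff_distrib mult.commute)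

lemma lin_ext_id: "lin_ext (\<lambda>a. Poly_Mapping.single a 1) x = x"
  unfolding lin_ext_def by (rule expand_basis[symmetric])

lemma keys_lin_ext:
  assumes "\<And>a. a \<in> Poly_Mapping.keys x \<Longrightarrow> Poly_Mapping.keys (f a) \<subseteq> K"
  shows "Poly_Mapping.keys (lin_ext f x) \<subseteq> K"
proof -
  have "pm.subspace {y. Poly_Mapping.keys y \<subseteq> K}"
    unfolding pm.subspace_def
    using keys_add keys_psmult by (auto dest!: subsetD[OF keys_add] subsetD[OF keys_psmult])
  from lin_ext_in_subspace[OF this, of x f] show ?thesis using assms by simp
qed

lemma pm_span_induct [consumes 1, case_names zero add smult base]:
  assumes "x \<in> pm.span S" "P 0" "\<And>x y. P x \<Longrightarrow> P y \<Longrightarrow> P (x + y)" "\<And>z x. P x \<Longrightarrow> P (psmult z x)"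
    "\<And>x. x \<in> S \<Longrightarrow> P x"
  shows "P x"
proof -
  have "pm.subspace {x. P x}"
    unfolding pm.subspace_def using assms(2-4) by blast
  with assms(1) show ?thesis
    by (rule pm.span_induct) (rule assms(5))
qed


section \<open>Words and the monoid algebra\<close>

text \<open>The free associative algebra on \<open>'a\<close>, as the monoid algebra of words.\<close>

type_synonym 'a wd = "'a list \<Rightarrow>\<^sub>0 complex"

abbreviation word :: "'a list \<Rightarrow> 'a wd" where
  "word w \<equiv> Poly_Mapping.single w 1"

lemma word_mult: "word u * word v = word (u @ v)"
  by (simp add: mult_single plus_list_def)

lemma word_mult_left: "word u * (word v * x) = word (u @ v) * x"
  by (simp add: word_mult flip: mult.assoc)

lemma word_Nil: "word [] = 1"
  by (metis single_one zero_list_def)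

lemma single_conv_psmult: "Poly_Mapping.single a z = psmult z (Poly_Mapping.single a 1)"
  by (rule poly_mapping_eqI) (simp add: lookup_single when_def)

lemma expand_single:
  "(x :: 'a \<Rightarrow>\<^sub>0 complex) = (\<Sum>a\<in>Poly_Mapping.keys x. Poly_Mapping.single a (Poly_Mapping.lookup x a))"
proof -
  have "(\<Sum>a\<in>Poly_Mapping.keys x. psmult (Poly_Mapping.lookup x a) (Poly_Mapping.single a 1))
     = (\<Sum>a\<in>Poly_Mapping.keys x. Poly_Mapping.single a (Poly_Mapping.lookup x a))"
    by (intro sum.cong refl single_conv_psmult[symmetric])
  then show ?thesis
    unfolding expand_basis[of x, symmetric] .
qed

lemma lin_ext_left_word: "lin_ext (\<lambda>v. word (u @ v)) x = word u * x" for u :: "'a list"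
proof -
  have "word u * x = word u * (\<Sum>a\<in>Poly_Mapping.keys x. Poly_Mapping.single a (Poly_Mapping.lookup x a))"
    by (rule arg_cong[where f = "\<lambda>x. word u * x", OF expand_single])
  also have "\<dots> = (\<Sum>a\<in>Poly_Mapping.keys x. Poly_Mapping.single (u @ a) (Poly_Mapping.lookup x a))"
    by (simp add: sum_distrib_left mult_single plus_list_def)
  also have "\<dots> = lin_ext (\<lambda>v. word (u @ v)) x"
    unfolding lin_ext_def by (intro sum.cong refl single_conv_psmult)
  finally show ?thesis ..
qed

lemma psmult_conv_mult: "psmult z (x :: 'a wd) = Poly_Mapping.single [] z * x"
proof -
  have "Poly_Mapping.single [] z * x = Poly_Mapping.single [] z *
      (\<Sum>a\<in>Poly_Mapping.keys x. Poly_Mapping.single a (Poly_Mapping.lookup x a))"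
    by (rule arg_cong[where f = "\<lambda>x. Poly_Mapping.single [] z * x", OF expand_single])
  also have "\<dots> = (\<Sum>a\<in>Poly_Mapping.keys x. Poly_Mapping.single a (z * Poly_Mapping.lookup x a))"
    by (simp add: sum_distrib_left mult_single plus_list_def)
  also have "\<dots> = psmult z (\<Sum>a\<in>Poly_Mapping.keys x. psmult (Poly_Mapping.lookup x a) (word a))"
    unfolding pm.scale_sum_right pm.scale_scale
    by (intro sum.cong refl single_conv_psmult)
  finally show ?thesis
    unfolding expand_basis[of x, symmetric] by (rule sym)
qed

lemma psmult_conv_mult_right: "psmult z (x :: 'a wd) = x * Poly_Mapping.single [] z"
proof -
  have "x * Poly_Mapping.single [] z =
      (\<Sum>a\<in>Poly_Mapping.keys x. Poly_Mapping.single a (Poly_Mapping.lookup x a)) * Poly_Mapping.single [] z"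
    by (rule arg_cong[where f = "\<lambda>x. x * Poly_Mapping.single [] z", OF expand_single])
  also have "\<dots> = (\<Sum>a\<in>Poly_Mapping.keys x. Poly_Mapping.single a (z * Poly_Mapping.lookup x a))"
    by (simp add: sum_distrib_right mult_single plus_list_def mult.commute)
  also have "\<dots> = psmult z (\<Sum>a\<in>Poly_Mapping.keys x. psmult (Poly_Mapping.lookup x a) (word a))"
    unfolding pm.scale_sum_right pm.scale_scale
    by (intro sum.cong refl single_conv_psmult)
  finally show ?thesis
    unfolding expand_basis[of x, symmetric] by (rule sym)
qed

lemma psmult_mult_left: "psmult z x * y = psmult z (x * y)" for x y :: "'a wd"
  by (simp add: psmult_conv_mult mult.assoc)

lemma psmult_mult_right: "x * psmult z y = psmult z (x * y)" for x y :: "'a wd"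
  by (simp add: psmult_conv_mult_right mult.assoc)

lemmas psmult_mult = psmult_mult_left psmult_mult_right

lemma lin_ext_mult_left: "p * lin_ext f x = lin_ext (\<lambda>a. p * f a) x" for p :: "'a wd"
  by (rule lin_ext_eqI[of "\<lambda>x. p * lin_ext f x" x]) (simp_all add: lin_ext_simps distrib_left psmult_mult)

lemma lin_ext_mult_right: "lin_ext f x * p = lin_ext (\<lambda>a. f a * p) x" for p :: "'a wd"
  by (rule lin_ext_eqI[of "\<lambda>x. lin_ext f x * p" x]) (simp_all add: lin_ext_simps distrib_right psmult_mult)


section \<open>A Poincare-Birkhoff-Witt theorem for Lie superalgebras\<close>

lemma ssign_simps [simp]:
  "ssign i j * ssign i j = 1" "ssign i (j + l) = ssign i j * ssign i l"
  "ssign (i + j) l = ssign i l * ssign j l" "ssign 0 i = 1" "ssign i 0 = 1"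
  by (auto simp: ssign_def)

lemma ssign_commute: "ssign i j = ssign j i"
  by (auto simp: ssign_def)

text \<open>
  A Lie superalgebra given by its structure constants on a homogeneous basis; the basis is totally
  ordered by an injective rank.
\<close>

locale lie_superalgebra_basis =
  fixes par :: "'a \<Rightarrow> bit" and br :: "'a \<Rightarrow> 'a \<Rightarrow> ('a \<Rightarrow>\<^sub>0 complex)" and rk :: "'a \<Rightarrow> int"
  assumes par_br: "g \<in> Poly_Mapping.keys (br a b) \<Longrightarrow> par g = par a + par b"
    and skew: "br b a = - psmult (ssign (par a) (par b)) (br a b)"
    and jacobi: "lin_ext (br a) (br b c) = lin_ext (\<lambda>x. br x c) (br a b)
       + psmult (ssign (par a) (par b)) (lin_ext (br b) (br a c))"
    and rk_inj: "rk a = rk b \<Longrightarrow> a = b"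
begin

text \<open>The embedding of the Lie superalgebra into the free algebra.\<close>

abbreviation lt :: "('a \<Rightarrow>\<^sub>0 complex) \<Rightarrow> 'a wd" where
  "lt \<equiv> lin_ext (\<lambda>a. word [a])"

abbreviation sg :: "'a \<Rightarrow> 'a \<Rightarrow> complex" where
  "sg a b \<equiv> ssign (par a) (par b)"

text \<open>The defining relation of the enveloping algebra for two basis elements.\<close>

definition rel :: "'a \<Rightarrow> 'a \<Rightarrow> 'a wd" where
  "rel a b = word [a, b] - psmult (sg a b) (word [b, a]) - lt (br a b)"

text \<open>
  An adjacent pair that cannot occur in a Poincare-Birkhoff-Witt monomial: the letters are in descending
  order, or an odd letter is repeated.  Its rewriting \<open>rw\<close> is what the relation makes of the pair; for
  a repeated odd letter, \<open>a\<^sup>2 = [a, a] / 2\<close>.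
\<close>

definition bad :: "'a \<Rightarrow> 'a \<Rightarrow> bool" where
  "bad a b \<longleftrightarrow> rk b < rk a \<or> (a = b \<and> par a = 1)"

definition rw :: "'a \<Rightarrow> 'a \<Rightarrow> 'a wd" where
  "rw a b = (if a = b then psmult (1/2) (lt (br a a))
             else psmult (sg a b) (word [b, a]) + lt (br a b))"

text \<open>The words of the Poincare-Birkhoff-Witt basis.\<close>

definition normal :: "'a list \<Rightarrow> bool" where
  "normal w \<longleftrightarrow> (\<forall>u a b v. w = u @ a # b # v \<longrightarrow> \<not> bad a b)"

text \<open>The number of bad pairs of letters, adjacent or not.\<close>

fun inversions :: "'a list \<Rightarrow> nat" where
  "inversions [] = 0"
| "inversions (x # xs) = length (filter (bad x) xs) + inversions xs"

text \<open>The termination order of the rewriting: length, then number of bad pairs.\<close>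

definition smaller :: "('a list \<times> 'a list) set" where
  "smaller = measures [length, inversions]"

lemma wf_smaller: "wf smaller"
  by (simp add: smaller_def)

lemma inversions_swap:
  assumes "rk b < rk a"
  shows "inversions (u @ b # a # v) < inversions (u @ a # b # v)"
proof (induction u)
  case Nil
  then show ?case using assms by (auto simp: bad_def)
qed simp

lemma smaller_swap: "rk b < rk a \<Longrightarrow> (u @ b # a # v, u @ a # b # v) \<in> smaller"
  by (simp add: smaller_def inversions_swap)

lemma smaller_length: "length x < length y \<Longrightarrow> (x, y) \<in> smaller"
  by (simp add: smaller_def)

lemma smaller_trans: "(x, y) \<in> smaller \<Longrightarrow> (y, z) \<in> smaller \<Longrightarrow> (x, z) \<in> smaller"
  by (auto simp: smaller_def)

lemma keys_lt: "w \<in> Poly_Mapping.keys (lt x) \<Longrightarrow> \<exists>g\<in>Poly_Mapping.keys x. w = [g]"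
  using keys_lin_ext[of x "\<lambda>a. word [a]" "(\<lambda>g. [g]) ` Poly_Mapping.keys x"] by auto

lemma keys_rw:
  assumes "x \<in> Poly_Mapping.keys (rw a b)"
  shows "(x = [b, a] \<and> a \<noteq> b) \<or> (\<exists>g\<in>Poly_Mapping.keys (br a b). x = [g])"
proof (cases "a = b")
  case True
  with assms show ?thesis
    using keys_psmult[of "1/2" "lt (br b b)"] keys_lt[of x "br b b"] by (auto simp: rw_def)
next
  case False
  with assms have "x \<in> Poly_Mapping.keys (psmult (sg a b) (word [b, a])) \<union> Poly_Mapping.keys (lt (br a b))"
    using keys_add by (force simp: rw_def)
  with False show ?thesis
    using keys_psmult[of "sg a b" "word [b, a]"] keys_lt[of x "br a b"] by auto
qed

lemma rw_smaller:
  assumes "bad a b" "x \<in> Poly_Mapping.keys (rw a b)"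
  shows "(u @ x @ v, u @ a # b # v) \<in> smaller"
  using keys_rw[OF assms(2)] assms(1) smaller_swap[of b a u v]
  by (auto simp: bad_def smaller_length)

text \<open>A choice of one bad adjacent pair in a word that is not normal, with its context.\<close>

definition redex :: "'a list \<Rightarrow> 'a list \<times> 'a \<times> 'a \<times> 'a list" where
  "redex w = (SOME (u, a, b, v). w = u @ a # b # v \<and> bad a b)"

lemma redex:
  assumes "\<not> normal w" "redex w = (u, a, b, v)"
  shows "w = u @ a # b # v" "bad a b"
proof -
  let ?P = "\<lambda>(u, a, b, v). w = u @ a # b # v \<and> bad a b"
  obtain u' a' b' v' where "w = u' @ a' # b' # v'" "bad a' b'"
    using assms(1) unfolding normal_def by blast
  then have "?P (u', a', b', v')" by (simp only: prod.case)
  then have "?P (redex w)"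
    unfolding redex_def by (rule someI)
  then show "w = u @ a # b # v" "bad a b" by (simp_all only: assms(2) prod.case)
qed

lemma redex_smaller:
  assumes "\<not> normal w" "(u, a, b, v) = redex w" "x \<in> Poly_Mapping.keys (rw a b)"
  shows "(u @ x @ v, w) \<in> smaller"
  using redex[OF assms(1) assms(2)[symmetric]] rw_smaller[of a b x u v] assms(3) by metis

text \<open>Normal form of a word, obtained by rewriting one chosen bad pair after another.\<close>

function nf :: "'a list \<Rightarrow> 'a wd" where
  "nf w = (if normal w then word w else
     (case redex w of (u, a, b, v) \<Rightarrow>
        (\<Sum>x\<in>Poly_Mapping.keys (rw a b). psmult (Poly_Mapping.lookup (rw a b) x) (nf (u @ x @ v)))))"
  by auto
termination
  by (relation smaller) (auto simp: wf_smaller intro: redex_smaller)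

declare nf.simps [simp del]

abbreviation NF :: "'a wd \<Rightarrow> 'a wd" where
  "NF \<equiv> lin_ext nf"

text \<open>The normal form of \<open>u p v\<close>, as a function of \<open>p\<close>.\<close>

definition nfc :: "'a list \<Rightarrow> 'a wd \<Rightarrow> 'a list \<Rightarrow> 'a wd" where
  "nfc u p v = NF (word u * p * word v)"

lemma nfc_add: "nfc u (p + q) v = nfc u p v + nfc u q v"
  by (simp add: nfc_def distrib_left distrib_right lin_ext_add)

lemma nfc_psmult: "nfc u (psmult z p) v = psmult z (nfc u p v)"
  by (simp add: nfc_def psmult_mult lin_ext_psmult)

lemma nfc_diff: "nfc u (p - q) v = nfc u p v - nfc u q v"
  by (simp add: nfc_def left_diff_distrib right_diff_distrib lin_ext_diff)

lemma nfc_zero: "nfc u 0 v = 0"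
  by (simp add: nfc_def)

lemma nfc_word: "nfc u (word w) v = nf (u @ w @ v)"
  by (simp add: nfc_def word_mult)

lemma nfc_expand: "nfc u p v = lin_ext (\<lambda>x. nf (u @ x @ v)) p"
  by (rule lin_ext_eqI[of "\<lambda>p. nfc u p v" p]) (simp_all add: nfc_add nfc_psmult nfc_word)

lemma nfc_append_left: "nfc u (word x * p) v = nfc (u @ x) p v"
  by (simp add: nfc_def word_mult flip: mult.assoc)

lemma nfc_append_right: "nfc u (p * word x) v = nfc u p (x @ v)"
  by (simp add: nfc_def word_mult mult.assoc)

lemma nf_normal: "normal w \<Longrightarrow> nf w = word w"
  by (subst nf.simps) simp

lemma nf_redex:
  assumes "\<not> normal w" "redex w = (u, a, b, v)"
  shows "nf w = nfc u (rw a b) v"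
  using assms by (subst nf.simps) (simp add: nfc_expand lin_ext_def)

text \<open>The normal form of the word does not depend on the bad pair that is rewritten first.\<close>

definition confluent :: "'a list \<Rightarrow> bool" where
  "confluent w \<longleftrightarrow> (\<forall>u a b v. w = u @ a # b # v \<longrightarrow> bad a b \<longrightarrow> nf w = nfc u (rw a b) v)"

lemma confluentD: "confluent (u @ a # b # v) \<Longrightarrow> bad a b \<Longrightarrow> nf (u @ a # b # v) = nfc u (rw a b) v"
  by (auto simp: confluent_def)

lemma confluent_eq:
  "confluent (u @ a # b # v) \<Longrightarrow> bad a b \<Longrightarrow> nfc u (word [a, b] - rw a b) v = 0"
  by (simp add: nfc_diff nfc_word confluentD)

lemma lt_skew: "lt (br b a) = - psmult (sg a b) (lt (br a b))"
  by (subst skew[of b a]) (simp add: lin_ext_simps)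

lemma rel_skew: "rel b a = - psmult (sg a b) (rel a b)"
  unfolding rel_def lt_skew[of b a]
  by (simp add: pm.scale_right_diff_distrib ssign_commute[of "par b"])

lemma rel_self_even:
  assumes "par a = 0"
  shows "rel a a = 0"
proof -
  have "br a a = - br a a" using skew[of a a] assms by simp
  then have "Poly_Mapping.lookup (br a a) k = - Poly_Mapping.lookup (br a a) k" for k
    by (metis lookup_uminus)
  then have "br a a = 0" by (intro poly_mapping_eqI) (simp add: eq_neg_iff_add_eq_0)
  with assms show ?thesis by (simp add: rel_def)
qed

lemma rel_bad:
  assumes "bad a b"
  shows "rel a b = (if a = b then psmult 2 (word [a, b] - rw a b) else word [a, b] - rw a b)"
proof (cases "a = b")
  case True
  with assms have "sg a b = -1" by (auto simp: bad_def ssign_def)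
  moreover have "x + x = psmult 2 x" for x :: "'a wd"
    by (metis mult_2 one_add_one pm.scale_left_distrib pm.scale_one)
  ultimately show ?thesis using True
    by (simp add: rel_def rw_def pm.scale_right_diff_distrib)
qed (auto simp: rel_def rw_def)

text \<open>If bad pairs may be rewritten at this place, the relation holds there for any two letters.\<close>

lemma rel_confluent:
  assumes "\<And>x y. {x, y} = {a, b} \<Longrightarrow> confluent (u @ x # y # v)"
  shows "nfc u (rel a b) v = 0"
proof -
  consider "bad a b" | "bad b a" | "a = b" "par a = 0"
  proof -
    have "par a = 0 \<or> par a = 1" by (cases "par a") auto
    with that rk_inj[of a b] show thesis
      unfolding bad_def by (meson linorder_neqE)
  qed
  then show ?thesis
  proof cases
    case 1
    then show ?thesis using confluent_eq[of u a b v] assms[of a b]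
      by (auto simp: rel_bad nfc_psmult)
  next
    case 2
    then have "nfc u (rel b a) v = 0" using confluent_eq[of u b a v] assms[of b a]
      by (auto simp: rel_bad nfc_psmult)
    moreover have "rel a b = psmult (- sg a b) (rel b a)"
      by (subst rel_skew) (simp add: ssign_commute[of "par b"])
    ultimately show ?thesis by (simp only: nfc_psmult) simp
  qed (simp add: rel_self_even nfc_zero)
qed

text \<open>
  Two linear extensions of the relation between letters: one of the letters is replaced by a homogeneous
  element of the Lie superalgebra.
\<close>

lemma lt_eq_zero_left:
  assumes "\<And>x. x \<in> Poly_Mapping.keys z \<Longrightarrow> par x = i" "\<And>x y. nfc u (rel x y) v = 0"
  shows "nfc u (lt z * word [c] - psmult (ssign i (par c)) (word [c] * lt z)
     - lt (lin_ext (\<lambda>x. br x c) z)) v = 0"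
proof -
  have "lt z * word [c] - psmult (ssign i (par c)) (word [c] * lt z) - lt (lin_ext (\<lambda>x. br x c) z)
      = lin_ext (\<lambda>x. word [x, c] - psmult (ssign i (par c)) (word [c, x]) - lt (br x c)) z"
    unfolding lin_ext_mult_left lin_ext_mult_right lin_ext_pointwise lin_ext_lin_ext
    by (simp add: word_mult)
  also have "\<dots> = lin_ext (\<lambda>x. rel x c) z"
    by (rule lin_ext_cong) (simp add: rel_def assms(1))
  finally show ?thesis
    using lin_ext_eqI[of "\<lambda>z. nfc u (lin_ext (\<lambda>x. rel x c) z) v" z "\<lambda>x. 0"] assms(2)
    by (simp add: nfc_add nfc_psmult lin_ext_simps) (simp add: lin_ext_def)
qed

lemma lt_eq_zero_right:
  assumes "\<And>x. x \<in> Poly_Mapping.keys z \<Longrightarrow> par x = i" "\<And>x y. nfc u (rel x y) v = 0"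
  shows "nfc u (word [a] * lt z - psmult (ssign (par a) i) (lt z * word [a])
     - lt (lin_ext (br a) z)) v = 0"
proof -
  have "word [a] * lt z - psmult (ssign (par a) i) (lt z * word [a]) - lt (lin_ext (br a) z)
      = lin_ext (\<lambda>x. word [a, x] - psmult (ssign (par a) i) (word [x, a]) - lt (br a x)) z"
    unfolding lin_ext_mult_left lin_ext_mult_right lin_ext_pointwise lin_ext_lin_ext
    by (simp add: word_mult)
  also have "\<dots> = lin_ext (\<lambda>x. rel a x) z"
    by (rule lin_ext_cong) (simp add: rel_def assms(1))
  finally show ?thesis
    using lin_ext_eqI[of "\<lambda>z. nfc u (lin_ext (\<lambda>x. rel a x) z) v" z "\<lambda>x. 0"] assms(2)
    by (simp add: nfc_add nfc_psmult lin_ext_simps) (simp add: lin_ext_def)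
qed

lemmas nfc_linear = nfc_add nfc_diff nfc_psmult nfc_zero

text \<open>
  The critical step: in a word \<open>u a b c v\<close> in which both \<open>a b\<close> and \<open>b c\<close> are bad, rewriting either pair
  gives the same normal form.  The relations that hold for smaller words bring the longest terms of both
  results to the order \<open>c b a\<close>, and then their difference is a combination of brackets of shorter words that vanishes by the Jacobi identity.
\<close>

lemma overlap_resolves:
  assumes ab: "bad a b" and bc: "bad b c"
    and IH: "\<And>w. (w, u @ a # b # c # v) \<in> smaller \<Longrightarrow> confluent w"
  shows "nfc u (rw a b * word [c] - word [a] * rw b c) v = 0"
proof -
  define A B C where "A = word [a]" "B = word [b]" "C = word [c]"
  define s r q where "s = sg a b" "r = sg a c" "q = sg b c"
  have sq: "s * s = 1" "r * r = 1" "q * q = 1" "s * (s * z) = z" "r * (r * z) = z" "q * (q * z) = z" for z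
    by (auto simp: s_r_q_def ssign_def)
  define XAB XAC XBC where "XAB = lt (br a b)" "XAC = lt (br a c)" "XBC = lt (br b c)"
  have rel0: "nfc u (rel x y) v = 0" for x y
    by (intro rel_confluent IH smaller_length) simp
  have T1: "nfc u (XAB * C - psmult (r * q) (C * XAB) - lt (lin_ext (\<lambda>x. br x c) (br a b))) v = 0"
    unfolding A_B_C_def XAB_XAC_XBC_def s_r_q_def
    by (rule lt_eq_zero_left[OF par_br rel0, unfolded ssign_simps])
  have s_flip: "s = sg b a" by (simp add: s_r_q_def ssign_commute)
  have T2: "nfc u (B * XAC - psmult (s * q) (XAC * B) - lt (lin_ext (br b) (br a c))) v = 0"
    unfolding A_B_C_def XAB_XAC_XBC_def s_flip unfolding s_r_q_def
    by (rule lt_eq_zero_right[OF par_br rel0, unfolded ssign_simps])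
  have T3: "nfc u (A * XBC - psmult (s * r) (XBC * A) - lt (lin_ext (br a) (br b c))) v = 0"
    unfolding A_B_C_def XAB_XAC_XBC_def s_r_q_def
    by (rule lt_eq_zero_right[OF par_br rel0, unfolded ssign_simps])
  have J: "lt (lin_ext (br a) (br b c)) = lt (lin_ext (\<lambda>x. br x c) (br a b))
      + psmult s (lt (lin_ext (br b) (br a c)))"
    unfolding s_r_q_def by (subst jacobi) (simp add: lin_ext_simps)
  have left: "nfc u (word [x] * (word [y, z] - rw y z)) v = 0"
    if "bad y z" "(u @ x # y # z # v, u @ a # b # c # v) \<in> smaller" for x y z
    using confluent_eq[of "u @ [x]" y z v] IH that by (simp add: nfc_append_left)
  have right: "nfc u ((word [x, y] - rw x y) * word [z]) v = 0"
    if "bad x y" "(u @ x # y # z # v, u @ a # b # c # v) \<in> smaller" for x y z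
    using confluent_eq[of u x y "z # v"] IH that by (simp add: nfc_append_right)
  have sw1: "(u @ b # a # c # v, u @ a # b # c # v) \<in> smaller" if "rk b < rk a"
    using that by (rule smaller_swap)
  have sw2: "(u @ a # c # b # v, u @ a # b # c # v) \<in> smaller" if "rk c < rk b"
    using smaller_swap[of c b "u @ [a]" v] that by simp
  have sw3: "(u @ b # c # a # v, u @ b # a # c # v) \<in> smaller" if "rk c < rk a"
    using smaller_swap[of c a "u @ [b]" v] that by simp
  have sw4: "(u @ c # a # b # v, u @ a # c # b # v) \<in> smaller" if "rk c < rk a"
    using smaller_swap[of c a u "b # v"] that by simp
  \<comment> \<open>each of the two pairs is either descending or a repeated odd letter\<close>
  consider (gg) "rk b < rk a" "rk c < rk b" | (eg) "a = b" "par a = 1" "rk c < rk b"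
    | (ge) "b = c" "par b = 1" "rk b < rk a" | (ee) "a = b" "b = c" "par a = 1"
    using ab bc unfolding bad_def by blast
  then show ?thesis
  proof cases
    case gg
    then have ne: "a \<noteq> b" "b \<noteq> c" "a \<noteq> c" "rk c < rk a" by auto
    have b3: "bad a c" using ne by (simp add: bad_def)
    have z1: "nfc u (B * (A * C - psmult r (C * A) - XAC)) v = 0"
      using left[of a c b] b3 sw1 gg ne
      by (simp add: rw_def A_B_C_def s_r_q_def XAB_XAC_XBC_def word_mult diff_diff_add)
    have z2: "nfc u ((B * C - psmult q (C * B) - XBC) * A) v = 0"
      using right[of b c a] bc smaller_trans[OF sw3 sw1] gg ne
      by (simp add: rw_def A_B_C_def s_r_q_def XAB_XAC_XBC_def word_mult diff_diff_add)
    have z3: "nfc u ((A * C - psmult r (C * A) - XAC) * B) v = 0"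
      using right[of a c b] b3 sw2 gg ne
      by (simp add: rw_def A_B_C_def s_r_q_def XAB_XAC_XBC_def word_mult diff_diff_add)
    have z4: "nfc u (C * (A * B - psmult s (B * A) - XAB)) v = 0"
      using left[of a b c] ab smaller_trans[OF sw4 sw2] gg ne
      by (simp add: rw_def A_B_C_def s_r_q_def XAB_XAC_XBC_def word_mult diff_diff_add)
    have "rw a b * C - A * rw b c = psmult s (B * (A * C - psmult r (C * A) - XAC))
      + psmult (s * r) ((B * C - psmult q (C * B) - XBC) * A)
      - psmult q ((A * C - psmult r (C * A) - XAC) * B)
      - psmult (q * r) (C * (A * B - psmult s (B * A) - XAB))
      + (XAB * C - psmult (r * q) (C * XAB) - lt (lin_ext (\<lambda>x. br x c) (br a b)))
      + psmult s (B * XAC - psmult (s * q) (XAC * B) - lt (lin_ext (br b) (br a c)))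
      - (A * XBC - psmult (s * r) (XBC * A) - lt (lin_ext (br a) (br b c)))"
    proof -
      have rws: "rw a b = psmult s (B * A) + XAB" "rw b c = psmult q (C * B) + XBC"
        using ne by (simp_all add: rw_def A_B_C_def s_r_q_def XAB_XAC_XBC_def word_mult)
      show ?thesis unfolding rws J
        by (simp add: algebra_simps psmult_mult pm.scale_right_distrib pm.scale_right_diff_distrib sq)
    qed
    then show ?thesis using z1 z2 z3 z4 T1 T2 T3
      by (simp only: nfc_linear A_B_C_def) simp
  next
    case eg
    then have ne: "b \<noteq> c" "a \<noteq> c" "rk c < rk a" by auto
    have b3: "bad a c" using ne by (simp add: bad_def)
    have s: "s = -1" "q = r" "B = A" "XBC = XAC"
      using eg by (simp_all add: s_r_q_def ssign_def A_B_C_def XAB_XAC_XBC_def)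
    have z3: "nfc u ((A * C - psmult r (C * A) - XAC) * A) v = 0"
      using right[of a c a] b3 sw2 eg ne
      by (simp add: rw_def A_B_C_def s_r_q_def XAB_XAC_XBC_def word_mult diff_diff_add)
    have z4: "nfc u (C * (A * A - psmult (1/2) XAB)) v = 0"
      using left[of a a c] ab smaller_trans[OF sw4 sw2] eg ne
      by (simp add: rw_def A_B_C_def XAB_XAC_XBC_def word_mult)
    have "rw a b * C - A * rw b c = - psmult r ((A * C - psmult r (C * A) - XAC) * A)
      - C * (A * A - psmult (1/2) XAB)
      + psmult (1/2) (XAB * C - C * XAB - lt (lin_ext (\<lambda>x. br x c) (br a b)))
      - (A * XAC + psmult r (XAC * A) - lt (lin_ext (br a) (br a c)))"
    proof -
      have rws: "rw a b = psmult (1/2) XAB" "rw b c = psmult r (C * A) + XAC"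
        using ne eg by (simp_all add: rw_def A_B_C_def s_r_q_def XAB_XAC_XBC_def word_mult)
      have "lt (lin_ext (\<lambda>x. br x c) (br a b)) = psmult 2 (lt (lin_ext (br a) (br a c)))"
        using J s eg by (simp add: pm.scale_left_distrib[of 1 1, simplified] algebra_simps)
      then show ?thesis unfolding rws
        by (simp add: algebra_simps psmult_mult pm.scale_right_distrib pm.scale_right_diff_distrib sq)
    qed
    moreover have "nfc u (- x) v = - nfc u x v" for x
      using nfc_psmult[of u "-1" x v] by (simp add: psmult_minus_one)
    ultimately show ?thesis using z3 z4 T1 T3 s sq eg
      by (simp only: nfc_linear A_B_C_def) simp
  next
    case ge
    then have ne: "a \<noteq> b" "a \<noteq> c" by auto
    have s: "q = -1" "s = r" "C = B" "XAC = XAB"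
      using ge by (simp_all add: s_r_q_def ssign_def A_B_C_def XAB_XAC_XBC_def)
    have z1: "nfc u (B * (A * B - psmult s (B * A) - XAB)) v = 0"
      using left[of a b b] ab sw1 ge ne
      by (simp add: rw_def A_B_C_def s_r_q_def XAB_XAC_XBC_def word_mult diff_diff_add)
    have z2: "nfc u ((B * B - psmult (1/2) XBC) * A) v = 0"
      using right[of b b a] bc smaller_trans[OF sw3 sw1] ge
      by (simp add: rw_def A_B_C_def XAB_XAC_XBC_def word_mult)
    have "rw a b * C - A * rw b c = psmult s (B * (A * B - psmult s (B * A) - XAB))
      + (B * B - psmult (1/2) XBC) * A
      + (XAB * B + psmult s (B * XAB) - lt (lin_ext (\<lambda>x. br x c) (br a b)))
      - psmult (1/2) (A * XBC - XBC * A - lt (lin_ext (br a) (br b c)))"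
    proof -
      have rws: "rw a b = psmult s (B * A) + XAB" "rw b c = psmult (1/2) XBC"
        using ge ne by (auto simp add: rw_def A_B_C_def s_r_q_def XAB_XAC_XBC_def word_mult)
      have "lin_ext (br b) (br a b) = lin_ext (\<lambda>x. psmult s (br x b)) (br a b)"
        by (rule lin_ext_cong) (subst skew, use ge in
          \<open>auto simp: par_br s_r_q_def ssign_def\<close>)
      then have "psmult s (lin_ext (br b) (br a b)) = lin_ext (\<lambda>x. br x b) (br a b)"
        by (simp add: lin_ext_pointwise sq)
      then have "psmult s (lt (lin_ext (br b) (br a b))) = lt (lin_ext (\<lambda>x. br x b) (br a b))"
        by (metis lin_ext_psmult)
      then have "lt (lin_ext (br a) (br b c)) = psmult 2 (lt (lin_ext (\<lambda>x. br x c) (br a b)))"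
        using J ge by (simp add: pm.scale_left_distrib[of 1 1, simplified])
      then show ?thesis unfolding rws s
        by (simp add: algebra_simps psmult_mult pm.scale_right_distrib pm.scale_right_diff_distrib sq)
    qed
    then show ?thesis using z1 z2 T1 T3 s sq
      by (simp only: nfc_linear A_B_C_def) simp
  next
    case ee
    have s: "s = -1" "r = -1" "q = -1" "B = A" "C = A" "XAC = XAB" "XBC = XAB"
      using ee by (simp_all add: s_r_q_def ssign_def A_B_C_def XAB_XAC_XBC_def)
    define Y where "Y = lt (lin_ext (br a) (br b c))"
    have "lin_ext (\<lambda>x. br x a) (br a a) = lin_ext (\<lambda>x. - br a x) (br a a)"
      by (rule lin_ext_cong) (subst skew, use ee in \<open>auto simp: par_br ssign_def\<close>)
    then have "lin_ext (\<lambda>x. br x a) (br a a) = - lin_ext (br a) (br a a)"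
      by (simp add: lin_ext_def sum_negf)
    then have "Y = - Y - Y" using J ee s by (simp add: Y_def lin_ext_simps)
    then have "Y + (Y + Y) = (- Y - Y) + (Y + Y)" by (rule arg_cong)
    then have "Y + (Y + Y) = 0" by simp
    \<comment> \<open>for odd \<open>a\<close> the Jacobi identity gives \<open>3 [a, [a, a]] = 0\<close>\<close>
    then have "psmult 3 Y = 0"
      by (simp add: pm.scale_left_distrib[of 1 2, simplified] pm.scale_left_distrib[of 1 1, simplified])
    then have "Y = 0" by simp
    then have "nfc u (A * XAB - XAB * A) v = 0" using T3 s by (simp add: Y_def)
    moreover have "rw a b * C - A * rw b c = psmult (-1/2) (A * XAB - XAB * A)"
      using ee s by (simp add: rw_def A_B_C_def XAB_XAC_XBC_def psmult_mult pm.scale_right_diff_distrib)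
    ultimately show ?thesis unfolding A_B_C_def by (simp only: nfc_psmult) simp
  qed
qed

text \<open>Rewriting either of two bad pairs leads to the same result; pairs that do not overlap are independent.\<close>

lemma nf_swap_redexes:
  assumes eq: "u @ a # b # v = u' @ a' # b' # v'" and less: "length u < length u'"
    and bad: "bad a b" "bad a' b'"
    and IH: "\<And>w. (w, u @ a # b # v) \<in> smaller \<Longrightarrow> confluent w"
  shows "nfc u (rw a b) v = nfc u' (rw a' b') v'"
proof -
  from eq less obtain t where t: "u' = u @ a # t" "b # v = t @ a' # b' # v'"
    by (auto simp: append_eq_append_conv2 Cons_eq_append_conv)
  show ?thesis
  proof (cases t)
    case Nil
    with t have *: "u' = u @ [a]" "a' = b" "v = b' # v'" by auto
    have "nfc u (rw a b * word [b'] - word [a] * rw b b') v' = 0"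
      by (rule overlap_resolves) (use bad IH * in auto)
    with * show ?thesis by (simp add: nfc_diff nfc_append_left nfc_append_right)
  next
    case (Cons b1 z)
    with t have *: "u' = u @ a # b # z" "v = z @ a' # b' # v'" by auto
    have "nfc u (rw a b) v = lin_ext (\<lambda>x. nf ((u @ x @ z) @ a' # b' # v')) (rw a b)"
      by (simp add: nfc_expand *)
    also have "\<dots> = lin_ext (\<lambda>x. nfc (u @ x @ z) (rw a' b') v') (rw a b)"
      using rw_smaller[OF bad(1), of _ u v] bad(2) *
      by (intro lin_ext_cong confluentD IH) auto
    also have "\<dots> = nfc u (rw a b * word z * rw a' b') v'"
      by (rule sym, rule lin_ext_eqI[of "\<lambda>p. nfc u (p * word z * rw a' b') v'"])
        (simp_all add: nfc_linear distrib_right psmult_mult nfc_append_left word_mult)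
    also have "\<dots> = lin_ext (\<lambda>x. nfc u (rw a b) (z @ x @ v')) (rw a' b')"
      by (rule lin_ext_eqI[of "\<lambda>p. nfc u (rw a b * word z * p) v'"])
        (simp_all add: nfc_linear distrib_left psmult_mult nfc_append_right word_mult mult.assoc)
    also have "\<dots> = lin_ext (\<lambda>x. nf (u @ a # b # z @ x @ v')) (rw a' b')"
      using rw_smaller[OF bad(2), of _ u' v'] bad(1) *
      by (intro lin_ext_cong confluentD[symmetric] IH) auto
    also have "\<dots> = nfc u' (rw a' b') v'"
      by (simp add: nfc_expand *)
    finally show ?thesis .
  qed
qed

lemma confluent: "confluent w"
  using wf_smaller
proof (induction w rule: wf_induct_rule)
  case (less w)
  show ?case unfolding confluent_def
  proof (intro allI impI)
    fix u a b v assume w: "w = u @ a # b # v" and bad: "bad a b"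
    then have nn: "\<not> normal w" by (auto simp: normal_def)
    obtain u' a' b' v' where r: "redex w = (u', a', b', v')" by (metis prod_cases4)
    note r' = redex[OF nn r]
    have eq: "u @ a # b # v = u' @ a' # b' # v'" using w r' by simp
    consider "length u < length u'" | "length u' < length u" | "length u = length u'" by linarith
    then have "nfc u (rw a b) v = nfc u' (rw a' b') v'"
    proof cases
      case 1
      then show ?thesis
        using nf_swap_redexes[OF eq 1 bad r'(2)] less w by simp
    next
      case 2
      then show ?thesis
        using nf_swap_redexes[OF eq[symmetric] 2 r'(2) bad] less r'(1) by simp
    qed (use eq in auto)
    then show "nf w = nfc u (rw a b) v" using nf_redex[OF nn r] by simp
  qed
qed

text \<open>Linear independence of the normal words modulo the relations, in functional form.\<close>

theorem NF_rel: "NF (p * rel a b * q) = 0"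
proof -
  have "NF (word u * rel a b * word v) = 0" for u v
    using rel_confluent[of a b u v] confluent by (simp add: nfc_def)
  then have "NF (word u * rel a b * q) = 0" for u
    using lin_ext_eqI[of "\<lambda>q. NF (word u * rel a b * q)" q "\<lambda>x. 0"]
    by (simp add: lin_ext_simps distrib_left psmult_mult) (simp add: lin_ext_def)
  then show ?thesis
    using lin_ext_eqI[of "\<lambda>p. NF (p * rel a b * q)" p "\<lambda>x. 0"]
    by (simp add: lin_ext_simps distrib_right psmult_mult) (simp add: lin_ext_def)
qed

text \<open>Induction along the rewriting, with the freedom to use the rewriting of any bad pair.\<close>

lemma nf_induct [case_names normal rewrite]:
  assumes "\<And>w. normal w \<Longrightarrow> P w"
    "\<And>u a b v. bad a b \<Longrightarrow> nf (u @ a # b # v) = nfc u (rw a b) v \<Longrightarrow>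
       (\<And>x. x \<in> Poly_Mapping.keys (rw a b) \<Longrightarrow> P (u @ x @ v)) \<Longrightarrow> P (u @ a # b # v)"
  shows "P w"
  using wf_smaller
proof (induction w rule: wf_induct_rule)
  case (less w)
  show ?case
  proof (cases "normal w")
    case False
    then obtain u a b v where "w = u @ a # b # v" "bad a b" by (auto simp: normal_def)
    with assms(2)[of a b u v] rw_smaller[of a b _ u v] less confluentD[OF confluent]
    show ?thesis by metis
  qed (rule assms(1))
qed

end


section \<open>The structure constants of the twisted N=2 algebra\<close>

text \<open>Twice the degree, so that it is an integer on every basis element.\<close>

fun deg :: "gen \<Rightarrow> int" where
  "deg (Lg m) = 2 * m"
| "deg (Tg k) = 2 * k + 1"
| "deg (Gg q) = q"
| "deg Cg = 0"

lemma bgens_eq: "bgens = {g. deg g > 0}"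
proof (intro Set.set_eqI)
  show "g \<in> bgens \<longleftrightarrow> g \<in> {g. deg g > 0}" for g
    by (cases g) (auto simp: bgens_def)
qed

lemma neg_one_powi: "(-1 :: complex) powi p = (if even p then 1 else -1)"
  by (auto simp: power_int_def even_nat_iff)

lemma key_gbracket:
  assumes "g \<in> Poly_Mapping.keys (gbracket a b)"
  shows "deg g = deg a + deg b \<and> parity g = parity a + parity b"
  using assms
  by (cases a; cases b)
     (auto simp: in_keys_iff lookup_add lookup_single when_def hf_def split: if_splits)

lemma gbracket_skew: "gbracket b a = - psmult (ssign (parity a) (parity b)) (gbracket a b)"
proof (cases "\<exists>i j. a = Tg i \<and> b = Tg j")
  case True
  then obtain i j where ij: "a = Tg i" "b = Tg j" by blast
  show ?thesis
  proof (cases "i + j = -1")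
    case True
    then have "j = - 1 - i" by simp
    with ij show ?thesis by (intro poly_mapping_eqI) (simp add: hf_def lookup_uminus algebra_simps)
  next
    case False
    then have "2 * i + 1 + (2 * j + 1) \<noteq> 0" "2 * j + 1 + (2 * i + 1) \<noteq> 0" by presburger+
    with ij show ?thesis by simp
  qed
next
  case False
  then show ?thesis
    by (intro poly_mapping_eqI, cases a; cases b)
     (auto simp: lookup_add lookup_uminus lookup_minus lookup_single when_def hf_def ssign_def neg_one_powi
       algebra_simps add_eq_0_iff diff_divide_distrib simp del: pm.scale_minus_left)
qed

text \<open>Splitting the index of \<open>G\<close> by parity decides all conditions on parities in the brackets.\<close>

lemma gen_cases [case_names L T Ge Go C]:
  obtains m where "a = Lg m" | k where "a = Tg k" | j where "a = Gg (2 * j)" | j where "a = Gg (2 * j + 1)"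
    | "a = Cg"
proof (cases a)
  case (Gg q)
  then show ?thesis using that by (cases "even q") (auto elim!: evenE oddE)
qed (use that in auto)

lemma gbracket_C [simp]: "gbracket Cg a = 0" "gbracket a Cg = 0"
  by (cases a; simp)+

lemma div_simps:
  "(1 + 2 * (i::int)) div 2 = i" "(2 * i + 1) div 2 = i" "(2 + 2 * (i::int)) div 2 = i + 1"
  by auto

text \<open>The relations between three indices under which a central term occurs, solved for the first index.\<close>

lemma index_sums:
  "2 + (i * 2 + (j * 2 + k * 2)) = (0 :: int) \<Longrightarrow> complex_of_int i = - 1 - of_int j - of_int k"
  "i * 2 + (j * 2 + k * 2) = (0 :: int) \<Longrightarrow> complex_of_int i = - of_int j - of_int k"
  "i + (j + k) = (0 :: int) \<Longrightarrow> complex_of_int i = - of_int j - of_int k"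
  "x + (y + z) = (0 :: complex) \<Longrightarrow> x = - y - z"
proof -
  have *: "i + (j + k) = c \<Longrightarrow> complex_of_int i = of_int c - of_int j - of_int k" for i j k c :: int
    by auto
  show "2 + (i * 2 + (j * 2 + k * 2)) = (0 :: int) \<Longrightarrow> complex_of_int i = - 1 - of_int j - of_int k"
    using *[of i j k "-1"] by simp
  show "i * 2 + (j * 2 + k * 2) = (0 :: int) \<Longrightarrow> complex_of_int i = - of_int j - of_int k"
    "i + (j + k) = (0 :: int) \<Longrightarrow> complex_of_int i = - of_int j - of_int k"
    using *[of i j k 0] by simp_all
  show "x + (y + z) = (0 :: complex) \<Longrightarrow> x = - y - z"
    by (simp add: eq_diff_eq eq_neg_iff_add_eq_0 add.assoc add.commute add.left_commute)
qed

text \<open>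
  The Jacobi identity is compared coefficient by coefficient.  What simplification leaves are the
  coefficients of the central element, where the three degrees add up to zero; eliminating one index makes
  them polynomial identities.
\<close>

lemma gbracket_jacobi: "lin_ext (gbracket a) (gbracket b c) = lin_ext (\<lambda>x. gbracket x c) (gbracket a b)
       + psmult (ssign (parity a) (parity b)) (lin_ext (gbracket b) (gbracket a c))"
  apply (rule poly_mapping_eqI)
  apply (cases a rule: gen_cases; cases b rule: gen_cases; cases c rule: gen_cases; simp add: neg_one_powi ssign_def lin_ext_simps lookup_add lookup_uminus lookup_minus lookup_single hf_def div_simps split del: if_split)
  apply (simp_all add: lin_ext_simps lookup_add lookup_uminus lookup_minus lookup_single hf_def div_simps algebra_simps if_distrib[of "lin_ext _"] if_distrib[of "\<lambda>x. Poly_Mapping.lookup x _"] split del: if_split cong: if_cong)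
  apply (auto simp: when_def field_simps)
  apply ((drule index_sums), simp only:, simp add: algebra_simps power2_eq_square power3_eq_cube)+
  done


section \<open>Linear extension into modules over the complex numbers\<close>

lemma complex_field_simps [simp]:
  "carrier complex_field = UNIV" "monoid.mult complex_field = (*)" "one complex_field = 1"
  "zero complex_field = 0" "add complex_field = (+)"
  by (simp_all add: complex_field_def)

lemma cring_complex_field: "cring complex_field"
proof (rule cringI)
  show "abelian_group complex_field"
  proof (rule abelian_groupI)
    show "\<exists>y\<in>carrier complex_field. y \<oplus>\<^bsub>complex_field\<^esub> x = \<zero>\<^bsub>complex_field\<^esub>" for x
      by (auto intro: exI[of _ "- x"])
  qed auto
  show "Group.comm_monoid complex_field"
    by (rule comm_monoidI) auto
qed (auto simp: algebra_simps)

lemma basis_induct [consumes 1, case_names zero add smult basis]: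
  fixes t :: "'i \<Rightarrow>\<^sub>0 complex"
  assumes "Poly_Mapping.keys t \<subseteq> I" "P 0"
    "\<And>x y. Poly_Mapping.keys x \<subseteq> I \<Longrightarrow> Poly_Mapping.keys y \<subseteq> I \<Longrightarrow> P x \<Longrightarrow> P y \<Longrightarrow> P (x + y)"
    "\<And>z x. Poly_Mapping.keys x \<subseteq> I \<Longrightarrow> P x \<Longrightarrow> P (psmult z x)"
    "\<And>i. i \<in> I \<Longrightarrow> P (Poly_Mapping.single i 1)"
  shows "P t"
proof -
  have "t \<in> pm.span ((\<lambda>i. Poly_Mapping.single i 1) ` I)"
    by (subst expand_basis) (intro pm.span_sum pm.span_scale pm.span_base, use assms(1) in auto)
  then have "Poly_Mapping.keys t \<subseteq> I \<and> P t"
    by (rule pm_span_induct)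
      (use assms(2-5) in \<open>auto dest!: subsetD[OF keys_add] subsetD[OF keys_psmult]\<close>)
  then show ?thesis ..
qed

locale complex_module = Module.module complex_field M for M :: "'v super_module" (structure)
begin

lemma smult_cl [simp, intro]: "v \<in> carrier M \<Longrightarrow> z \<odot> v \<in> carrier M"
  using smult_closed by simp

lemma smult_add_left: "v \<in> carrier M \<Longrightarrow> (y + z) \<odot> v = y \<odot> v \<oplus> z \<odot> v"
  using smult_l_distr[of y z v] by simp

lemma smult_add_right: "v \<in> carrier M \<Longrightarrow> w \<in> carrier M \<Longrightarrow> z \<odot> (v \<oplus> w) = z \<odot> v \<oplus> z \<odot> w"
  using smult_r_distr[of z v w] by simp

lemma smult_smult: "v \<in> carrier M \<Longrightarrow> y \<odot> (z \<odot> v) = (y * z) \<odot> v"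
  using smult_assoc1[of y z v] by simp

lemma smult_1 [simp]: "v \<in> carrier M \<Longrightarrow> 1 \<odot> v = v"
  using smult_one[of v] by simp

lemma smult_0 [simp]: "v \<in> carrier M \<Longrightarrow> 0 \<odot> v = \<zero>"
  using smult_l_null[of v] by simp

lemma smult_zero [simp]: "z \<odot> \<zero> = \<zero>"
  using smult_r_null[of z] by simp

lemma minus_eq_smult: "v \<in> carrier M \<Longrightarrow> \<ominus> v = (-1) \<odot> v"
proof -
  assume v: "v \<in> carrier M"
  have "(-1) \<odot> v \<oplus> v = \<zero>"
    using smult_add_left[of v "-1" 1] v by simp
  with v show ?thesis by (intro M.minus_equality) auto
qed

lemma diff_eq_smult: "v \<in> carrier M \<Longrightarrow> w \<in> carrier M \<Longrightarrow> v \<ominus> w = v \<oplus> (-1) \<odot> w"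
  by (simp add: a_minus_def minus_eq_smult)

lemma smult_eq_zero: "z \<odot> v = \<zero> \<Longrightarrow> v \<in> carrier M \<Longrightarrow> z \<noteq> 0 \<Longrightarrow> v = \<zero>"
  using smult_smult[of v "1/z" z] by simp

lemma diff_zero_iff: "v \<in> carrier M \<Longrightarrow> w \<in> carrier M \<Longrightarrow> v \<ominus> w = \<zero> \<longleftrightarrow> v = w"
  using M.minus_equality[of v "\<ominus> w"] by (auto simp: a_minus_def M.r_neg)

text \<open>Evaluation in \<open>M\<close> of a formal linear combination of indices \<open>i\<close> standing for vectors \<open>f i\<close>.\<close>

definition mlin :: "('i \<Rightarrow> 'v) \<Rightarrow> ('i \<Rightarrow>\<^sub>0 complex) \<Rightarrow> 'v" where
  "mlin f t = finsum M (\<lambda>i. Poly_Mapping.lookup t i \<odot> f i) (Poly_Mapping.keys t)"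

lemma mlin_superset:
  assumes "finite S" "Poly_Mapping.keys t \<subseteq> S" "\<And>i. i \<in> S \<Longrightarrow> f i \<in> carrier M"
  shows "mlin f t = finsum M (\<lambda>i. Poly_Mapping.lookup t i \<odot> f i) S"
  unfolding mlin_def
  by (rule M.add.finprod_mono_neutral_cong_left) (use assms in \<open>auto simp: in_keys_iff\<close>)

lemma mlin_closed:
  "(\<And>i. i \<in> Poly_Mapping.keys t \<Longrightarrow> f i \<in> carrier M) \<Longrightarrow> mlin f t \<in> carrier M"
  unfolding mlin_def by (rule M.finsum_closed) auto

lemma mlin_zero [simp]: "mlin f 0 = \<zero>"
  by (simp add: mlin_def)

lemma mlin_basis: "f i \<in> carrier M \<Longrightarrow> mlin f (Poly_Mapping.single i 1) = f i"
  by (simp add: mlin_def)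

lemma mlin_add:
  assumes "\<And>i. i \<in> I \<Longrightarrow> f i \<in> carrier M" "Poly_Mapping.keys s \<subseteq> I" "Poly_Mapping.keys t \<subseteq> I"
  shows "mlin f (s + t) = mlin f s \<oplus> mlin f t"
proof -
  let ?S = "Poly_Mapping.keys s \<union> Poly_Mapping.keys t"
  have cl: "\<And>i. i \<in> ?S \<Longrightarrow> f i \<in> carrier M" using assms by auto
  have k: "Poly_Mapping.keys (s + t) \<subseteq> ?S" by (rule keys_add)
  have "mlin f (s + t) = finsum M (\<lambda>i. (Poly_Mapping.lookup s i \<odot> f i) \<oplus> (Poly_Mapping.lookup t i \<odot> f i)) ?S"
    by (subst mlin_superset[OF _ k cl], simp, simp)
       (intro M.finsum_cong', use cl in \<open>auto simp: lookup_add smult_add_left\<close>)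
  also have "\<dots> = finsum M (\<lambda>i. Poly_Mapping.lookup s i \<odot> f i) ?S \<oplus> finsum M (\<lambda>i. Poly_Mapping.lookup t i \<odot> f i) ?S"
    by (rule M.finsum_addf) (use cl in auto)
  also have "\<dots> = mlin f s \<oplus> mlin f t"
    using mlin_superset[of ?S s f] mlin_superset[of ?S t f] cl by simp
  finally show ?thesis .
qed

lemma mlin_smult:
  assumes "\<And>i. i \<in> Poly_Mapping.keys t \<Longrightarrow> f i \<in> carrier M"
  shows "mlin f (psmult z t) = z \<odot> mlin f t"
proof -
  have "mlin f (psmult z t) = finsum M (\<lambda>i. z \<odot> (Poly_Mapping.lookup t i \<odot> f i)) (Poly_Mapping.keys t)"
    by (subst mlin_superset[OF _ keys_psmult assms], simp, simp)
      (intro M.finsum_cong', use assms in \<open>auto simp: smult_smult\<close>)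
  also have "\<dots> = z \<odot> mlin f t"
    unfolding mlin_def
    using finsum_smult_ldistr[of "Poly_Mapping.keys t" z "\<lambda>i. Poly_Mapping.lookup t i \<odot> f i"] assms by auto
  finally show ?thesis .
qed

lemma mlin_eqI:
  assumes "Poly_Mapping.keys t \<subseteq> I" "\<And>i. i \<in> I \<Longrightarrow> f i \<in> carrier M" "h 0 = \<zero>"
    "\<And>x y. Poly_Mapping.keys x \<subseteq> I \<Longrightarrow> Poly_Mapping.keys y \<subseteq> I \<Longrightarrow> h (x + y) = h x \<oplus> h y"
    "\<And>z x. Poly_Mapping.keys x \<subseteq> I \<Longrightarrow> h (psmult z x) = z \<odot> h x"
    "\<And>i. i \<in> I \<Longrightarrow> h (Poly_Mapping.single i 1) = f i"
  shows "h t = mlin f t"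
  using assms(1)
proof (induction rule: basis_induct)
  case (add x y)
  then show ?case using mlin_add[of I f x y] assms(2,4) by simp
next
  case (smult z x)
  then show ?case using mlin_smult[of x f z] assms(2,5) by (simp add: subset_iff)
qed (use assms in \<open>auto simp: mlin_basis\<close>)

lemma mlin_lin_ext:
  fixes t :: "'a \<Rightarrow>\<^sub>0 complex"
  assumes "\<And>a. a \<in> Poly_Mapping.keys t \<Longrightarrow> Poly_Mapping.keys (g a) \<subseteq> I" "\<And>i. i \<in> I \<Longrightarrow> f i \<in> carrier M"
  shows "mlin f (lin_ext g t) = mlin (\<lambda>a. mlin f (g a)) t"
proof (rule mlin_eqI[of t "Poly_Mapping.keys t"])
  fix x y :: "'a \<Rightarrow>\<^sub>0 complex" assume *: "Poly_Mapping.keys x \<subseteq> Poly_Mapping.keys t" "Poly_Mapping.keys y \<subseteq> Poly_Mapping.keys t"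
  have k: "Poly_Mapping.keys (lin_ext g x) \<subseteq> I" "Poly_Mapping.keys (lin_ext g y) \<subseteq> I"
    using * by (intro keys_lin_ext assms(1); auto)+
  show "mlin f (lin_ext g (x + y)) = mlin f (lin_ext g x) \<oplus> mlin f (lin_ext g y)"
    unfolding lin_ext_add by (rule mlin_add[OF assms(2) k])
next
  fix x :: "'a \<Rightarrow>\<^sub>0 complex" and z assume *: "Poly_Mapping.keys x \<subseteq> Poly_Mapping.keys t"
  have k: "Poly_Mapping.keys (lin_ext g x) \<subseteq> I"
    using * by (intro keys_lin_ext assms(1); auto)
  show "mlin f (lin_ext g (psmult z x)) = z \<odot> mlin f (lin_ext g x)"
    unfolding lin_ext_psmult by (rule mlin_smult) (use k assms(2) in auto)
qed (use assms in \<open>auto intro!: mlin_closed\<close>)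

lemma mlin_cong:
  "(\<And>i. i \<in> Poly_Mapping.keys t \<Longrightarrow> f i = g i) \<Longrightarrow> (\<And>i. i \<in> Poly_Mapping.keys t \<Longrightarrow> g i \<in> carrier M)
   \<Longrightarrow> mlin f t = mlin g t"
  unfolding mlin_def by (intro M.finsum_cong') auto

lemma mlin_map:
  fixes t :: "'a \<Rightarrow>\<^sub>0 complex"
  assumes "\<And>i. i \<in> Poly_Mapping.keys t \<Longrightarrow> f i \<in> carrier M"
    and h: "\<And>v. v \<in> carrier M \<Longrightarrow> h v \<in> carrier M"
      "\<And>v w. v \<in> carrier M \<Longrightarrow> w \<in> carrier M \<Longrightarrow> h (v \<oplus> w) = h v \<oplus> h w"
      "\<And>z v. v \<in> carrier M \<Longrightarrow> h (z \<odot> v) = z \<odot> h v"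
  shows "h (mlin f t) = mlin (\<lambda>i. h (f i)) t"
proof (rule mlin_eqI[of t "Poly_Mapping.keys t"])
  show "h (mlin f 0) = \<zero>" using h(3)[of \<zero> 0] h(1) by simp
next
  fix x y :: "'a \<Rightarrow>\<^sub>0 complex" assume *: "Poly_Mapping.keys x \<subseteq> Poly_Mapping.keys t" "Poly_Mapping.keys y \<subseteq> Poly_Mapping.keys t"
  then show "h (mlin f (x + y)) = h (mlin f x) \<oplus> h (mlin f y)"
    using mlin_add[of "Poly_Mapping.keys t" f x y] h(2) mlin_closed[of x f] mlin_closed[of y f] assms(1)
    by (simp add: subset_iff)
next
  fix x :: "'a \<Rightarrow>\<^sub>0 complex" and z assume *: "Poly_Mapping.keys x \<subseteq> Poly_Mapping.keys t"
  then show "h (mlin f (psmult z x)) = z \<odot> h (mlin f x)"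
    using mlin_smult[of x f z] h(3) mlin_closed[of x f] assms(1) by (simp add: subset_iff)
qed (use assms in \<open>auto simp: mlin_basis\<close>)

lemma mlin_in_submodule:
  assumes "submodule W complex_field M" "\<And>i. i \<in> Poly_Mapping.keys t \<Longrightarrow> f i \<in> W"
  shows "mlin f t \<in> W"
proof -
  note W = submoduleE[OF assms(1)]
  have 0: "\<zero> \<in> W" using W(2) W(4)[of 0] W(1) by (metis complex_field_simps(1) UNIV_I ex_in_conv smult_0 subsetD)
  have cl: "i \<in> Poly_Mapping.keys t \<Longrightarrow> f i \<in> carrier M" for i using W(1) assms(2) by blast
  have "Poly_Mapping.keys t \<subseteq> Poly_Mapping.keys t" by simp
  then show ?thesis
  proof (induction t rule: basis_induct)
    case (add x y)
    then show ?case using mlin_add[OF cl add(1,2)] W(5) by simp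
  next
    case (smult z x)
    have "mlin f (psmult z x) = z \<odot> mlin f x"
      by (rule mlin_smult) (use cl smult(1) in blast)
    then show ?case using smult W(4) by simp
  next
    case (basis i)
    then show ?case using cl assms(2) by (simp add: mlin_basis)
  qed (simp add: 0)
qed

end


section \<open>Modules over the positive part\<close>

text \<open>
  The rank puts the basis elements of degree at most zero, except the central one, before those of
  \<open>\<bb> \<oplus> \<complex>C\<close>.
\<close>

fun gen_rank :: "gen \<Rightarrow> int" where
  "gen_rank (Lg m) = 4 * (m - 1)"
| "gen_rank (Tg k) = 4 * k + 1"
| "gen_rank (Gg q) = 4 * (q - 1) + 2"
| "gen_rank Cg = 3"

abbreviation bCgens :: "gen set" where
  "bCgens \<equiv> insert Cg bgens"

lemma gen_rank_nonneg: "g \<in> bCgens \<longleftrightarrow> 0 \<le> gen_rank g"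
  by (cases g) (auto simp: bgens_eq)

lemma gen_rank_inj:
  assumes "gen_rank a = gen_rank b"
  shows "a = b"
  using assms by (cases a; cases b; simp; presburger)

text \<open>The twisted algebra satisfies the assumptions of the Poincare-Birkhoff-Witt theorem.\<close>

interpretation tw: lie_superalgebra_basis parity gbracket gen_rank
proof
  show "gbracket b a = - psmult (ssign (parity a) (parity b)) (gbracket a b)" for a b
    by (rule gbracket_skew)
  show "lin_ext (gbracket a) (gbracket b c) = lin_ext (\<lambda>x. gbracket x c) (gbracket a b)
       + psmult (ssign (parity a) (parity b)) (lin_ext (gbracket b) (gbracket a c))" for a b c
    by (rule gbracket_jacobi)
qed (use key_gbracket gen_rank_inj in auto)

lemma tw_to_falg_eq: "tw_to_falg = lin_ext (\<lambda>a. word [a])"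
  by (rule ext) (simp add: tw_to_falg_def lin_ext_def letter_def)

lemma env_rel_eq: "env_rel a b = tw.rel a b"
  by (simp add: env_rel_def tw.rel_def letter_def word_mult tw_to_falg_eq)

lemma NF_env_ideal: "x \<in> env_ideal \<Longrightarrow> tw.NF x = 0"
  by (induction rule: env_ideal.induct) (simp_all add: env_rel_eq tw.NF_rel lin_ext_add)

lemma env_ideal_psmult: "x \<in> env_ideal \<Longrightarrow> psmult z x \<in> env_ideal"
  by (simp add: psmult_conv_mult env_ideal_mult_left)

lemma subspace_env_ideal: "pm.subspace env_ideal"
  by (simp add: pm.subspace_def env_ideal.intros env_ideal_psmult)

lemma rw_env_ideal:
  assumes "tw.bad a b"
  shows "word [a, b] - tw.rw a b \<in> env_ideal"
proof -
  have "tw.rel a b \<in> env_ideal"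
    using env_ideal.rel[of 1 a b 1] by (simp add: env_rel_eq)
  from this env_ideal_psmult[OF this, of "1/2"] show ?thesis
    using tw.rel_bad[OF assms] by (auto split: if_splits)
qed

text \<open>Rewriting does not change the class of a word in the enveloping algebra.\<close>

lemma nf_env_ideal: "word w - tw.nf w \<in> env_ideal"
proof (induction w rule: tw.nf_induct)
  case (normal w)
  then show ?case by (simp add: tw.nf_normal env_ideal.zero)
next
  case (rewrite u a b v)
  have "word (u @ a # b # v) - tw.nf (u @ a # b # v) =
      word u * (word [a, b] - tw.rw a b) * word v + (word u * tw.rw a b * word v - tw.nfc u (tw.rw a b) v)"
    by (simp add: rewrite(2) algebra_simps word_mult)
  also have "word u * tw.rw a b * word v - tw.nfc u (tw.rw a b) v
      = lin_ext (\<lambda>x. word (u @ x @ v) - tw.nf (u @ x @ v)) (tw.rw a b)"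
  proof -
    have "word u * tw.rw a b * word v = lin_ext (\<lambda>x. word (u @ x @ v)) (tw.rw a b)"
      by (rule lin_ext_eqI[of "\<lambda>p. word u * p * word v"])
        (simp_all add: distrib_left distrib_right psmult_mult word_mult)
    then show ?thesis by (simp add: tw.nfc_expand lin_ext_pointwise)
  qed
  finally show ?case
    using rewrite(3) env_ideal_mult_left env_ideal_mult_right rw_env_ideal[OF rewrite(1)]
    by (auto intro!: env_ideal.add lin_ext_in_subspace[OF subspace_env_ideal])
qed

lemma NF_env_ideal_diff: "x - tw.NF x \<in> env_ideal"
proof -
  have "x - tw.NF x = lin_ext (\<lambda>w. word w - tw.nf w) x"
    by (simp add: lin_ext_pointwise lin_ext_id)
  then show ?thesis
    using lin_ext_in_subspace[OF subspace_env_ideal, of x "\<lambda>w. word w - tw.nf w"] nf_env_ideal by simp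
qed

lemma lists_iff: "w \<in> lists A \<longleftrightarrow> set w \<subseteq> A"
  by auto

lemma Cg_bgens [simp]: "Cg \<notin> bgens"
  by (simp add: bgens_eq)

lemma falg_bC_eq: "falg_bC = {p. Poly_Mapping.keys p \<subseteq> lists bCgens}"
  by (auto simp: falg_bC_def lists_iff)

lemma subspace_falg_bC: "pm.subspace falg_bC"
  by (auto simp: pm.subspace_def falg_bC_eq dest!: subsetD[OF keys_add] subsetD[OF keys_psmult])

lemma gbracket_bC:
  assumes "a \<in> bCgens" "b \<in> bCgens"
  shows "gbracket a b \<in> b_alg"
proof (cases "a = Cg \<or> b = Cg")
  case False
  with assms key_gbracket[of _ a b] show ?thesis
    by (fastforce simp: b_alg_def bgens_eq)
qed (auto simp: b_alg_def)

lemma rw_bC: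
  assumes "a \<in> bCgens" "b \<in> bCgens" "x \<in> Poly_Mapping.keys (tw.rw a b)"
  shows "set x \<subseteq> bCgens"
  using tw.keys_rw[OF assms(3)] assms(1,2) gbracket_bC[OF assms(1,2)] by (auto simp: b_alg_def)

lemma nf_bC: "set w \<subseteq> bCgens \<Longrightarrow> tw.nf w \<in> falg_bC"
proof (induction w rule: tw.nf_induct)
  case (normal w)
  then show ?case by (simp add: tw.nf_normal falg_bC_def)
next
  case (rewrite u a b v)
  show ?case
    unfolding rewrite(2) tw.nfc_expand
    by (rule lin_ext_in_subspace[OF subspace_falg_bC], rule rewrite(3))
      (use rw_bC[of a b] rewrite(4) in auto)
qed

lemma bracket_basis: "bracket (basis a) (basis b) = gbracket a b"
  by (simp add: bracket_def)

sublocale supermodule \<subseteq> complex_module M ..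

text \<open>
  A \<open>\<bb>\<close>-module together with the scalar \<open>c\<close> by which the central element acts.  The operator \<open>ga a\<close>
  is meaningful for basis elements \<open>a\<close> of \<open>\<bb> \<oplus> \<complex>C\<close> only.
\<close>

locale b_module = supermodule b_alg M for M :: "'v super_module" (structure) +
  fixes c :: complex
begin

abbreviation ga :: "gen \<Rightarrow> 'v \<Rightarrow> 'v" where
  "ga \<equiv> gen_act c M"

lemma basis_b_alg: "a \<in> bgens \<Longrightarrow> basis a \<in> b_alg"
  by (simp add: b_alg_def)

lemma ga_Cg: "ga Cg v = c \<odot> v"
  by (simp add: gen_act_def)

lemma ga_basis: "a \<in> bgens \<Longrightarrow> ga a v = act M (basis a) v"
  by (auto simp: gen_act_def)

lemma ga_closed [simp]: "a \<in> bCgens \<Longrightarrow> v \<in> carrier M \<Longrightarrow> ga a v \<in> carrier M"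
  by (auto simp: gen_act_def intro!: act_closed basis_b_alg)

lemma ga_add: "a \<in> bCgens \<Longrightarrow> v \<in> carrier M \<Longrightarrow> w \<in> carrier M \<Longrightarrow> ga a (v \<oplus> w) = ga a v \<oplus> ga a w"
  by (auto simp: gen_act_def smult_add_right intro!: act_add_right basis_b_alg)

lemma ga_smult: "a \<in> bCgens \<Longrightarrow> v \<in> carrier M \<Longrightarrow> ga a (z \<odot> v) = z \<odot> ga a v"
  by (auto simp: gen_act_def smult_smult mult.commute intro!: act_smult_right basis_b_alg)

lemma word_act_simps [simp]:
  "word_act c M [] v = v" "word_act c M (a # w) v = ga a (word_act c M w v)"
  "word_act c M (u @ w) v = word_act c M u (word_act c M w v)"
  by (simp_all add: word_act_def)

lemma word_act_closed [simp]: "set w \<subseteq> bCgens \<Longrightarrow> v \<in> carrier M \<Longrightarrow> word_act c M w v \<in> carrier M"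
  by (induction w) auto

lemma word_act_add: "set w \<subseteq> bCgens \<Longrightarrow> v \<in> carrier M \<Longrightarrow> v' \<in> carrier M \<Longrightarrow>
    word_act c M w (v \<oplus> v') = word_act c M w v \<oplus> word_act c M w v'"
  by (induction w) (auto simp: ga_add)

lemma word_act_smult: "set w \<subseteq> bCgens \<Longrightarrow> v \<in> carrier M \<Longrightarrow>
    word_act c M w (z \<odot> v) = z \<odot> word_act c M w v"
  by (induction w) (auto simp: ga_smult)

lemma falg_act_eq: "falg_act c M p v = mlin (\<lambda>w. word_act c M w v) p"
  by (simp add: falg_act_def mlin_def)

lemma falg_act_closed [simp]: "p \<in> falg_bC \<Longrightarrow> v \<in> carrier M \<Longrightarrow> falg_act c M p v \<in> carrier M"
  unfolding falg_act_eq by (rule mlin_closed) (auto simp: falg_bC_def)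

lemma falg_act_add:
  "p \<in> falg_bC \<Longrightarrow> q \<in> falg_bC \<Longrightarrow> v \<in> carrier M \<Longrightarrow>
   falg_act c M (p + q) v = falg_act c M p v \<oplus> falg_act c M q v"
  unfolding falg_act_eq by (rule mlin_add[of "lists bCgens"]) (auto simp: falg_bC_eq lists_iff)

lemma falg_act_psmult:
  "p \<in> falg_bC \<Longrightarrow> v \<in> carrier M \<Longrightarrow> falg_act c M (psmult z p) v = z \<odot> falg_act c M p v"
  unfolding falg_act_eq by (rule mlin_smult) (auto simp: falg_bC_def)

lemma falg_act_diff:
  "p \<in> falg_bC \<Longrightarrow> q \<in> falg_bC \<Longrightarrow> v \<in> carrier M \<Longrightarrow>
   falg_act c M (p - q) v = falg_act c M p v \<ominus> falg_act c M q v"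
  using falg_act_add[of p "psmult (-1) q" v] falg_act_psmult[of q v "-1"]
    pm.subspace_scale[OF subspace_falg_bC, of q "-1"]
  by (simp add: diff_eq_smult psmult_minus_one)

lemma falg_act_word [simp]: "set w \<subseteq> bCgens \<Longrightarrow> v \<in> carrier M \<Longrightarrow> falg_act c M (word w) v = word_act c M w v"
  unfolding falg_act_eq by (rule mlin_basis) auto

lemma falg_act_linear:
  assumes "p \<in> falg_bC"
  shows "v \<in> carrier M \<Longrightarrow> w \<in> carrier M \<Longrightarrow> falg_act c M p (v \<oplus> w) = falg_act c M p v \<oplus> falg_act c M p w"
    and "v \<in> carrier M \<Longrightarrow> falg_act c M p (z \<odot> v) = z \<odot> falg_act c M p v"
proof -
  have p: "Poly_Mapping.keys p \<subseteq> lists bCgens" using assms by (simp add: falg_bC_eq)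
  show "falg_act c M p (v \<oplus> w) = falg_act c M p v \<oplus> falg_act c M p w" if "v \<in> carrier M" "w \<in> carrier M"
    using p
  proof (induction rule: basis_induct)
    case (add x y)
    then show ?case using that by (simp add: falg_bC_eq falg_act_add M.a_ac)
  next
    case (smult z x)
    then show ?case using that by (simp add: falg_bC_eq falg_act_psmult smult_add_right)
  next
    case (basis i)
    then show ?case using that by (simp add: lists_iff word_act_add)
  qed (simp add: falg_act_eq)
  show "falg_act c M p (z \<odot> v) = z \<odot> falg_act c M p v" if "v \<in> carrier M"
    using p
  proof (induction rule: basis_induct)
    case (add x y)
    then show ?case using that by (simp add: falg_bC_eq falg_act_add smult_add_right)
  next
    case (smult z x)
    then show ?case using that by (simp add: falg_bC_eq falg_act_psmult smult_smult mult.commute)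
  next
    case (basis i)
    then show ?case using that by (simp add: lists_iff word_act_smult)
  qed (simp add: falg_act_eq)
qed

lemma falg_bC_mult: "p \<in> falg_bC \<Longrightarrow> q \<in> falg_bC \<Longrightarrow> p * q \<in> falg_bC"
  using keys_mult[of p q] by (fastforce simp: falg_bC_eq plus_list_def)

lemma falg_act_word_mult:
  assumes "set w \<subseteq> bCgens" "q \<in> falg_bC" "v \<in> carrier M"
  shows "falg_act c M (word w * q) v = word_act c M w (falg_act c M q v)"
proof -
  have w: "word w * x \<in> falg_bC" if "x \<in> falg_bC" for x
    using that assms(1) by (intro falg_bC_mult) (auto simp: falg_bC_def)
  have "Poly_Mapping.keys q \<subseteq> lists bCgens" using assms(2) by (simp add: falg_bC_eq)
  then show ?thesis
  proof (induction rule: basis_induct)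
    case (add x y)
    then show ?case using assms w[of x] w[of y]
      by (simp add: falg_bC_eq falg_act_add distrib_left word_act_add)
  next
    case (smult z x)
    then show ?case using assms w[of x]
      by (simp add: falg_bC_eq falg_act_psmult psmult_mult word_act_smult)
  next
    case (basis i)
    then show ?case using assms by (simp add: lists_iff word_mult)
  next
    case zero
    have "word_act c M w \<zero> = \<zero>"
      using word_act_smult[of w \<zero> 0] assms(1) by simp
    then show ?case by (simp add: falg_act_eq)
  qed
qed

lemma falg_act_mult:
  assumes "p \<in> falg_bC" "q \<in> falg_bC" "v \<in> carrier M"
  shows "falg_act c M (p * q) v = falg_act c M p (falg_act c M q v)"
proof -
  have "Poly_Mapping.keys p \<subseteq> lists bCgens" using assms by (simp add: falg_bC_eq)
  then show ?thesis
  proof (induction rule: basis_induct)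
    case (add x y)
    then have "x \<in> falg_bC" "y \<in> falg_bC" by (simp_all add: falg_bC_eq)
    with add assms show ?case by (simp add: falg_act_add distrib_right falg_bC_mult)
  next
    case (smult z x)
    then have "x \<in> falg_bC" by (simp add: falg_bC_eq)
    with smult assms show ?case by (simp add: falg_act_psmult psmult_mult falg_bC_mult)
  next
    case (basis i)
    then have "set i \<subseteq> bCgens" by (auto simp: lists_iff)
    with assms show ?case by (simp add: falg_act_word_mult)
  qed (simp add: falg_act_eq)
qed

lemma act_expand:
  assumes "x \<in> b_alg" "v \<in> carrier M"
  shows "act M x v = falg_act c M (tw_to_falg x) v"
proof -
  have x: "Poly_Mapping.keys x \<subseteq> bgens" using assms(1) by (simp add: b_alg_def)
  have "0 \<in> b_alg" by (simp add: b_alg_def)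
  then have "act M 0 v = \<zero>"
    using act_smult_left[of 0 v 0] act_closed[of 0 v] assms(2) by simp
  then have "act M x v = mlin (\<lambda>a. act M (basis a) v) x"
    using x assms(2) by (intro mlin_eqI[of x bgens "\<lambda>a. act M (basis a) v" "\<lambda>x. act M x v"])
      (auto simp: b_alg_def act_closed act_add_left act_smult_left)
  also have "\<dots> = mlin (\<lambda>a. falg_act c M (word [a]) v) x"
    using assms(2) subsetD[OF x] by (intro mlin_cong) (auto simp: ga_basis[symmetric])
  also have "\<dots> = falg_act c M (tw_to_falg x) v"
    unfolding tw_to_falg_eq falg_act_eq
    by (rule mlin_lin_ext[symmetric, of _ _ "lists bCgens"]) (use x assms(2) in \<open>auto simp: lists_iff\<close>)
  finally show ?thesis .
qed

lemma tw_to_falg_bC: "x \<in> b_alg \<Longrightarrow> tw_to_falg x \<in> falg_bC"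
  unfolding tw_to_falg_eq
  by (rule lin_ext_in_subspace[OF subspace_falg_bC]) (auto simp: falg_bC_def b_alg_def)

lemma word_bC: "set w \<subseteq> bCgens \<Longrightarrow> word w \<in> falg_bC"
  by (auto simp: falg_bC_def)

lemma falg_act_gbracket:
  assumes "a \<in> bCgens" "b \<in> bCgens" "v \<in> carrier M"
  shows "falg_act c M (tw_to_falg (gbracket a b)) v
     = ga a (ga b v) \<ominus> ssign (parity a) (parity b) \<odot> ga b (ga a v)"
    (is "_ = _ \<ominus> ?s \<odot> _")
proof (cases "a = Cg \<or> b = Cg")
  case True
  then have "ga a (ga b v) = ga b (ga a v)" "?s = 1"
    using assms ga_smult[of a v c] ga_smult[of b v c] by (auto simp: ga_Cg)
  moreover have "falg_act c M (tw_to_falg (gbracket a b)) v = \<zero>"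
    using True by (auto simp: tw_to_falg_eq falg_act_eq)
  ultimately show ?thesis
    using assms diff_zero_iff[of "ga b (ga a v)" "ga b (ga a v)"] by simp
next
  case False
  then have ab: "a \<in> bgens" "b \<in> bgens" using assms by auto
  have "act M (bracket (basis a) (basis b)) v = act M (basis a) (act M (basis b) v)
      \<ominus> ?s \<odot> act M (basis b) (act M (basis a) v)"
    by (rule act_bracket) (use ab assms in \<open>auto simp: basis_b_alg tw_part_def\<close>)
  then show ?thesis
    using act_expand[OF gbracket_bC] assms ab False by (simp add: bracket_basis gen_act_def)
qed

text \<open>The action of words over \<open>\<bb> \<oplus> \<complex>C\<close> respects the relations, and hence (\<open>falg_act_NF\<close>) normal forms.\<close>

lemma falg_act_rel:
  assumes "a \<in> bCgens" "b \<in> bCgens" "v \<in> carrier M"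
  shows "falg_act c M (tw.rel a b) v = \<zero>"
proof -
  let ?s = "ssign (parity a) (parity b)"
  have "word [a, b] \<in> falg_bC" "word [b, a] \<in> falg_bC" "psmult ?s (word [b, a]) \<in> falg_bC"
    using assms by (auto intro!: word_bC pm.subspace_scale[OF subspace_falg_bC])
  then have "falg_act c M (tw.rel a b) v = (ga a (ga b v) \<ominus> ?s \<odot> ga b (ga a v)) \<ominus> falg_act c M (tw_to_falg (gbracket a b)) v"
    using assms gbracket_bC[OF assms(1,2)]
    by (simp add: tw.rel_def falg_act_diff falg_act_psmult tw_to_falg_bC tw_to_falg_eq[symmetric]
        pm.subspace_diff[OF subspace_falg_bC])
  then show ?thesis
    unfolding falg_act_gbracket[OF assms] using assms by (simp add: diff_zero_iff M.minus_closed)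
qed

lemma falg_act_rw:
  assumes "a \<in> bCgens" "b \<in> bCgens" "v \<in> carrier M" "tw.bad a b"
  shows "falg_act c M (tw.rw a b) v = word_act c M [a, b] v"
proof -
  have rw: "tw.rw a b \<in> falg_bC"
    using rw_bC[OF assms(1,2)] by (auto simp: falg_bC_def)
  have w: "word [a, b] \<in> falg_bC" using assms by (auto intro: word_bC)
  have d: "word [a, b] - tw.rw a b \<in> falg_bC"
    by (rule pm.subspace_diff[OF subspace_falg_bC w rw])
  have "falg_act c M (word [a, b] - tw.rw a b) v = \<zero>"
  proof (cases "a = b")
    case True
    then have "2 \<odot> falg_act c M (word [a, b] - tw.rw a b) v = \<zero>"
      using falg_act_rel[OF assms(1-3)] tw.rel_bad[OF assms(4)] falg_act_psmult[OF d assms(3), of 2] by simp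
    then show ?thesis using smult_eq_zero falg_act_closed[OF d assms(3)] by simp
  qed (use falg_act_rel[OF assms(1-3)] tw.rel_bad[OF assms(4)] in simp)
  then show ?thesis
    using falg_act_diff[OF w rw assms(3)] assms falg_act_closed[OF rw] by (simp add: diff_zero_iff)
qed

lemma falg_act_nf:
  "set w \<subseteq> bCgens \<Longrightarrow> v \<in> carrier M \<Longrightarrow> falg_act c M (tw.nf w) v = word_act c M w v"
proof (induction w rule: tw.nf_induct)
  case (normal w)
  then show ?case by (simp add: tw.nf_normal)
next
  case (rewrite u a b x)
  have ab: "a \<in> bCgens" "b \<in> bCgens" "set u \<subseteq> bCgens" "set x \<subseteq> bCgens" using rewrite(4) by auto
  have rw: "tw.rw a b \<in> falg_bC"
    using rw_bC[OF ab(1,2)] by (auto simp: falg_bC_def)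
  have nfb: "tw.nf (u @ y @ x) \<in> falg_bC" if "y \<in> Poly_Mapping.keys (tw.rw a b)" for y
    using rw_bC[OF ab(1,2) that] ab by (intro nf_bC) auto
  have "falg_act c M (tw.nf (u @ a # b # x)) v = mlin (\<lambda>y. falg_act c M (tw.nf (u @ y @ x)) v) (tw.rw a b)"
    unfolding rewrite(2) tw.nfc_expand falg_act_eq
    by (rule mlin_lin_ext[of _ _ "lists bCgens"]) (use nfb rewrite(5) in \<open>auto simp: falg_bC_eq lists_iff\<close>)
  also have "\<dots> = mlin (\<lambda>y. falg_act c M (word u) (falg_act c M (word y * word x) v)) (tw.rw a b)"
    using rw_bC[OF ab(1,2)] rewrite(3,5) ab
    by (intro mlin_cong) (auto simp: word_mult)
  also have "\<dots> = falg_act c M (word u) (falg_act c M (tw.rw a b) (word_act c M x v))"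
    unfolding falg_act_eq[of "tw.rw a b"]
    by (subst mlin_map[of "tw.rw a b" _ "falg_act c M (word u)"], use rw_bC[OF ab(1,2)] rewrite(5) ab in
      \<open>auto simp: falg_act_linear word_bC word_mult intro!: mlin_cong\<close>)
  also have "\<dots> = word_act c M (u @ a # b # x) v"
    using falg_act_rw[OF ab(1,2) _ rewrite(1)] ab rewrite(5) by simp
  finally show ?case .
qed

lemma falg_act_NF:
  assumes "p \<in> falg_bC" "v \<in> carrier M"
  shows "falg_act c M (tw.NF p) v = falg_act c M p v"
proof -
  have p: "w \<in> Poly_Mapping.keys p \<Longrightarrow> set w \<subseteq> bCgens" for w
    using assms(1) by (auto simp: falg_bC_def)
  have "falg_act c M (tw.NF p) v = mlin (\<lambda>w. falg_act c M (tw.nf w) v) p"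
    unfolding falg_act_eq
    by (rule mlin_lin_ext[of _ _ "lists bCgens"]) (use nf_bC p assms(2) in \<open>auto simp: falg_bC_eq lists_iff\<close>)
  also have "\<dots> = falg_act c M p v"
    unfolding falg_act_eq[of p] using p assms(2) by (intro mlin_cong) (auto simp: falg_act_nf)
  finally show ?thesis .
qed

end


section \<open>Schur's lemma\<close>

abbreviation word_parity :: "gen list \<Rightarrow> bit" where
  "word_parity w \<equiv> (\<Sum>a\<leftarrow>w. parity a)"

context complex_module
begin

lemma submodule_I:
  assumes "W \<subseteq> carrier M" "\<zero> \<in> W" "\<And>v w. v \<in> W \<Longrightarrow> w \<in> W \<Longrightarrow> v \<oplus> w \<in> W"
    "\<And>z v. v \<in> W \<Longrightarrow> z \<odot> v \<in> W"
  shows "submodule W complex_field M"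
proof (rule submoduleI)
  show "\<ominus> v \<in> W" if "v \<in> W" for v
    using assms(4)[OF that, of "-1"] minus_eq_smult[of v] assms(1) that by auto
qed (use assms in auto)

lemma submodule_D:
  assumes "submodule W complex_field M"
  shows "W \<subseteq> carrier M" "\<zero> \<in> W" "v \<in> W \<Longrightarrow> w \<in> W \<Longrightarrow> v \<oplus> w \<in> W" "v \<in> W \<Longrightarrow> z \<odot> v \<in> W"
    "v \<in> W \<Longrightarrow> w \<in> W \<Longrightarrow> v \<ominus> w \<in> W" "v \<in> W \<Longrightarrow> \<ominus> v \<in> W"
proof -
  note W = submoduleE[OF assms]
  show 1: "W \<subseteq> carrier M" by (rule W(1))
  show 2: "z \<odot> v \<in> W" if "v \<in> W" for v z using W(4) that by simp
  show "\<zero> \<in> W" using 2[of _ 0] W(2) 1 by (metis ex_in_conv smult_0 subsetD)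
  show 3: "v \<in> W \<Longrightarrow> w \<in> W \<Longrightarrow> v \<oplus> w \<in> W" for v w by (rule W(5))
  show 4: "v \<in> W \<Longrightarrow> \<ominus> v \<in> W" for v by (rule W(3))
  show "v \<in> W \<Longrightarrow> w \<in> W \<Longrightarrow> v \<ominus> w \<in> W" using 3 4 by (simp add: a_minus_def)
qed

lemma mlin_eq_zero: "(\<And>i. i \<in> Poly_Mapping.keys t \<Longrightarrow> f i = \<zero>) \<Longrightarrow> mlin f t = \<zero>"
  using mlin_cong[of t f "\<lambda>_. \<zero>"] by (simp add: mlin_def)

end

context supermodule
begin

lemmas part_D = submodule_D[OF part_submodule]

lemma part_carrier [simp]: "v \<in> part M i \<Longrightarrow> v \<in> carrier M"
  using part_D(1) by auto

lemma part_decomp: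
  assumes "v \<in> carrier M"
  obtains v0 v1 where "v0 \<in> part M 0" "v1 \<in> part M 1" "v = v0 \<oplus> v1"
  using assms unfolding part_sum set_add_def' by auto

lemma part_sum_zero:
  assumes "v0 \<in> part M 0" "v1 \<in> part M 1" "v0 \<oplus> v1 = \<zero>"
  shows "v0 = \<zero>" "v1 = \<zero>"
proof -
  have "v1 = \<ominus> v0"
    using M.minus_equality[of v1 v0] assms by (simp add: M.a_comm)
  then have "v1 \<in> part M 0" using part_D(6) assms(1) by simp
  then show "v1 = \<zero>" using part_disjoint assms(2) by auto
  with assms show "v0 = \<zero>" by simp
qed

lemma subsupermodule_I:
  assumes "submodule W complex_field M" "\<And>x w. x \<in> g \<Longrightarrow> w \<in> W \<Longrightarrow> act M x w \<in> W"
    "\<And>w. w \<in> W \<Longrightarrow> \<exists>v0\<in>W \<inter> part M 0. \<exists>v1\<in>W \<inter> part M 1. w = v0 \<oplus> v1"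
  shows "subsupermodule g M W"
  unfolding subsupermodule_def set_add_def'
  using assms submodule_D(3)[OF assms(1)] by fastforce

end

context b_module
begin

lemma ga_part: "a \<in> bCgens \<Longrightarrow> v \<in> part M j \<Longrightarrow> ga a v \<in> part M (parity a + j)"
proof (cases "a = Cg")
  case False
  assume "a \<in> bCgens" "v \<in> part M j"
  with False show ?thesis
    using act_parity[of "basis a" "parity a" v j] by (simp add: gen_act_def basis_b_alg tw_part_def)
qed (use part_D(4)[of v j c] in \<open>cases j; simp add: ga_Cg\<close>)

lemma word_act_part: "set w \<subseteq> bCgens \<Longrightarrow> v \<in> part M j \<Longrightarrow> word_act c M w v \<in> part M (word_parity w + j)"
proof (induction w)
  case (Cons a w)
  then have "ga a (word_act c M w v) \<in> part M (parity a + (word_parity w + j))"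
    by (intro ga_part) auto
  then show ?case by (simp only: word_act_simps list.map sum_list.Cons add.assoc)
qed (simp only: word_act_simps list.map sum_list.Nil add_0_left)

text \<open>The cyclic submodule generated by a homogeneous vector.\<close>

lemma cyclic_subsupermodule:
  assumes v: "v \<in> part M j"
  shows "subsupermodule b_alg M {falg_act c M p v | p. p \<in> falg_bC}" (is "subsupermodule _ _ ?W")
proof (rule subsupermodule_I)
  have vc: "v \<in> carrier M" using v by simp
  have 0: "0 \<in> falg_bC" by (simp add: falg_bC_def)
  show "submodule ?W complex_field M"
  proof (rule submodule_I)
    show "\<zero> \<in> ?W" using 0 by (auto simp: falg_act_eq intro!: exI[of _ 0])
    show "x \<oplus> y \<in> ?W" if "x \<in> ?W" "y \<in> ?W" for x y
      using that vc by (force simp flip: falg_act_add intro: pm.subspace_add[OF subspace_falg_bC])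
    show "z \<odot> x \<in> ?W" if "x \<in> ?W" for x z
      using that vc by (force simp flip: falg_act_psmult intro: pm.subspace_scale[OF subspace_falg_bC])
  qed (use vc in auto)
  show "act M x w \<in> ?W" if "x \<in> b_alg" "w \<in> ?W" for x w
  proof -
    from that(2) obtain p where p: "w = falg_act c M p v" "p \<in> falg_bC" by blast
    have "act M x w = falg_act c M (tw_to_falg x * p) v"
      using p that(1) vc by (simp add: act_expand falg_act_mult tw_to_falg_bC)
    then show ?thesis using p that(1) by (auto intro: falg_bC_mult tw_to_falg_bC)
  qed
  fix w assume "w \<in> ?W"
  then obtain p where p: "w = falg_act c M p v" "p \<in> falg_bC" by blast
  define pr where "pr i = lin_ext (\<lambda>w. if word_parity w = i then word w else 0) p" for i
  have pr: "pr i \<in> falg_bC" for i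
    unfolding pr_def by (rule lin_ext_in_subspace[OF subspace_falg_bC])
      (use p(2) in \<open>auto simp: falg_bC_def split: if_splits\<close>)
  have "p = lin_ext (\<lambda>w. (if word_parity w = j then word w else 0) + (if word_parity w = j + 1 then word w else 0)) p"
    by (subst lin_ext_id[symmetric], rule lin_ext_cong) (cases j, auto)
  then have sum: "p = pr j + pr (j + 1)" by (simp add: pr_def lin_ext_pointwise)
  have part: "falg_act c M (pr i) v \<in> part M (i + j)" for i
    unfolding falg_act_eq
  proof (rule mlin_in_submodule[OF part_submodule])
    fix w assume "w \<in> Poly_Mapping.keys (pr i)"
    moreover have "Poly_Mapping.keys (pr i) \<subseteq> {w. word_parity w = i \<and> set w \<subseteq> bCgens}"
      unfolding pr_def by (rule keys_lin_ext) (use p(2) in \<open>auto simp: falg_bC_def split: if_splits\<close>)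
    ultimately have wi: "word_parity w = i" "set w \<subseteq> bCgens" by blast+
    from word_act_part[OF wi(2) v] show "word_act c M w v \<in> part M (i + j)"
      unfolding wi(1) .
  qed
  have "w = falg_act c M (pr j) v \<oplus> falg_act c M (pr (j + 1)) v"
    using p(1) sum pr falg_act_add vc by metis
  moreover have "falg_act c M (pr j) v \<in> ?W \<inter> part M 0" "falg_act c M (pr (j + 1)) v \<in> ?W \<inter> part M 1"
    using pr part[of j] part[of "j + 1"] by (cases j; auto)+
  ultimately show "\<exists>v0\<in>?W \<inter> part M 0. \<exists>v1\<in>?W \<inter> part M 1. w = v0 \<oplus> v1" by blast
qed

text \<open>Even linear maps of \<open>M\<close>, on its carrier, that commute with \<open>\<bb> \<oplus> \<complex>C\<close>.\<close>

definition even_endo :: "('v \<Rightarrow> 'v) \<Rightarrow> bool" where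
  "even_endo h \<longleftrightarrow> (\<forall>v\<in>carrier M. h v \<in> carrier M)
     \<and> (\<forall>v\<in>carrier M. \<forall>w\<in>carrier M. h (v \<oplus> w) = h v \<oplus> h w)
     \<and> (\<forall>v\<in>carrier M. \<forall>z. h (z \<odot> v) = z \<odot> h v)
     \<and> (\<forall>i. \<forall>v\<in>part M i. h v \<in> part M i)
     \<and> (\<forall>a\<in>bCgens. \<forall>v\<in>carrier M. h (ga a v) = ga a (h v))"

lemma even_endo_falg_act:
  assumes "even_endo h" "p \<in> falg_bC" "v \<in> carrier M"
  shows "h (falg_act c M p v) = falg_act c M p (h v)"
proof -
  have w: "h (word_act c M w v) = word_act c M w (h v)" if "set w \<subseteq> bCgens" for w
    using that assms(1,3) by (induction w) (auto simp: even_endo_def)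
  have "h (falg_act c M p v) = mlin (\<lambda>w. h (word_act c M w v)) p"
    unfolding falg_act_eq using assms
    by (intro mlin_map) (auto simp: even_endo_def falg_bC_def)
  also have "\<dots> = falg_act c M p (h v)"
    unfolding falg_act_eq using assms w by (intro mlin_cong) (auto simp: even_endo_def falg_bC_def)
  finally show ?thesis .
qed

lemma even_endo_kernel:
  assumes h: "even_endo h"
  shows "subsupermodule b_alg M {v \<in> carrier M. h v = \<zero>}" (is "subsupermodule _ _ ?W")
proof (rule subsupermodule_I)
  have h0: "h \<zero> = \<zero>" using h unfolding even_endo_def by (metis M.zero_closed smult_0)
  show "submodule ?W complex_field M"
    by (rule submodule_I) (use h h0 in \<open>auto simp: even_endo_def\<close>)
  show "act M x w \<in> ?W" if "x \<in> b_alg" "w \<in> ?W" for x w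
  proof -
    have "h (act M x w) = falg_act c M (tw_to_falg x) \<zero>"
      using that by (simp add: act_expand even_endo_falg_act[OF h] tw_to_falg_bC)
    also have "\<dots> = \<zero>"
      using falg_act_linear(2)[OF tw_to_falg_bC[OF that(1)], of \<zero> 0]
        falg_act_closed[OF tw_to_falg_bC[OF that(1)], of \<zero>] by simp
    finally show ?thesis using that by (simp add: act_closed)
  qed
  fix w assume w: "w \<in> ?W"
  then obtain v0 v1 where v: "v0 \<in> part M 0" "v1 \<in> part M 1" "w = v0 \<oplus> v1" using part_decomp by blast
  then have "h v0 \<oplus> h v1 = \<zero>" using w h by (simp add: even_endo_def)
  moreover have "h v0 \<in> part M 0" "h v1 \<in> part M 1" using v h by (auto simp: even_endo_def)
  ultimately have "h v0 = \<zero>" "h v1 = \<zero>" using part_sum_zero by blast+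
  with v show "\<exists>v0\<in>?W \<inter> part M 0. \<exists>v1\<in>?W \<inter> part M 1. w = v0 \<oplus> v1" by force
qed

lemma even_endo_image:
  assumes h: "even_endo h"
  shows "subsupermodule b_alg M (h ` carrier M)" (is "subsupermodule _ _ ?W")
proof (rule subsupermodule_I)
  have h0: "h \<zero> = \<zero>" using h unfolding even_endo_def by (metis M.zero_closed smult_0)
  show "submodule ?W complex_field M"
  proof (rule submodule_I)
    show "\<zero> \<in> ?W" using h0 by force
    show "x \<oplus> y \<in> ?W" if "x \<in> ?W" "y \<in> ?W" for x y
    proof -
      from that obtain x' y' where "x' \<in> carrier M" "y' \<in> carrier M" "x = h x'" "y = h y'" by blast
      then have "x \<oplus> y = h (x' \<oplus> y')" "x' \<oplus> y' \<in> carrier M" using h by (auto simp: even_endo_def)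
      then show ?thesis by blast
    qed
    show "z \<odot> x \<in> ?W" if "x \<in> ?W" for z x
    proof -
      from that obtain x' where "x' \<in> carrier M" "x = h x'" by blast
      then have "z \<odot> x = h (z \<odot> x')" "z \<odot> x' \<in> carrier M" using h by (auto simp: even_endo_def)
      then show ?thesis by blast
    qed
  qed (use h in \<open>auto simp: even_endo_def\<close>)
  show "act M x w \<in> ?W" if "x \<in> b_alg" "w \<in> ?W" for x w
  proof -
    from that obtain v where v: "w = h v" "v \<in> carrier M" by blast
    then have "act M x w = h (act M x v)"
      using that(1) h by (simp add: act_expand even_endo_falg_act[OF h] tw_to_falg_bC even_endo_def)
    with v that(1) show ?thesis by (simp add: act_closed)
  qed
  fix w assume "w \<in> ?W"
  then obtain v where w: "w = h v" "v \<in> carrier M" by blast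
  obtain v0 v1 where v: "v0 \<in> part M 0" "v1 \<in> part M 1" "v = v0 \<oplus> v1"
    using part_decomp[OF w(2)] by blast
  have "w = h v0 \<oplus> h v1" using w v h by (simp add: even_endo_def)
  moreover from v have "h v0 \<in> ?W \<inter> part M 0" "h v1 \<in> ?W \<inter> part M 1"
    using h by (auto simp: even_endo_def)
  ultimately show "\<exists>v0\<in>?W \<inter> part M 0. \<exists>v1\<in>?W \<inter> part M 1. w = v0 \<oplus> v1" by blast
qed

end

instance gen :: countable
  by countable_datatype

lemma linear_dependence:
  assumes "finite B" "p ` Z \<subseteq> pm.span B" "finite Z" "card B < card Z"
  obtains e z where "z \<in> Z" "e z \<noteq> 0" "(\<Sum>z\<in>Z. psmult (e z) (p z)) = 0"
proof (cases "inj_on p Z")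
  case True
  have "pm.dependent (p ` Z)"
    using pm.independent_span_bound[OF assms(1) _ assms(2)] assms(4) card_image[OF True] by fastforce
  then obtain e v where "v \<in> p ` Z" "e v \<noteq> 0" "(\<Sum>v\<in>p ` Z. psmult (e v) v) = 0"
    using pm.dependent_finite[of "p ` Z"] assms(3) by auto
  then show ?thesis
    using that[of _ "\<lambda>z. e (p z)"] True by (auto simp: sum.reindex)
next
  case False
  then obtain x y where xy: "x \<in> Z" "y \<in> Z" "x \<noteq> y" "p x = p y" by (auto simp: inj_on_def)
  define e :: "_ \<Rightarrow> complex" where "e z = (if z = x then 1 else if z = y then -1 else 0)" for z
  have "(\<Sum>z\<in>Z. psmult (e z) (p z)) = (\<Sum>z\<in>{x, y}. psmult (e z) (p z))"
    using xy assms(3) by (intro sum.mono_neutral_right) (auto simp: e_def)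
  also have "\<dots> = 0" using xy by (simp add: e_def)
  finally show ?thesis using that[of x e] xy by (simp add: e_def)
qed

text \<open>Uncountably many elements of the countably generated free algebra are linearly dependent.\<close>

lemma uncountable_family_dependent:
  fixes p :: "complex \<Rightarrow> falg"
  obtains e z Z where "finite Z" "z \<in> Z" "e z \<noteq> 0" "(\<Sum>z\<in>Z. psmult (e z) (p z)) = 0"
proof -
  define B where "B n = (\<lambda>i. word (from_nat i :: gen list)) ` {..n}" for n :: nat
  have "\<exists>n. p z \<in> pm.span (B n)" for z
  proof -
    obtain n where n: "\<forall>w\<in>Poly_Mapping.keys (p z). to_nat w \<le> n"
      using finite_nat_set_iff_bounded_le[of "to_nat ` Poly_Mapping.keys (p z)"] by auto
    have "p z \<in> pm.span (B n)"
    proof (subst expand_basis, intro pm.span_sum pm.span_scale pm.span_base)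
      fix w assume "w \<in> Poly_Mapping.keys (p z)"
      then have "to_nat w \<in> {..n}" using n by auto
      then show "word w \<in> B n" unfolding B_def by (intro image_eqI[of _ _ "to_nat w"]) simp_all
    qed
    then show ?thesis ..
  qed
  then obtain N where N: "p z \<in> pm.span (B (N z))" for z by metis
  have "\<exists>n. infinite (N -` {n})"
  proof (rule ccontr)
    assume "\<nexists>n. infinite (N -` {n})"
    then have "countable (\<Union>n. N -` {n})" by (intro countable_UN) (auto intro: countable_finite)
    moreover have "(\<Union>n. N -` {n}) = UNIV" by auto
    ultimately show False using uncountable_UNIV_complex by simp
  qed
  then obtain n where "infinite (N -` {n})" by blast
  then obtain Z where Z: "Z \<subseteq> N -` {n}" "card Z = Suc (card (B n))" "finite Z"
    by (metis infinite_arbitrarily_large)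
  have "finite (B n)" by (simp add: B_def)
  moreover have "p ` Z \<subseteq> pm.span (B n)" using N Z(1) by auto
  moreover have "card (B n) < card Z" using Z(2) by simp
  ultimately show ?thesis using that Z(3) linear_dependence[of "B n" p Z] by metis
qed

text \<open>Evaluation of a complex polynomial at an element of the free algebra.\<close>

definition poly_falg :: "falg \<Rightarrow> complex poly \<Rightarrow> falg" where
  "poly_falg t f = (\<Sum>i\<le>degree f. psmult (coeff f i) (t ^ i))"

lemma poly_falg_upto: "degree f \<le> n \<Longrightarrow> poly_falg t f = (\<Sum>i\<le>n. psmult (coeff f i) (t ^ i))"
  unfolding poly_falg_def by (rule sum.mono_neutral_left) (auto simp: coeff_eq_0)

lemma poly_falg_add: "poly_falg t (f + g) = poly_falg t f + poly_falg t g"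
proof -
  let ?n = "max (degree f) (degree g)"
  have "degree (f + g) \<le> ?n" by (rule degree_add_le_max)
  then show ?thesis
    by (simp add: poly_falg_upto[of _ ?n] pm.scale_left_distrib sum.distrib)
qed

lemma poly_falg_smult: "poly_falg t (Polynomial.smult z f) = psmult z (poly_falg t f)"
  by (simp add: poly_falg_upto[of _ "degree f"] pm.scale_sum_right)

lemma poly_falg_pCons: "poly_falg t (pCons z f) = psmult z 1 + t * poly_falg t f"
proof -
  have "poly_falg t (pCons z f) = (\<Sum>i\<le>Suc (degree f). psmult (coeff (pCons z f) i) (t ^ i))"
    by (rule poly_falg_upto) (rule degree_pCons_le)
  then show ?thesis
    unfolding sum.atMost_Suc_shift by (simp add: poly_falg_def sum_distrib_left psmult_mult)
qed

lemma poly_falg_0 [simp]: "poly_falg t 0 = 0"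
  by (simp add: poly_falg_def)

lemma poly_falg_diff: "poly_falg t (f - g) = poly_falg t f - poly_falg t g"
  using poly_falg_add[of t f "Polynomial.smult (-1) g"] poly_falg_smult[of t "-1" g]
  by (simp add: psmult_minus_one)

lemma poly_falg_linear: "poly_falg t ([:-z, 1:] * f) = (t - psmult z 1) * poly_falg t f"
  by (simp add: mult_pCons_left poly_falg_diff poly_falg_smult poly_falg_pCons left_diff_distrib psmult_mult)

lemma poly_falg_sum: "poly_falg t (sum f S) = (\<Sum>i\<in>S. poly_falg t (f i))"
  by (induction S rule: infinite_finite_induct) (simp_all add: poly_falg_add)

context b_module
begin

lemma one_falg_bC: "1 \<in> falg_bC"
  using word_bC[of "[]"] by (simp add: word_Nil)

lemma poly_falg_bC: "t \<in> falg_bC \<Longrightarrow> poly_falg t f \<in> falg_bC"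
proof (induction f)
  case (pCons z f)
  then show ?case unfolding poly_falg_pCons
    by (intro pm.subspace_add[OF subspace_falg_bC] pm.subspace_scale[OF subspace_falg_bC]
        falg_bC_mult one_falg_bC) auto
qed (simp add: falg_bC_def)

text \<open>
  Dixmier's version of Schur's lemma.  If \<open>t\<close> is not a scalar, then by simplicity \<open>t - z\<close> is bijective
  for all complex \<open>z\<close>, and the vectors \<open>(t - z)\<^sup>-\<^sup>1 v\<close> are uncountably many linearly independent
  vectors of a module of countable dimension, which is impossible.
\<close>

lemma central_generator_scalar:
  assumes simple: "simple_supermodule b_alg M" and a: "a \<in> bgens" "parity a = 0"
    and central: "\<And>b v. b \<in> bCgens \<Longrightarrow> v \<in> carrier M \<Longrightarrow> ga a (ga b v) = ga b (ga a v)"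
  shows "\<exists>z. \<forall>v\<in>carrier M. ga a v = z \<odot> v"
proof (rule ccontr)
  assume no: "\<nexists>z. \<forall>v\<in>carrier M. ga a v = z \<odot> v"
  \<comment> \<open>calculations take place in the free algebra, modulo the annihilator \<open>J\<close> of a cyclic vector\<close>
  define t where "t = (word [a] :: falg)"
  have aC: "a \<in> bCgens" using a by simp
  have t: "t \<in> falg_bC" using word_bC[of "[a]"] aC by (simp add: t_def)
  have tz: "t - psmult z 1 \<in> falg_bC" for z
    by (intro pm.subspace_diff[OF subspace_falg_bC] pm.subspace_scale[OF subspace_falg_bC] t one_falg_bC)
  define S where "S z v = falg_act c M (t - psmult z 1) v" for z v
  have S_eq: "S z v = ga a v \<ominus> z \<odot> v" if "v \<in> carrier M" for z v
    using that t one_falg_bC pm.subspace_scale[OF subspace_falg_bC one_falg_bC, of z] aC falg_act_word[of "[]" v]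
    by (simp add: S_def falg_act_diff falg_act_psmult word_Nil) (simp add: t_def)
  have endo: "even_endo (S z)" for z
    unfolding even_endo_def
  proof (intro conjI ballI allI)
    fix b v assume "b \<in> bCgens" "v \<in> carrier M"
    then show "S z (ga b v) = ga b (S z v)"
      using aC ga_add[of b "ga a v" "(-z) \<odot> v"] ga_smult[of b v]
      by (simp add: S_eq central diff_eq_smult smult_smult ga_add ga_smult)
  next
    fix i v assume v: "v \<in> part M i"
    have "ga a v \<in> part M (0 + i)" using ga_part[OF aC v] a(2) by simp
    with v show "S z v \<in> part M i" by (simp only: S_eq part_carrier part_D add_0_left)
  qed (use tz falg_act_linear in \<open>auto simp: S_def\<close>)
  have nz: "\<exists>v\<in>carrier M. S z v \<noteq> \<zero>" for z
  proof -
    obtain v where "v \<in> carrier M" "ga a v \<noteq> z \<odot> v" using no by blast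
    then show ?thesis using aC by (auto simp: S_eq diff_zero_iff)
  qed
  have inj: "v = \<zero>" if "v \<in> carrier M" "S z v = \<zero>" for z v
    using simple even_endo_kernel[OF endo[of z]] nz[of z] that unfolding simple_supermodule_def by blast
  have surj: "S z ` carrier M = carrier M" for z
    using simple even_endo_image[OF endo[of z]] nz[of z] unfolding simple_supermodule_def by blast
  obtain v j where v: "v \<noteq> \<zero>" "v \<in> part M j"
  proof -
    obtain w where w: "w \<in> carrier M" "w \<noteq> \<zero>"
      using simple M.zero_closed unfolding simple_supermodule_def by blast
    obtain v0 v1 where "v0 \<in> part M 0" "v1 \<in> part M 1" "w = v0 \<oplus> v1" using part_decomp[OF w(1)] by blast
    with w that show thesis by (cases "v0 = \<zero>") auto
  qed
  have vc: "v \<in> carrier M" using v(2) by simp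
  have "falg_act c M 1 v = v" using falg_act_word[of "[]" v] vc by (simp add: word_Nil)
  then have "v \<in> {falg_act c M p v | p. p \<in> falg_bC}" using one_falg_bC by force
  then have "{falg_act c M p v | p. p \<in> falg_bC} \<noteq> {\<zero>}" using v(1) by blast
  then have cyc: "{falg_act c M p v | p. p \<in> falg_bC} = carrier M"
    using simple cyclic_subsupermodule[OF v(2)] unfolding simple_supermodule_def by blast
  have "\<exists>p\<in>falg_bC. S z (falg_act c M p v) = v" for z
  proof -
    have "v \<in> S z ` carrier M" unfolding surj by (rule vc)
    then obtain w where w: "w \<in> carrier M" "S z w = v" by (auto elim: imageE)
    from w(1) have "w \<in> {falg_act c M p v | p. p \<in> falg_bC}" by (simp only: cyc)
    then obtain p where p: "p \<in> falg_bC" "w = falg_act c M p v" by blast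
    from w(2) have "S z (falg_act c M p v) = v" unfolding p(2) .
    with p(1) show ?thesis by (rule bexI[rotated])
  qed
  then obtain p where p: "p z \<in> falg_bC" "S z (falg_act c M (p z) v) = v" for z by metis
  let ?f = "poly_falg t"
  have f_bC: "?f q \<in> falg_bC" for q by (rule poly_falg_bC[OF t])
  have f_lin: "falg_act c M (?f ([:-z, 1:] * q)) w = S z (falg_act c M (?f q) w)" if "w \<in> carrier M" for z q w
    unfolding poly_falg_linear S_def using tz f_bC that by (simp add: falg_act_mult)
  have f_inj: "w = \<zero>" if "q \<noteq> 0" "falg_act c M (?f q) w = \<zero>" "w \<in> carrier M" for q w
    using that
  proof (induction "degree q" arbitrary: q)
    case 0
    obtain z where q: "q = [:z:]" using degree_eq_zeroE[of q] 0(1) by metis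
    with 0(2) have z: "z \<noteq> 0" by simp
    have "falg_act c M (?f q) w = z \<odot> falg_act c M 1 w"
      using 0 q one_falg_bC by (simp add: poly_falg_pCons falg_act_psmult)
    then have "z \<odot> w = \<zero>" using 0 falg_act_word[of "[]" w] by (simp add: word_Nil)
    then show ?case using smult_eq_zero 0(4) z by blast
  next
    case (Suc n)
    then have "\<not> constant (poly q)" by (simp add: constant_degree)
    then obtain z where "poly q z = 0" using fundamental_theorem_of_algebra by blast
    then obtain r where r: "q = [:-z, 1:] * r" by (auto simp: poly_eq_0_iff_dvd)
    have r0: "r \<noteq> 0" using r Suc(3) by auto
    have "degree q = Suc (degree r)" unfolding r using r0 by (subst degree_mult_eq) auto
    moreover have "falg_act c M (?f r) w = \<zero>"
      using Suc.prems f_lin[of w z r] inj[of "falg_act c M (?f r) w" z] f_bC by (simp add: r)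
    ultimately show ?case using Suc.hyps(1)[of r] Suc.hyps(2) Suc.prems(3) r0 by simp
  qed
  obtain e y Z where Z: "finite Z" "y \<in> Z" "e y \<noteq> 0" "(\<Sum>z\<in>Z. psmult (e z) (p z)) = 0"
    by (rule uncountable_family_dependent[of p])
  \<comment> \<open>multiplying a dependency by the product of all \<open>t - z\<close> gives a polynomial in \<open>t\<close> that kills \<open>v\<close>\<close>
  define Q where "Q A = (\<Prod>z\<in>A. [:-z, 1:])" for A :: "complex set"
  define J where "J = {x \<in> falg_bC. falg_act c M x v = \<zero>}"
  have J: "pm.subspace J"
    unfolding J_def pm.subspace_def using subspace_falg_bC vc
    by (auto simp: falg_act_add falg_act_psmult pm.subspace_def falg_act_eq[of 0])
  have mem: "?f (Q Z) * p z - ?f (Q (Z - {z})) \<in> J" if "z \<in> Z" for z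
  proof -
    have "Q Z = [:-z, 1:] * Q (Z - {z})" unfolding Q_def by (rule prod.remove[OF Z(1) that])
    then have "falg_act c M (?f (Q Z) * p z) v = S z (falg_act c M (?f (Q (Z - {z}))) (falg_act c M (p z) v))"
      using f_bC p(1) vc f_lin by (simp add: falg_act_mult)
    also have "\<dots> = falg_act c M (?f (Q (Z - {z}))) v"
      using even_endo_falg_act[OF endo f_bC] p vc by simp
    finally show ?thesis
      unfolding J_def using f_bC p(1) vc
      by (simp add: falg_act_diff diff_zero_iff falg_bC_mult pm.subspace_diff[OF subspace_falg_bC])
  qed
  have "(\<Sum>z\<in>Z. psmult (e z) (?f (Q Z) * p z - ?f (Q (Z - {z})))) \<in> J"
    by (intro pm.subspace_sum pm.subspace_scale J mem)
  moreover have "(\<Sum>z\<in>Z. psmult (e z) (?f (Q Z) * p z - ?f (Q (Z - {z}))))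
      = ?f (Q Z) * (\<Sum>z\<in>Z. psmult (e z) (p z)) - ?f (\<Sum>z\<in>Z. Polynomial.smult (e z) (Q (Z - {z})))"
    by (simp add: poly_falg_sum poly_falg_smult pm.scale_right_diff_distrib sum_subtractf
        sum_distrib_left psmult_mult)
  ultimately have "?f (\<Sum>z\<in>Z. Polynomial.smult (e z) (Q (Z - {z}))) \<in> J"
    using pm.subspace_neg[OF J] Z(4) by fastforce
  then have "(\<Sum>z\<in>Z. Polynomial.smult (e z) (Q (Z - {z}))) = 0"
    using f_inj[OF _ _ vc] v(1) unfolding J_def by blast
  then have "poly (\<Sum>z\<in>Z. Polynomial.smult (e z) (Q (Z - {z}))) y = 0" by simp
  then have "(\<Sum>z\<in>Z. e z * poly (Q (Z - {z})) y) = 0" by (simp add: poly_sum)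
  moreover have "(\<Sum>z\<in>Z. e z * poly (Q (Z - {z})) y) = (\<Sum>z\<in>{y}. e z * poly (Q (Z - {z})) y)"
    using Z(1,2) by (intro sum.mono_neutral_right) (auto simp: Q_def poly_prod)
  moreover have "poly (Q (Z - {y})) y \<noteq> 0" using Z(1) by (simp add: Q_def poly_prod)
  ultimately show False using Z(3) by simp
qed

end


section \<open>The induced module\<close>

(* the default rule would turn sums of degrees into case distinctions *)
declare add_bit_eq_xor [simp del]

lemma env_add: "env (p + q) = env p + env q"
  by (simp add: plus_U.abs_eq)

lemma env_mult: "env (p * q) = env p * env q"
  by (simp add: times_U.abs_eq)

lemma env_1: "env 1 = 1"
  by (simp add: one_U_def)

lemma env_eq_iff: "env p = env q \<longleftrightarrow> p - q \<in> env_ideal"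
  by (simp add: U.abs_eq_iff env_eq_def)

lemma env_cases: obtains p where "u = env p"
proof -
  have "\<exists>p. u = env p" by (induction u rule: U.abs_induct) blast
  with that show thesis by blast
qed

lemma left_mult_eq: "left_mult x t = lin_ext (\<lambda>(u, m). tens (x * u) m) t"
  unfolding left_mult_def lin_ext_def by (rule sum.cong) auto

lemma left_mult_linear:
  "left_mult x (s + t) = left_mult x s + left_mult x t"
  "left_mult x (s - t) = left_mult x s - left_mult x t"
  "left_mult x (psmult z t) = psmult z (left_mult x t)"
  "left_mult x 0 = 0"
  by (simp_all add: left_mult_eq lin_ext_simps)

lemma left_mult_tens [simp]: "left_mult x (tens u m) = tens (x * u) m"
  by (simp add: left_mult_eq)

lemma left_mult_mult: "left_mult x (left_mult y t) = left_mult (x * y) t"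
  unfolding left_mult_eq lin_ext_lin_ext by (rule lin_ext_cong) (auto simp: mult.assoc)

lemma env_bracket:
  assumes "x \<in> tw_part i" "y \<in> tw_part j"
  shows "env (tw_to_falg (bracket x y))
       = env (tw_to_falg x * tw_to_falg y - psmult (ssign i j) (tw_to_falg y * tw_to_falg x))"
proof -
  have "bracket x y = lin_ext (\<lambda>a. lin_ext (gbracket a) y) x"
    unfolding bracket_def lin_ext_def pm.scale_sum_right by simp
  then have 1: "tw_to_falg (bracket x y) = lin_ext (\<lambda>a. lin_ext (\<lambda>b. tw_to_falg (gbracket a b)) y) x"
    by (simp add: tw_to_falg_eq lin_ext_lin_ext)
  have 2: "tw_to_falg x * tw_to_falg y = lin_ext (\<lambda>a. lin_ext (\<lambda>b. word [a, b]) y) x"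
    unfolding tw_to_falg_eq lin_ext_mult_right unfolding lin_ext_mult_left by (simp add: word_mult)
  have 3: "tw_to_falg y * tw_to_falg x = lin_ext (\<lambda>a. lin_ext (\<lambda>b. word [b, a]) y) x"
    unfolding tw_to_falg_eq lin_ext_mult_left unfolding lin_ext_mult_right by (simp add: word_mult)
  have "lin_ext (\<lambda>a. lin_ext (\<lambda>b. word [a, b] - psmult (ssign i j) (word [b, a]) - tw_to_falg (gbracket a b)) y) x
     = lin_ext (\<lambda>a. lin_ext (\<lambda>b. env_rel a b) y) x"
    using assms by (intro lin_ext_cong) (auto simp: env_rel_eq tw.rel_def tw_part_def tw_to_falg_eq)
  moreover have "lin_ext (\<lambda>a. lin_ext (\<lambda>b. env_rel a b) y) x \<in> env_ideal"
    using env_ideal.rel[of 1 _ _ 1] by (intro lin_ext_in_subspace[OF subspace_env_ideal]) auto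
  ultimately have "tw_to_falg x * tw_to_falg y - psmult (ssign i j) (tw_to_falg y * tw_to_falg x)
       - tw_to_falg (bracket x y) \<in> env_ideal"
    unfolding 1 2 3 by (simp add: lin_ext_pointwise)
  then show ?thesis by (simp add: env_eq_iff[symmetric])
qed

lemma U_part_mult:
  assumes "u \<in> U_part i" "v \<in> U_part j"
  shows "u * v \<in> U_part (i + j)"
proof -
  obtain p q where p: "u = env p" "\<forall>w\<in>Poly_Mapping.keys p. word_parity w = i"
    and q: "v = env q" "\<forall>w\<in>Poly_Mapping.keys q. word_parity w = j"
    using assms by (auto simp: U_part_def)
  have "\<forall>w\<in>Poly_Mapping.keys (p * q). word_parity w = i + j"
  proof
    fix w assume "w \<in> Poly_Mapping.keys (p * q)"
    then obtain a b where ab: "a \<in> Poly_Mapping.keys p" "b \<in> Poly_Mapping.keys q" "w = a @ b"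
      using keys_mult[of p q] by (auto simp: plus_list_def)
    have "word_parity w = word_parity a + word_parity b"
      by (simp only: ab(3) map_append sum_list_append)
    with ab(1,2) p(2) q(2) show "word_parity w = i + j" by simp
  qed
  then show ?thesis unfolding U_part_def p(1) q(1) env_mult[symmetric] by blast
qed

lemma env_tw_part: "x \<in> tw_part i \<Longrightarrow> env (tw_to_falg x) \<in> U_part i"
proof -
  assume x: "x \<in> tw_part i"
  have "Poly_Mapping.keys (tw_to_falg x) \<subseteq> {w. word_parity w = i}"
    unfolding tw_to_falg_eq by (rule keys_lin_ext) (use x in \<open>auto simp: tw_part_def\<close>)
  then show ?thesis by (auto simp: U_part_def)
qed

lemma U_part_decomp:
  obtains u0 u1 where "u0 \<in> U_part 0" "u1 \<in> U_part 1" "u = u0 + u1"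
proof -
  obtain p where p: "u = env p" by (rule env_cases)
  define pr where "pr i = lin_ext (\<lambda>w. if word_parity w = i then word w else 0) p" for i
  have "pr 0 + pr 1 = lin_ext (\<lambda>w. (if word_parity w = 0 then word w else 0) + (if word_parity w = 1 then word w else 0)) p"
    by (simp only: pr_def lin_ext_pointwise)
  also have "\<dots> = lin_ext word p" by (rule lin_ext_cong) auto
  also have "\<dots> = p" by (rule lin_ext_id)
  finally have "u = env (pr 0) + env (pr 1)" by (simp add: p flip: env_add)
  moreover have "env (pr i) \<in> U_part i" for i
  proof -
    have "Poly_Mapping.keys (pr i) \<subseteq> {w. word_parity w = i}"
      unfolding pr_def by (rule keys_lin_ext) (auto split: if_splits)
    then show ?thesis by (auto simp: U_part_def)
  qed
  ultimately show thesis using that by blast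
qed

context b_module
begin

text \<open>The relations of the tensor product, the tensors, and the class of a tensor in the induced module.\<close>

abbreviation rel_span :: "((U \<times> 'v) \<Rightarrow>\<^sub>0 complex) set" where
  "rel_span \<equiv> pm.span (tensor_rels c M)"

abbreviation tensors :: "((U \<times> 'v) \<Rightarrow>\<^sub>0 complex) set" where
  "tensors \<equiv> pm.span {tens u m | u m. m \<in> carrier M}"

abbreviation cls :: "((U \<times> 'v) \<Rightarrow>\<^sub>0 complex) \<Rightarrow> ((U \<times> 'v) \<Rightarrow>\<^sub>0 complex) set" where
  "cls \<equiv> tensor_class c M"

lemma tens_tensors: "m \<in> carrier M \<Longrightarrow> tens u m \<in> tensors"
  by (rule pm.span_base) blast

lemma tensor_rels_I:
  assumes "m \<in> carrier M"
  shows "tens (u + u') m - tens u m - tens u' m \<in> rel_span"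
    "m' \<in> carrier M \<Longrightarrow> tens u (m \<oplus> m') - tens u m - tens u m' \<in> rel_span"
    "tens (env (psmult z p)) m - psmult z (tens (env p) m) \<in> rel_span"
    "tens u (z \<odot> m) - psmult z (tens u m) \<in> rel_span"
    "p \<in> falg_bC \<Longrightarrow> tens (u * env p) m - tens u (falg_act c M p m) \<in> rel_span"
  using assms by (intro pm.span_base; auto simp: tensor_rels_def; blast)+

text \<open>Elimination rule for the five families of relations.\<close>

lemma tensor_rels_cases:
  assumes "t \<in> tensor_rels c M"
  obtains (add_left) u u' m where "m \<in> carrier M" "t = tens (u + u') m - tens u m - tens u' m"
  | (add_right) u m m' where "m \<in> carrier M" "m' \<in> carrier M" "t = tens u (m \<oplus> m') - tens u m - tens u m'"
  | (smult_left) z p m where "m \<in> carrier M" "t = tens (env (psmult z p)) m - psmult z (tens (env p) m)"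
  | (smult_right) z u m where "m \<in> carrier M" "t = tens u (z \<odot> m) - psmult z (tens u m)"
  | (balance) u p m where "p \<in> falg_bC" "m \<in> carrier M" "t = tens (u * env p) m - tens u (falg_act c M p m)"
  using assms unfolding tensor_rels_def
  by (elim UnE CollectE exE conjE)
    ((rule add_left, assumption, assumption) | (rule add_right, assumption, assumption, assumption)
     | (rule smult_left, assumption, assumption) | (rule smult_right, assumption, assumption)
     | (rule balance, assumption, assumption, assumption))+

lemma rel_span_tensors: "rel_span \<subseteq> tensors"
proof (rule pm.span_minimal)
  show "tensor_rels c M \<subseteq> tensors"
  proof
    fix t assume "t \<in> tensor_rels c M"
    then show "t \<in> tensors"
      by (cases rule: tensor_rels_cases)
        (auto intro!: pm.span_diff pm.span_scale tens_tensors)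
  qed
qed simp

lemma left_mult_rel_span:
  assumes "t \<in> rel_span"
  shows "left_mult x t \<in> rel_span"
  using assms
proof (induction rule: pm_span_induct)
  case (base t)
  from base show ?case
  proof (cases rule: tensor_rels_cases)
    case (smult_left z p m)
    obtain q where q: "x = env q" by (rule env_cases)
    show ?thesis
      using tensor_rels_I(3)[OF smult_left(1), of z "q * p"]
      by (simp add: smult_left(2) left_mult_linear q psmult_mult flip: env_mult)
  qed (simp_all add: left_mult_linear distrib_left tensor_rels_I flip: mult.assoc)
qed (auto simp: left_mult_linear pm.span_zero intro: pm.span_add pm.span_scale)

lemma left_mult_tensors:
  assumes "t \<in> tensors"
  shows "left_mult x t \<in> tensors"
  using assms
  by (induction rule: pm_span_induct)
    (auto simp: left_mult_linear pm.span_zero intro: pm.span_add pm.span_scale tens_tensors)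

lemma left_mult_add_left:
  assumes "t \<in> tensors"
  shows "left_mult (x + y) t - left_mult x t - left_mult y t \<in> rel_span"
  using assms
proof (induction rule: pm_span_induct)
  case (add s t)
  have "left_mult (x + y) (s + t) - left_mult x (s + t) - left_mult y (s + t)
    = (left_mult (x + y) s - left_mult x s - left_mult y s) + (left_mult (x + y) t - left_mult x t - left_mult y t)"
    by (simp add: left_mult_linear)
  then show ?case using add by (metis pm.span_add)
next
  case (smult z t)
  have "left_mult (x + y) (psmult z t) - left_mult x (psmult z t) - left_mult y (psmult z t)
    = psmult z (left_mult (x + y) t - left_mult x t - left_mult y t)"
    by (simp add: left_mult_linear pm.scale_right_diff_distrib)
  then show ?case using smult by (metis pm.span_scale)
next
  case (base t)
  then show ?case by (auto simp: distrib_right intro: tensor_rels_I)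
qed (simp add: left_mult_linear pm.span_zero)

lemma left_mult_psmult_left:
  assumes "t \<in> tensors"
  shows "left_mult (env (psmult z p)) t - psmult z (left_mult (env p) t) \<in> rel_span"
  using assms
proof (induction rule: pm_span_induct)
  case (add s t)
  have "left_mult (env (psmult z p)) (s + t) - psmult z (left_mult (env p) (s + t))
    = (left_mult (env (psmult z p)) s - psmult z (left_mult (env p) s))
    + (left_mult (env (psmult z p)) t - psmult z (left_mult (env p) t))"
    by (simp add: left_mult_linear pm.scale_right_distrib)
  then show ?case using add by (metis pm.span_add)
next
  case (smult y t)
  have "left_mult (env (psmult z p)) (psmult y t) - psmult z (left_mult (env p) (psmult y t))
    = psmult y (left_mult (env (psmult z p)) t - psmult z (left_mult (env p) t))"
    by (simp add: left_mult_linear pm.scale_right_diff_distrib mult.commute)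
  then show ?case using smult by (metis pm.span_scale)
next
  case (base t)
  then obtain u m where t: "t = tens u m" "m \<in> carrier M" by blast
  obtain q where q: "u = env q" by (rule env_cases)
  show ?case using tensor_rels_I(3)[OF t(2), of z "p * q"]
    by (simp add: t(1) q psmult_mult flip: env_mult)
qed (simp add: left_mult_linear pm.span_zero)

text \<open>The action of a linear combination of words is linear modulo the relations.\<close>

lemma left_mult_env_add:
  "t \<in> tensors \<Longrightarrow> left_mult (env (p + q)) t - (left_mult (env p) t + left_mult (env q) t) \<in> rel_span"
  using left_mult_add_left[of t "env p" "env q"] by (simp add: env_add diff_diff_add)

lemma left_mult_env_diff:
  assumes "t \<in> tensors"
  shows "left_mult (env (p - psmult z q)) t - (left_mult (env p) t - psmult z (left_mult (env q) t)) \<in> rel_span"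
proof -
  have "left_mult (env (p - psmult z q)) t - (left_mult (env p) t - psmult z (left_mult (env q) t))
    = (left_mult (env (p + psmult (- z) q)) t - (left_mult (env p) t + left_mult (env (psmult (- z) q)) t))
     + (left_mult (env (psmult (- z) q)) t - psmult (- z) (left_mult (env q) t))"
    by simp
  then show ?thesis
    using left_mult_env_add[OF assms, of p "psmult (- z) q"] left_mult_psmult_left[OF assms, of "- z" q]
    by (metis pm.span_add)
qed

lemma cls_iff: "s \<in> cls t \<longleftrightarrow> s - t \<in> rel_span"
  unfolding tensor_class_def by (auto intro: exI[of _ "s - t"])

lemma cls_eq_iff: "cls s = cls t \<longleftrightarrow> s - t \<in> rel_span"
proof
  assume "cls s = cls t"
  then show "s - t \<in> rel_span" using cls_iff[of s s] cls_iff[of s t] by (simp add: pm.span_zero)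
next
  assume *: "s - t \<in> rel_span"
  have "x - s \<in> rel_span \<longleftrightarrow> x - t \<in> rel_span" for x
    using pm.span_add[OF _ *, of "x - s"] pm.span_diff[OF _ *, of "x - t"] by auto
  then show "cls s = cls t" by (auto simp: cls_iff)
qed

text \<open>Operations on cosets may be computed on a representative.\<close>

lemma cls_union:
  assumes "\<And>a. a - s \<in> rel_span \<Longrightarrow> f a - f s \<in> rel_span"
  shows "(\<Union>a\<in>cls s. cls (f a)) = cls (f s)"
proof -
  have "cls (f a) = cls (f s)" if "a \<in> cls s" for a
    using that assms by (simp add: cls_iff cls_eq_iff)
  moreover have "s \<in> cls s" by (simp add: cls_iff pm.span_zero)
  ultimately show ?thesis by blast
qed

lemma Ind_add: "cls s \<oplus>\<^bsub>Ind c M\<^esub> cls t = cls (s + t)"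
proof -
  have "(\<Union>b\<in>cls t. cls (a + b)) = cls (a + t)" for a by (rule cls_union) simp
  moreover have "(\<Union>a\<in>cls s. cls (a + t)) = cls (s + t)" by (rule cls_union) simp
  ultimately show ?thesis by (simp add: Ind_def)
qed

lemma Ind_smult: "z \<odot>\<^bsub>Ind c M\<^esub> cls t = cls (psmult z t)"
  unfolding Ind_def
  by (simp, rule cls_union) (metis pm.scale_right_diff_distrib pm.span_scale)

lemma Ind_act: "act (Ind c M) x (cls t) = cls (left_mult (env (tw_to_falg x)) t)"
  unfolding Ind_def
  by (simp, rule cls_union) (metis left_mult_linear(2) left_mult_rel_span)

lemma Ind_carrier: "carrier (Ind c M) = cls ` tensors"
  by (simp add: Ind_def)

lemma Ind_zero: "\<zero>\<^bsub>Ind c M\<^esub> = cls 0"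
  by (simp add: Ind_def)

text \<open>Representatives of the homogeneous vectors of the induced module.\<close>

definition tensor_part :: "bit \<Rightarrow> ((U \<times> 'v) \<Rightarrow>\<^sub>0 complex) set" where
  "tensor_part i = pm.span {tens u m | u m j k. u \<in> U_part j \<and> m \<in> part M k \<and> j + k = i}"

lemma Ind_part: "part (Ind c M) i = cls ` tensor_part i"
  by (simp add: Ind_def tensor_part_def)

lemma tensor_part_subset: "tensor_part i \<subseteq> tensors"
  unfolding tensor_part_def by (rule pm.span_mono) (blast dest: part_carrier)

lemma Ind_complex_module: "complex_module (Ind c M)"
proof -
  have "abelian_group (Ind c M)"
  proof (rule abelian_groupI)
    fix x assume "x \<in> carrier (Ind c M)"
    then obtain t where t: "x = cls t" "t \<in> tensors" by (auto simp: Ind_carrier)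
    then have "cls (- t) \<in> carrier (Ind c M)" "cls (- t) \<oplus>\<^bsub>Ind c M\<^esub> x = \<zero>\<^bsub>Ind c M\<^esub>"
      by (auto simp: Ind_carrier Ind_add Ind_zero intro: pm.span_neg)
    then show "\<exists>y\<in>carrier (Ind c M). y \<oplus>\<^bsub>Ind c M\<^esub> x = \<zero>\<^bsub>Ind c M\<^esub>" by blast
  qed (auto simp: Ind_carrier Ind_add Ind_zero add.assoc add.commute add.left_commute intro: pm.span_add pm.span_zero)
  then have "Module.module complex_field (Ind c M)"
    by (intro Module.moduleI cring_complex_field)
      (auto simp: Ind_carrier Ind_add Ind_smult pm.scale_left_distrib pm.scale_right_distrib intro: pm.span_scale)
  then show ?thesis by (rule complex_module.intro)
qed

end

text \<open>The sign of a degree, and the automorphism that acts on homogeneous elements by this sign.\<close>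

definition parity_sign :: "bit \<Rightarrow> complex" where
  "parity_sign i = (if i = 1 then -1 else 1)"

lemma parity_sign_add: "parity_sign (i + j) = parity_sign i * parity_sign j"
  by (cases i; cases j) (auto simp: parity_sign_def)

lemma parity_sign_0 [simp]: "parity_sign 0 = 1"
  by (simp add: parity_sign_def)

definition falg_sign :: "falg \<Rightarrow> falg" where
  "falg_sign = lin_ext (\<lambda>w. psmult (parity_sign (word_parity w)) (word w))"

lemma falg_sign_mult: "falg_sign (p * q) = falg_sign p * falg_sign q"
proof -
  have "falg_sign (word u * q) = falg_sign (word u) * falg_sign q" for u
  proof -
    have "falg_sign (word u * q) = lin_ext (\<lambda>v. falg_sign (word u) * falg_sign (word v)) q"
      by (rule lin_ext_eqI[of "\<lambda>q. falg_sign (word u * q)"])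
        (simp_all add: falg_sign_def distrib_left lin_ext_simps psmult_mult word_mult parity_sign_add mult.commute)
    also have "\<dots> = falg_sign (word u) * falg_sign q"
      by (rule lin_ext_eqI[of "\<lambda>q. falg_sign (word u) * falg_sign q", symmetric])
        (simp_all add: falg_sign_def distrib_left lin_ext_simps psmult_mult)
    finally show ?thesis .
  qed
  then have "falg_sign (p * q) = lin_ext (\<lambda>u. falg_sign (word u) * falg_sign q) p"
    by (intro lin_ext_eqI[of "\<lambda>p. falg_sign (p * q)"])
      (simp_all add: falg_sign_def distrib_right lin_ext_simps psmult_mult)
  also have "\<dots> = falg_sign p * falg_sign q"
    by (rule lin_ext_eqI[of "\<lambda>p. falg_sign p * falg_sign q", symmetric])
      (simp_all add: falg_sign_def distrib_right lin_ext_simps psmult_mult)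
  finally show ?thesis .
qed

lemma falg_sign_homogeneous:
  assumes "\<And>w. w \<in> Poly_Mapping.keys p \<Longrightarrow> word_parity w = i"
  shows "falg_sign p = psmult (parity_sign i) p"
proof -
  have "falg_sign p = lin_ext (\<lambda>w. psmult (parity_sign i) (word w)) p"
    unfolding falg_sign_def by (rule lin_ext_cong) (simp add: assms)
  then show ?thesis by (simp add: lin_ext_pointwise lin_ext_id)
qed

lemma falg_sign_env_ideal: "x \<in> env_ideal \<Longrightarrow> falg_sign x \<in> env_ideal"
proof (induction rule: env_ideal.induct)
  case (rel p a b q)
  have k: "Poly_Mapping.keys (tw_to_falg (gbracket a b)) \<subseteq> {w. word_parity w = parity a + parity b}"
    unfolding tw_to_falg_eq by (rule keys_lin_ext) (use key_gbracket in auto)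
  have "falg_sign (word [a, b]) = psmult (parity_sign (parity a + parity b)) (word [a, b])"
    "falg_sign (word [b, a]) = psmult (parity_sign (parity a + parity b)) (word [b, a])"
    by (simp_all add: falg_sign_def parity_sign_add mult.commute)
  moreover have "falg_sign (tw_to_falg (gbracket a b)) = psmult (parity_sign (parity a + parity b)) (tw_to_falg (gbracket a b))"
    by (rule falg_sign_homogeneous) (use k in blast)
  moreover have "falg_sign (x - psmult z y - v) = falg_sign x - psmult z (falg_sign y) - falg_sign v" for x y v z
    by (simp add: falg_sign_def lin_ext_simps)
  ultimately have "falg_sign (env_rel a b) = psmult (parity_sign (parity a + parity b)) (env_rel a b)"
    unfolding env_rel_eq tw.rel_def tw_to_falg_eq[symmetric]
    by (simp only: pm.scale_right_diff_distrib pm.scale_scale mult.commute)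
  then show ?case
    by (simp add: falg_sign_mult psmult_mult env_ideal_psmult env_ideal.rel)
qed (auto simp: falg_sign_def lin_ext_add intro: env_ideal.intros)

text \<open>The parity automorphism of the enveloping algebra.\<close>

lift_definition U_sign :: "U \<Rightarrow> U" is falg_sign
  unfolding env_eq_def using falg_sign_env_ideal by (force simp: falg_sign_def simp flip: lin_ext_diff)

lemma U_sign_env: "U_sign (env p) = env (falg_sign p)"
  by (rule U_sign.abs_eq)

lemma U_sign_part:
  assumes "u \<in> U_part i"
  obtains p where "u = env p" "U_sign u = env (psmult (parity_sign i) p)"
  using assms falg_sign_homogeneous by (auto simp: U_part_def U_sign_env)

context supermodule
begin

lemma part_unique:
  assumes "v0 \<in> part M 0" "v1 \<in> part M 1" "w0 \<in> part M 0" "w1 \<in> part M 1" "v0 \<oplus> v1 = w0 \<oplus> w1"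
  shows "v0 = w0" "v1 = w1"
proof -
  have "(v0 \<ominus> w0) \<oplus> (v1 \<ominus> w1) = (v0 \<oplus> v1) \<ominus> (w0 \<oplus> w1)"
    using assms(1-4) by (simp add: diff_eq_smult smult_add_right M.a_ac)
  also have "\<dots> = \<zero>" using assms by (simp add: diff_zero_iff)
  finally have "v0 \<ominus> w0 = \<zero>" "v1 \<ominus> w1 = \<zero>"
    using part_sum_zero[of "v0 \<ominus> w0" "v1 \<ominus> w1"] assms(1-4) part_D(5) by blast+
  with assms(1-4) show "v0 = w0" "v1 = w1" by (simp_all add: diff_zero_iff)
qed

text \<open>The parity automorphism of a supermodule.\<close>

definition sign_op :: "'v \<Rightarrow> 'v" where
  "sign_op v = (THE w. \<exists>v0\<in>part M 0. \<exists>v1\<in>part M 1. v = v0 \<oplus> v1 \<and> w = v0 \<oplus> (-1) \<odot> v1)"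

lemma sign_op_eq:
  assumes "v0 \<in> part M 0" "v1 \<in> part M 1"
  shows "sign_op (v0 \<oplus> v1) = v0 \<oplus> (-1) \<odot> v1"
  unfolding sign_op_def
  by (rule the_equality) (use assms part_unique in blast)+

lemma sign_op_part:
  assumes "v \<in> part M i"
  shows "sign_op v = parity_sign i \<odot> v"
proof -
  have "i = 0 \<or> i = 1" by (cases i) auto
  then show ?thesis
    using sign_op_eq[of v \<zero>] sign_op_eq[of \<zero> v] assms part_D(2)
    by (auto simp: parity_sign_def)
qed

lemma sign_op_linear:
  assumes "v \<in> carrier M" "w \<in> carrier M"
  shows "sign_op v \<in> carrier M" "sign_op (v \<oplus> w) = sign_op v \<oplus> sign_op w" "sign_op (z \<odot> v) = z \<odot> sign_op v"
proof -
  obtain v0 v1 where v: "v0 \<in> part M 0" "v1 \<in> part M 1" "v = v0 \<oplus> v1"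
    using part_decomp[OF assms(1)] by blast
  obtain w0 w1 where w: "w0 \<in> part M 0" "w1 \<in> part M 1" "w = w0 \<oplus> w1"
    using part_decomp[OF assms(2)] by blast
  show "sign_op v \<in> carrier M" using v by (simp add: sign_op_eq)
  have "v \<oplus> w = (v0 \<oplus> w0) \<oplus> (v1 \<oplus> w1)" using v w by (simp add: M.a_ac)
  then have "sign_op (v \<oplus> w) = (v0 \<oplus> w0) \<oplus> (-1) \<odot> (v1 \<oplus> w1)"
    using sign_op_eq[of "v0 \<oplus> w0" "v1 \<oplus> w1"] part_D(3) v w by simp
  then show "sign_op (v \<oplus> w) = sign_op v \<oplus> sign_op w"
    using v w by (simp add: sign_op_eq smult_add_right M.a_ac)
  have "z \<odot> v = z \<odot> v0 \<oplus> z \<odot> v1" using v by (simp add: smult_add_right)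
  then show "sign_op (z \<odot> v) = z \<odot> sign_op v"
    using sign_op_eq[of "z \<odot> v0" "z \<odot> v1"] part_D(4) v
    by (simp add: sign_op_eq smult_add_right smult_smult mult.commute)
qed

end

context b_module
begin

lemma sign_op_word_act:
  assumes "set w \<subseteq> bCgens" "v \<in> carrier M"
  shows "sign_op (word_act c M w v) = parity_sign (word_parity w) \<odot> word_act c M w (sign_op v)"
proof -
  have part: "sign_op (word_act c M w v) = parity_sign (word_parity w) \<odot> word_act c M w (sign_op v)"
    if "v \<in> part M i" for v i
    using word_act_part[OF assms(1) that] that assms(1)
    by (simp only: sign_op_part parity_sign_add word_act_smult part_carrier smult_smult word_act_closed)
  obtain v0 v1 where v: "v0 \<in> part M 0" "v1 \<in> part M 1" "v = v0 \<oplus> v1"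
    using part_decomp[OF assms(2)] by blast
  have c: "v0 \<in> carrier M" "v1 \<in> carrier M" using v by auto
  show ?thesis
    using c assms(1) part[OF v(1)] part[OF v(2)]
    by (simp add: v(3) word_act_add sign_op_linear smult_add_right)
qed

lemma falg_sign_bC:
  assumes "p \<in> falg_bC"
  shows "falg_sign p \<in> falg_bC"
  unfolding falg_sign_def
proof (rule lin_ext_in_subspace[OF subspace_falg_bC])
  fix w assume "w \<in> Poly_Mapping.keys p"
  then have "set w \<subseteq> bCgens" using assms by (auto simp: falg_bC_def)
  then show "psmult (parity_sign (word_parity w)) (word w) \<in> falg_bC"
    by (intro pm.subspace_scale[OF subspace_falg_bC] word_bC)
qed

lemma sign_op_falg_act:
  assumes p: "p \<in> falg_bC" and v: "v \<in> carrier M"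
  shows "sign_op (falg_act c M p v) = falg_act c M (falg_sign p) (sign_op v)"
proof -
  have w: "w \<in> Poly_Mapping.keys p \<Longrightarrow> set w \<subseteq> bCgens" for w using p by (auto simp: falg_bC_def)
  have sv: "sign_op v \<in> carrier M" using v by (simp add: sign_op_linear)
  have sc: "psmult z (word w) \<in> falg_bC" if "w \<in> Poly_Mapping.keys p" for z w
    using w[OF that] by (intro pm.subspace_scale[OF subspace_falg_bC] word_bC)
  have "sign_op (falg_act c M p v) = mlin (\<lambda>w. sign_op (word_act c M w v)) p"
    unfolding falg_act_eq using w v by (intro mlin_map) (auto simp: sign_op_linear)
  also have "\<dots> = mlin (\<lambda>w. falg_act c M (psmult (parity_sign (word_parity w)) (word w)) (sign_op v)) p"
    using w sv v by (intro mlin_cong)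
      (simp_all add: sign_op_word_act falg_act_psmult word_bC sc)
  also have "\<dots> = falg_act c M (falg_sign p) (sign_op v)"
    unfolding falg_act_eq falg_sign_def
  proof (rule mlin_lin_ext[symmetric, of _ _ "lists bCgens"])
    fix w assume "w \<in> Poly_Mapping.keys p"
    then show "Poly_Mapping.keys (psmult (parity_sign (word_parity w)) (word w)) \<subseteq> lists bCgens"
      using w[of w] keys_psmult[of "parity_sign (word_parity w)" "word w"] by (auto simp: lists_iff)
  qed (use sv in \<open>auto simp: lists_iff\<close>)
  finally show ?thesis .
qed

text \<open>The parity automorphism on tensors.\<close>

definition tensor_sign :: "((U \<times> 'v) \<Rightarrow>\<^sub>0 complex) \<Rightarrow> ((U \<times> 'v) \<Rightarrow>\<^sub>0 complex)" where
  "tensor_sign = lin_ext (\<lambda>(u, m). tens (U_sign u) (sign_op m))"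

lemma tensor_sign_linear:
  "tensor_sign (s + t) = tensor_sign s + tensor_sign t" "tensor_sign (s - t) = tensor_sign s - tensor_sign t"
  "tensor_sign (psmult z t) = psmult z (tensor_sign t)" "tensor_sign 0 = 0"
  "tensor_sign (tens u m) = tens (U_sign u) (sign_op m)"
  by (simp_all add: tensor_sign_def lin_ext_simps)

lemma U_sign_add: "U_sign (u + v) = U_sign u + U_sign v"
proof -
  obtain p q where "u = env p" "v = env q" using env_cases by metis
  then show ?thesis by (simp add: U_sign_env falg_sign_def lin_ext_add flip: env_add)
qed

lemma U_sign_mult_env: "U_sign (u * env p) = U_sign u * env (falg_sign p)"
proof -
  obtain q where "u = env q" by (rule env_cases)
  then show ?thesis by (simp add: U_sign_env falg_sign_mult flip: env_mult)
qed

lemma tensor_sign_rel_span: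
  assumes "t \<in> rel_span"
  shows "tensor_sign t \<in> rel_span"
  using assms
proof (induction rule: pm_span_induct)
  case (base t)
  from base show ?case
  proof (cases rule: tensor_rels_cases)
    case (smult_left z p m)
    have "falg_sign (psmult z p) = psmult z (falg_sign p)" by (simp add: falg_sign_def lin_ext_psmult)
    then show ?thesis
      using tensor_rels_I(3)[OF sign_op_linear(1)[OF smult_left(1)]] smult_left
      by (simp add: tensor_sign_linear U_sign_env)
  qed (auto simp: tensor_sign_linear U_sign_add U_sign_mult_env sign_op_linear sign_op_falg_act
      intro!: tensor_rels_I falg_sign_bC)
qed (auto simp: tensor_sign_linear pm.span_zero intro: pm.span_add pm.span_scale)

lemma tensor_sign_part:
  assumes "t \<in> tensor_part i"
  shows "tensor_sign t - psmult (parity_sign i) t \<in> rel_span"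
  using assms unfolding tensor_part_def
proof (induction rule: pm_span_induct)
  case (add s t)
  have "tensor_sign (s + t) - psmult (parity_sign i) (s + t)
     = (tensor_sign s - psmult (parity_sign i) s) + (tensor_sign t - psmult (parity_sign i) t)"
    by (simp add: tensor_sign_linear pm.scale_right_distrib)
  then show ?case using add by (metis pm.span_add)
next
  case (smult z t)
  have "tensor_sign (psmult z t) - psmult (parity_sign i) (psmult z t)
     = psmult z (tensor_sign t - psmult (parity_sign i) t)"
    by (simp add: tensor_sign_linear pm.scale_right_diff_distrib mult.commute)
  then show ?case using smult by (metis pm.span_scale)
next
  case (base t)
  then obtain u m j k where t: "t = tens u m" "u \<in> U_part j" "m \<in> part M k" "j + k = i" by blast
  then have m: "m \<in> carrier M" by simp
  from t(2) obtain p where p: "u = env p" "U_sign u = env (psmult (parity_sign j) p)" by (rule U_sign_part)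
  have "tensor_sign t = tens (env (psmult (parity_sign j) p)) (parity_sign k \<odot> m)"
    by (simp only: t(1) tensor_sign_linear p(2) sign_op_part[OF t(3)])
  then have "tensor_sign t - psmult (parity_sign i) t
     = (tens (env (psmult (parity_sign j) p)) (parity_sign k \<odot> m)
        - psmult (parity_sign k) (tens (env (psmult (parity_sign j) p)) m))
     + psmult (parity_sign k) (tens (env (psmult (parity_sign j) p)) m - psmult (parity_sign j) (tens (env p) m))"
    unfolding t(4)[symmetric] parity_sign_add
    by (simp add: t(1) p(1) pm.scale_right_diff_distrib mult.commute)
  then show ?case
    using tensor_rels_I(3,4)[OF m] by (metis pm.span_add pm.span_scale)
qed (simp add: tensor_sign_linear pm.span_zero)

text \<open>
  The parity automorphism is \<open>1\<close> on the even and \<open>-1\<close> on the odd part, so the two parts meet in zero.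
\<close>

lemma tensor_part_disjoint:
  assumes "s \<in> tensor_part 0" "t \<in> tensor_part 1" "s - t \<in> rel_span"
  shows "s \<in> rel_span"
proof -
  have "psmult 2 s = (tensor_sign (s - t) - (tensor_sign s - s) + (tensor_sign t + t)) + (s - t)"
    by (simp add: tensor_sign_linear pm.scale_left_distrib[of 1 1, simplified])
  moreover have "tensor_sign s - s \<in> rel_span" "tensor_sign t + t \<in> rel_span"
    using tensor_sign_part[OF assms(1)] tensor_sign_part[OF assms(2)] by (simp_all add: parity_sign_def)
  ultimately have "psmult 2 s \<in> rel_span"
    using tensor_sign_rel_span[OF assms(3)] assms(3) by (metis pm.span_add pm.span_diff)
  from pm.span_scale[OF this, of "1/2"] show ?thesis by simp
qed

lemma tensors_decomp:
  assumes "t \<in> tensors"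
  obtains t0 t1 where "t0 \<in> tensor_part 0" "t1 \<in> tensor_part 1" "t - (t0 + t1) \<in> rel_span"
proof -
  have "\<exists>t0\<in>tensor_part 0. \<exists>t1\<in>tensor_part 1. t - (t0 + t1) \<in> rel_span"
    using assms
  proof (induction rule: pm_span_induct)
    case zero
    show ?case
      by (rule bexI[of _ 0], rule bexI[of _ 0]) (simp_all add: tensor_part_def pm.span_zero)
  next
    case (add s t)
    then obtain s0 s1 t0 t1 where *: "s0 \<in> tensor_part 0" "s1 \<in> tensor_part 1" "s - (s0 + s1) \<in> rel_span"
      "t0 \<in> tensor_part 0" "t1 \<in> tensor_part 1" "t - (t0 + t1) \<in> rel_span" by blast
    have "(s + t) - ((s0 + t0) + (s1 + t1)) = (s - (s0 + s1)) + (t - (t0 + t1))" by simp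
    then have "(s + t) - ((s0 + t0) + (s1 + t1)) \<in> rel_span"
      using pm.span_add[OF *(3,6)] by (simp only:)
    moreover have "s0 + t0 \<in> tensor_part 0" "s1 + t1 \<in> tensor_part 1"
      using * unfolding tensor_part_def by (blast intro: pm.span_add)+
    ultimately show ?case by blast
  next
    case (smult z t)
    then obtain t0 t1 where *: "t0 \<in> tensor_part 0" "t1 \<in> tensor_part 1" "t - (t0 + t1) \<in> rel_span" by blast
    have "psmult z t - (psmult z t0 + psmult z t1) = psmult z (t - (t0 + t1))"
      by (simp add: pm.scale_right_distrib pm.scale_right_diff_distrib)
    then have "psmult z t - (psmult z t0 + psmult z t1) \<in> rel_span"
      using pm.span_scale[OF *(3), of z] by (simp only:)
    moreover have "psmult z t0 \<in> tensor_part 0" "psmult z t1 \<in> tensor_part 1"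
      using * unfolding tensor_part_def by (blast intro: pm.span_scale)+
    ultimately show ?case by blast
  next
    case (base t)
    then obtain u m where t: "t = tens u m" "m \<in> carrier M" by blast
    obtain u0 u1 where u: "u0 \<in> U_part 0" "u1 \<in> U_part 1" "u = u0 + u1" by (rule U_part_decomp)
    obtain m0 m1 where m: "m0 \<in> part M 0" "m1 \<in> part M 1" "m = m0 \<oplus> m1" using part_decomp[OF t(2)] by blast
    have mc: "m0 \<in> carrier M" "m1 \<in> carrier M" using m by auto
    have p: "tens x y \<in> tensor_part i" if "x \<in> U_part j" "y \<in> part M k" "j + k = i" for x y i j k
      unfolding tensor_part_def using that by (intro pm.span_base) blast
    have "t - ((tens u0 m0 + tens u1 m1) + (tens u0 m1 + tens u1 m0))
      = (tens (u0 + u1) (m0 \<oplus> m1) - tens (u0 + u1) m0 - tens (u0 + u1) m1)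
      + (tens (u0 + u1) m0 - tens u0 m0 - tens u1 m0) + (tens (u0 + u1) m1 - tens u0 m1 - tens u1 m1)"
      by (simp add: t u m)
    also have "\<dots> \<in> rel_span"
      using mc by (intro pm.span_add tensor_rels_I)
    finally have "t - ((tens u0 m0 + tens u1 m1) + (tens u0 m1 + tens u1 m0)) \<in> rel_span" .
    moreover have "tens u0 m0 + tens u1 m1 \<in> tensor_part 0"
      using p[OF u(1) m(1)] p[OF u(2) m(2)] unfolding tensor_part_def by (intro pm.span_add) auto
    moreover have "tens u0 m1 + tens u1 m0 \<in> tensor_part 1"
      using p[OF u(1) m(2)] p[OF u(2) m(1)] unfolding tensor_part_def by (intro pm.span_add) auto
    ultimately show ?case by blast
  qed
  with that show thesis by blast
qed

lemma left_mult_part: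
  assumes "u \<in> U_part i" "t \<in> tensor_part j"
  shows "left_mult u t \<in> tensor_part (i + j)"
  using assms(2) unfolding tensor_part_def
proof (induction rule: pm_span_induct)
  case (base t)
  then obtain x m l k where t: "t = tens x m" "x \<in> U_part l" "m \<in> part M k" "l + k = j" by blast
  have "u * x \<in> U_part (i + l)" "(i + l) + k = i + j"
    using U_part_mult[OF assms(1) t(2)] t(4) by (simp_all only: add.assoc)
  then show ?case unfolding t(1) left_mult_tens using t(3) by (intro pm.span_base) blast
qed (simp_all only: left_mult_linear pm.span_zero pm.span_add pm.span_scale)

theorem Ind_supermodule: "supermodule UNIV (Ind c M)"
proof -
  interpret I: complex_module "Ind c M" by (rule Ind_complex_module)
  have E_add: "tw_to_falg (x + y) = tw_to_falg x + tw_to_falg y"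
    and E_psmult: "tw_to_falg (psmult z x) = psmult z (tw_to_falg x)" for x y z
    by (simp_all add: tw_to_falg_eq lin_ext_simps)
  show ?thesis
  proof (rule supermodule.intro[OF I.module_axioms], rule supermodule_axioms.intro)
    show "submodule (part (Ind c M) i) complex_field (Ind c M)" for i
    proof (rule I.submodule_I)
      show "part (Ind c M) i \<subseteq> carrier (Ind c M)"
        using tensor_part_subset by (auto simp: Ind_part Ind_carrier)
      show "\<zero>\<^bsub>Ind c M\<^esub> \<in> part (Ind c M) i"
        unfolding Ind_part Ind_zero tensor_part_def by (intro imageI pm.span_zero)
      show "v \<oplus>\<^bsub>Ind c M\<^esub> w \<in> part (Ind c M) i" if "v \<in> part (Ind c M) i" "w \<in> part (Ind c M) i" for v w
        using that unfolding Ind_part tensor_part_def by (auto simp: Ind_add intro: pm.span_add)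
      show "z \<odot>\<^bsub>Ind c M\<^esub> v \<in> part (Ind c M) i" if "v \<in> part (Ind c M) i" for z v
        using that unfolding Ind_part tensor_part_def by (auto simp: Ind_smult intro: pm.span_scale)
    qed
    show "part (Ind c M) 0 \<inter> part (Ind c M) 1 = {\<zero>\<^bsub>Ind c M\<^esub>}"
    proof -
      have "cls 0 \<in> cls ` tensor_part i" for i
        unfolding tensor_part_def by (intro imageI pm.span_zero)
      moreover have "v = cls 0" if v: "v \<in> cls ` tensor_part 0" "v \<in> cls ` tensor_part 1" for v
      proof -
        from v obtain s t where *: "v = cls s" "s \<in> tensor_part 0" "v = cls t" "t \<in> tensor_part 1" by blast
        then have "s - t \<in> rel_span" using cls_eq_iff by metis
        with * have "s \<in> rel_span" using tensor_part_disjoint by blast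
        then show ?thesis using *(1) by (simp add: cls_eq_iff)
      qed
      ultimately show ?thesis unfolding Ind_part Ind_zero by blast
    qed
    show "carrier (Ind c M) = part (Ind c M) 0 <+>\<^bsub>Ind c M\<^esub> part (Ind c M) 1"
    proof (intro subset_antisym subsetI)
      fix v assume "v \<in> carrier (Ind c M)"
      then obtain t where t: "v = cls t" "t \<in> tensors" by (auto simp: Ind_carrier)
      from t(2) obtain t0 t1 where *: "t0 \<in> tensor_part 0" "t1 \<in> tensor_part 1" "t - (t0 + t1) \<in> rel_span"
        by (rule tensors_decomp)
      then have "v = cls t0 \<oplus>\<^bsub>Ind c M\<^esub> cls t1" by (simp add: t(1) Ind_add cls_eq_iff)
      with * show "v \<in> part (Ind c M) 0 <+>\<^bsub>Ind c M\<^esub> part (Ind c M) 1"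
        unfolding set_add_def' Ind_part by blast
    next
      fix v assume "v \<in> part (Ind c M) 0 <+>\<^bsub>Ind c M\<^esub> part (Ind c M) 1"
      then obtain t0 t1 where "t0 \<in> tensor_part 0" "t1 \<in> tensor_part 1" "v = cls t0 \<oplus>\<^bsub>Ind c M\<^esub> cls t1"
        unfolding set_add_def' Ind_part by blast
      moreover from this have "t0 + t1 \<in> tensors" using tensor_part_subset by (blast intro: pm.span_add)
      ultimately show "v \<in> carrier (Ind c M)" by (simp add: Ind_add Ind_carrier)
    qed
  next
    fix x v assume "v \<in> carrier (Ind c M)"
    then obtain t where t: "v = cls t" "t \<in> tensors" by (auto simp: Ind_carrier)
    show "act (Ind c M) x v \<in> carrier (Ind c M)"
      using t by (simp add: Ind_act Ind_carrier left_mult_tensors)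
    show "act (Ind c M) (x + y) v = act (Ind c M) x v \<oplus>\<^bsub>Ind c M\<^esub> act (Ind c M) y v" for y
      using left_mult_env_add[OF t(2)] by (simp add: t(1) Ind_act Ind_add cls_eq_iff E_add)
    show "act (Ind c M) (psmult z x) v = z \<odot>\<^bsub>Ind c M\<^esub> act (Ind c M) x v" for z
      using left_mult_psmult_left[OF t(2)] by (simp add: t(1) Ind_act Ind_smult cls_eq_iff E_psmult)
    show "act (Ind c M) x (z \<odot>\<^bsub>Ind c M\<^esub> v) = z \<odot>\<^bsub>Ind c M\<^esub> act (Ind c M) x v" for z
      by (simp add: t(1) Ind_act Ind_smult left_mult_linear)
    show "act (Ind c M) x (v \<oplus>\<^bsub>Ind c M\<^esub> w) = act (Ind c M) x v \<oplus>\<^bsub>Ind c M\<^esub> act (Ind c M) x w"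
      if "w \<in> carrier (Ind c M)" for w
      using that by (auto simp: Ind_carrier t(1) Ind_act Ind_add left_mult_linear)
  next
    fix x i v j assume "x \<in> UNIV \<inter> tw_part i" "v \<in> part (Ind c M) j"
    then show "act (Ind c M) x v \<in> part (Ind c M) (i + j)"
      using left_mult_part[OF env_tw_part] unfolding Ind_part by (force simp only: Ind_act Int_iff)
  next
    fix x i y j v assume xy: "x \<in> UNIV \<inter> tw_part i" "y \<in> UNIV \<inter> tw_part j" and "v \<in> carrier (Ind c M)"
    then obtain t where t: "v = cls t" "t \<in> tensors" by (auto simp: Ind_carrier)
    have cl: "cls (left_mult u t) \<in> carrier (Ind c M)" for u
      using t(2) by (simp add: Ind_carrier left_mult_tensors)
    let ?s = "ssign i j" and ?x = "tw_to_falg x" and ?y = "tw_to_falg y"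
    have "act (Ind c M) (bracket x y) v = cls (left_mult (env (?x * ?y)) t - psmult ?s (left_mult (env (?y * ?x)) t))"
      unfolding t(1) Ind_act env_bracket[OF xy[THEN IntD2]] cls_eq_iff by (rule left_mult_env_diff[OF t(2)])
    also have "\<dots> = cls (left_mult (env (?x * ?y)) t) \<oplus>\<^bsub>Ind c M\<^esub> (-1) \<odot>\<^bsub>Ind c M\<^esub> (?s \<odot>\<^bsub>Ind c M\<^esub> cls (left_mult (env (?y * ?x)) t))"
      by (simp add: Ind_add Ind_smult)
    also have "\<dots> = act (Ind c M) x (act (Ind c M) y v) \<ominus>\<^bsub>Ind c M\<^esub> ?s \<odot>\<^bsub>Ind c M\<^esub> act (Ind c M) y (act (Ind c M) x v)"
      by (simp add: t(1) Ind_act left_mult_mult env_mult I.diff_eq_smult cl)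
    finally show "act (Ind c M) (bracket x y) v
       = act (Ind c M) x (act (Ind c M) y v) \<ominus>\<^bsub>Ind c M\<^esub> ?s \<odot>\<^bsub>Ind c M\<^esub> act (Ind c M) y (act (Ind c M) x v)" .
  qed
qed

end


section \<open>The vectors of the inducing module survive\<close>

context lie_superalgebra_basis
begin

lemma normal_Cons: "normal (a # b # w) \<longleftrightarrow> \<not> bad a b \<and> normal (b # w)"
proof
  assume n: "normal (a # b # w)"
  have "\<not> bad x y" if "b # w = u @ x # y # v" for u x y v
    using n[unfolded normal_def, rule_format, of "a # u" x y v] that by simp
  moreover have "\<not> bad a b"
    using n[unfolded normal_def, rule_format, of "[]" a b w] by simp
  ultimately show "\<not> bad a b \<and> normal (b # w)" by (auto simp: normal_def)
next
  assume n: "\<not> bad a b \<and> normal (b # w)"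
  show "normal (a # b # w)"
    unfolding normal_def
  proof (intro allI impI)
    fix u x y v assume eq: "a # b # w = u @ x # y # v"
    show "\<not> bad x y"
    proof (cases u)
      case Nil
      with eq n show ?thesis by simp
    next
      case (Cons z u')
      with eq have "b # w = u' @ x # y # v" by simp
      with n show ?thesis unfolding normal_def by blast
    qed
  qed
qed

lemma normal_Nil [simp]: "normal []" and normal_single [simp]: "normal [a]"
  by (simp_all add: normal_def Cons_eq_append_conv)

lemma normal_append:
  assumes "normal v" "normal w" "\<And>a b. a \<in> set v \<Longrightarrow> b \<in> set w \<Longrightarrow> \<not> bad a b"
  shows "normal (v @ w)"
  using assms
proof (induction v)
  case (Cons a v)
  have "normal v" using Cons.prems(1) by (cases v) (auto simp: normal_Cons)
  with Cons have IH: "normal (v @ w)" by simp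
  show ?case
  proof (cases v)
    case Nil
    then show ?thesis using Cons.prems by (cases w) (auto simp: normal_Cons)
  next
    case (Cons b v')
    then show ?thesis using IH \<open>normal (a # v)\<close> by (simp add: normal_Cons)
  qed
qed simp

lemma normal_split:
  assumes "normal w"
  shows "\<exists>w1 w2. w = w1 @ w2 \<and> normal w1 \<and> (\<forall>a\<in>set w1. rk a < 0) \<and> (\<forall>a\<in>set w2. 0 \<le> rk a)"
  using assms
proof (induction w)
  case (Cons a w)
  have "normal w" using Cons.prems by (cases w) (auto simp: normal_Cons)
  then obtain w1 w2 where w: "w = w1 @ w2" "normal w1" "\<forall>a\<in>set w1. rk a < 0" "\<forall>a\<in>set w2. 0 \<le> rk a"
    using Cons.IH by blast
  show ?case
  proof (cases "rk a < 0")
    case True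
    have "normal (a # w1)"
      using Cons.prems w by (cases w1) (auto simp: normal_Cons)
    with True w show ?thesis by (intro exI[of _ "a # w1"] exI[of _ w2]) auto
  next
    case False
    have "w1 = []"
    proof (cases w1)
      case (Cons b w1')
      then have "\<not> bad a b" using \<open>normal (a # w)\<close> w by (simp add: normal_Cons)
      with False w(3) Cons show ?thesis by (auto simp: bad_def)
    qed
    with False w show ?thesis by (intro exI[of _ "[]"] exI[of _ "a # w2"]) auto
  qed
qed auto

lemma keys_nf: "x \<in> Poly_Mapping.keys (nf w) \<Longrightarrow> normal x"
proof (induction w arbitrary: x rule: nf_induct)
  case (normal w)
  then show ?case by (simp add: nf_normal)
next
  case (rewrite u a b v)
  have "Poly_Mapping.keys (nf (u @ a # b # v)) \<subseteq> {x. normal x}"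
    unfolding rewrite(2) nfc_expand by (rule keys_lin_ext, rule subsetI) (simp add: rewrite(3))
  then show ?case using rewrite(4) by auto
qed

lemma keys_NF: "Poly_Mapping.keys (NF p) \<subseteq> {x. normal x}"
  by (rule keys_lin_ext, rule subsetI) (simp add: keys_nf)

end

text \<open>
  The component in \<open>U(\<bb> \<oplus> \<complex>C)\<close> of an element of the enveloping algebra, with respect to the
  basis of normal words, which are products of a word in basis elements outside \<open>\<bb> \<oplus> \<complex>C\<close>
  and a word in basis elements of \<open>\<bb> \<oplus> \<complex>C\<close>.
\<close>

definition bC_part :: "falg \<Rightarrow> falg" where
  "bC_part = lin_ext (\<lambda>w. if set w \<subseteq> bCgens then word w else 0)"

lift_definition bC_component :: "U \<Rightarrow> falg" is "\<lambda>p. bC_part (tw.NF p)"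
proof -
  fix p q assume "env_eq p q"
  then have "tw.NF (p - q) = 0" by (simp add: env_eq_def NF_env_ideal)
  then show "bC_part (tw.NF p) = bC_part (tw.NF q)" by (simp add: lin_ext_diff)
qed

lemma bC_part_bC: "bC_part p \<in> falg_bC"
  unfolding bC_part_def
  by (rule lin_ext_in_subspace[OF subspace_falg_bC]) (auto simp: falg_bC_def)

lemma bC_part_id: "p \<in> falg_bC \<Longrightarrow> bC_part p = p"
proof -
  assume "p \<in> falg_bC"
  then have "bC_part p = lin_ext word p"
    unfolding bC_part_def by (intro lin_ext_cong) (auto simp: falg_bC_def)
  then show ?thesis by (simp only: lin_ext_id)
qed

lemma NF_bC: "p \<in> falg_bC \<Longrightarrow> tw.NF p \<in> falg_bC"
  by (rule lin_ext_in_subspace[OF subspace_falg_bC]) (auto simp: falg_bC_def intro!: nf_bC[unfolded falg_bC_def, simplified])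

lemma bC_component_linear:
  "bC_component (u + v) = bC_component u + bC_component v"
  "bC_component (env (psmult z p)) = psmult z (bC_component (env p))"
proof -
  obtain x y where "u = env x" "v = env y" using env_cases by metis
  then show "bC_component (u + v) = bC_component u + bC_component v"
    by (simp add: bC_component.abs_eq bC_part_def lin_ext_add flip: env_add)
  show "bC_component (env (psmult z p)) = psmult z (bC_component (env p))"
    by (simp add: bC_component.abs_eq bC_part_def lin_ext_psmult)
qed

lemma bC_component_bC: "bC_component u \<in> falg_bC"
proof -
  obtain p where "u = env p" by (rule env_cases)
  then show ?thesis by (simp add: bC_component.abs_eq bC_part_bC)
qed

text \<open>A nonempty normal prefix outside \<open>\<bb> \<oplus> \<complex>C\<close> is not affected by what follows it.\<close>

lemma bC_part_prefix:
  assumes w: "tw.normal w" "\<forall>a\<in>set w. gen_rank a < 0" "w \<noteq> []" and r: "r \<in> falg_bC"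
  shows "bC_part (tw.NF (word w * r)) = 0"
proof -
  have "word w * (r - tw.NF r) \<in> env_ideal"
    by (intro env_ideal_mult_left NF_env_ideal_diff)
  then have "tw.NF (word w * r) = tw.NF (word w * tw.NF r)"
    using NF_env_ideal by (force simp: right_diff_distrib lin_ext_diff)
  also have "\<dots> = lin_ext (\<lambda>x. tw.nf (w @ x)) (tw.NF r)"
    by (subst lin_ext_left_word[symmetric]) (simp add: lin_ext_lin_ext)
  also have "\<dots> = lin_ext (\<lambda>x. word (w @ x)) (tw.NF r)"
  proof (rule lin_ext_cong)
    fix x assume x: "x \<in> Poly_Mapping.keys (tw.NF r)"
    have "set x \<subseteq> bCgens" using NF_bC[OF r] x by (auto simp: falg_bC_def)
    moreover have "tw.normal x" using subsetD[OF tw.keys_NF x] by simp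
    moreover have "\<not> tw.bad a b" if "gen_rank a < 0" "b \<in> bCgens" for a b
      using that gen_rank_nonneg[of b] by (auto simp: tw.bad_def)
    ultimately have "tw.normal (w @ x)"
      using w(1,2) by (intro tw.normal_append) blast+
    then show "tw.nf (w @ x) = word (w @ x)" by (rule tw.nf_normal)
  qed
  finally have "bC_part (tw.NF (word w * r)) = lin_ext (\<lambda>x. bC_part (word (w @ x))) (tw.NF r)"
    by (simp add: bC_part_def lin_ext_lin_ext)
  also have "\<dots> = lin_ext (\<lambda>x. 0) (tw.NF r)"
  proof (rule lin_ext_cong)
    obtain a where "a \<in> set w" "a \<notin> bCgens"
      using w(2,3) gen_rank_nonneg by (metis list.set_intros(1) neq_Nil_conv not_le)
    then show "bC_part (word (w @ x)) = 0" for x by (auto simp: bC_part_def)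
  qed
  finally show ?thesis by (simp add: lin_ext_def)
qed

context b_module
begin

text \<open>Taking the component is compatible with right multiplication by \<open>U(\<bb> \<oplus> \<complex>C)\<close>, so it passes to the tensor product.\<close>

lemma bC_component_balanced:
  assumes p: "p \<in> falg_bC" and m: "m \<in> carrier M"
  shows "falg_act c M (bC_component (u * env p)) m = falg_act c M (bC_component u) (falg_act c M p m)"
proof -
  obtain q where q: "u = env q" by (rule env_cases)
  have "u = env (tw.NF q)" unfolding q env_eq_iff by (rule NF_env_ideal_diff)
  then have u: "bC_component (u * env p) = bC_part (tw.NF (tw.NF q * p))" "bC_component u = bC_part (tw.NF (tw.NF q))"
    by (simp_all add: bC_component.abs_eq flip: env_mult)
  have lin: "bC_part (tw.NF (x + y)) = bC_part (tw.NF x) + bC_part (tw.NF y)"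
    "bC_part (tw.NF (psmult z x)) = psmult z (bC_part (tw.NF x))" for x y z
    by (simp_all add: bC_part_def lin_ext_simps)
  have "falg_act c M (bC_part (tw.NF (x * p))) m = falg_act c M (bC_part (tw.NF x)) (falg_act c M p m)"
    if "Poly_Mapping.keys x \<subseteq> {w. tw.normal w}" for x
    using that
  proof (induction x rule: basis_induct)
    case zero
    then show ?case by (simp add: bC_part_def falg_act_eq)
  next
    case (add x y)
    then show ?case using m p by (simp add: distrib_right lin falg_act_add bC_part_bC)
  next
    case (smult z x)
    then show ?case using m p by (simp add: psmult_mult lin falg_act_psmult bC_part_bC)
  next
    case (basis w)
    then obtain w1 w2 where w: "w = w1 @ w2" "tw.normal w1" "\<forall>a\<in>set w1. gen_rank a < 0" "\<forall>a\<in>set w2. 0 \<le> gen_rank a"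
      using tw.normal_split by blast
    have w2: "set w2 \<subseteq> bCgens" using w(4) gen_rank_nonneg by blast
    have r: "word w2 * p \<in> falg_bC" using word_bC[OF w2] p by (rule falg_bC_mult)
    show ?case
    proof (cases "w1 = []")
      case True
      then show ?thesis
        using w w2 r p m NF_bC[OF r] NF_bC[OF word_bC[OF w2]]
        by (simp add: bC_part_id falg_act_NF falg_act_word_mult falg_act_nf)
    next
      case False
      have "bC_part (tw.NF (word w * p)) = 0" "bC_part (tw.NF (word w)) = 0"
        using bC_part_prefix[OF w(2,3) False r] bC_part_prefix[OF w(2,3) False word_bC[OF w2]]
        by (simp_all add: w(1) word_mult word_mult_left)
      then show ?thesis by (simp only: falg_act_eq mlin_zero)
    qed
  qed
  from this[OF tw.keys_NF] show ?thesis by (simp only: u)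
qed

lemma mlin_diff:
  assumes "\<And>i. i \<in> I \<Longrightarrow> f i \<in> carrier M" "Poly_Mapping.keys s \<subseteq> I" "Poly_Mapping.keys t \<subseteq> I"
  shows "mlin f (s - t) = mlin f s \<ominus> mlin f t"
proof -
  have "Poly_Mapping.keys (psmult (-1) t) \<subseteq> I" using keys_psmult[of "-1" t] assms(3) by blast
  then have "mlin f (s + psmult (-1) t) = mlin f s \<oplus> (-1) \<odot> mlin f t"
    using mlin_add[of I f s "psmult (-1) t"] mlin_smult[of t f "-1"] assms by (simp add: subset_iff)
  then show ?thesis
    using assms mlin_closed[of s f] mlin_closed[of t f] by (simp add: psmult_minus_one diff_eq_smult subset_iff)
qed

text \<open>The map that lets the component of \<open>u\<close> act on \<open>m\<close> kills all tensor relations and is the identity on \<open>1 \<otimes> M\<close>.\<close>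

theorem tens_one_eq_zero:
  assumes "m \<in> carrier M" "tens 1 m \<in> rel_span"
  shows "m = \<zero>"
proof -
  define f where "f = (\<lambda>(u, m). falg_act c M (bC_component u) m)"
  let ?I = "UNIV \<times> carrier M"
  have f: "i \<in> ?I \<Longrightarrow> f i \<in> carrier M" for i
    by (auto simp: f_def bC_component_bC)
  have ft: "mlin f (tens u m) = falg_act c M (bC_component u) m" if "m \<in> carrier M" for u m
    using mlin_basis[of f "(u, m)"] that by (simp add: f_def bC_component_bC)
  have K: "pm.subspace {t. Poly_Mapping.keys t \<subseteq> ?I}"
    unfolding pm.subspace_def using keys_add keys_psmult by (auto dest!: subsetD[OF keys_add] subsetD[OF keys_psmult])
  have tK: "Poly_Mapping.keys (tens u m) \<subseteq> ?I" if "m \<in> carrier M" for u m using that by auto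
  have dK: "Poly_Mapping.keys (s - t) \<subseteq> ?I" if "Poly_Mapping.keys s \<subseteq> ?I" "Poly_Mapping.keys t \<subseteq> ?I" for s t :: "(U \<times> 'v) \<Rightarrow>\<^sub>0 complex"
    using pm.subspace_diff[OF K, of s t] that by simp
  have sK: "Poly_Mapping.keys (psmult z t) \<subseteq> ?I" if "Poly_Mapping.keys t \<subseteq> ?I" for z and t :: "(U \<times> 'v) \<Rightarrow>\<^sub>0 complex"
    using pm.subspace_scale[OF K, of t z] that by simp
  have fd: "mlin f (s - t) = mlin f s \<ominus> mlin f t"
    if "Poly_Mapping.keys s \<subseteq> ?I" "Poly_Mapping.keys t \<subseteq> ?I" for s t :: "(U \<times> 'v) \<Rightarrow>\<^sub>0 complex"
    by (rule mlin_diff[OF f that])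
  have fs: "mlin f (psmult z t) = z \<odot> mlin f t" if "Poly_Mapping.keys t \<subseteq> ?I" for z and t :: "(U \<times> 'v) \<Rightarrow>\<^sub>0 complex"
    by (rule mlin_smult) (rule f, rule subsetD[OF that])
  have "Poly_Mapping.keys (tens 1 m) \<subseteq> ?I \<and> mlin f (tens 1 m) = \<zero>"
    using assms(2)
  proof (induction rule: pm_span_induct)
    case zero
    then show ?case by simp
  next
    case (add s t)
    then show ?case
      using mlin_add[of ?I f s t] f pm.subspace_add[OF K, of s t] by simp
  next
    case (smult z t)
    then show ?case using fs[of t z] sK[of t z] by simp
  next
    case (base t)
    note simps = tK dK sK fd fs ft bC_component_bC bC_component_linear falg_act_linear falg_act_add
      falg_act_psmult falg_act_closed diff_zero_iff M.minus_closed
    from base show ?case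
    proof (cases rule: tensor_rels_cases)
      case (add_left u u' m)
      have "a \<oplus> b \<ominus> a \<ominus> b = \<zero>" if "a \<in> carrier M" "b \<in> carrier M" for a b
        using that by (simp add: a_minus_def M.a_assoc) (metis M.a_comm M.a_assoc M.r_neg M.l_neg M.a_inv_closed M.r_zero)
      then show ?thesis using add_left by (simp add: simps)
    next
      case (add_right u m m')
      have "a \<oplus> b \<ominus> a \<ominus> b = \<zero>" if "a \<in> carrier M" "b \<in> carrier M" for a b
        using that by (simp add: a_minus_def M.a_assoc) (metis M.a_comm M.a_assoc M.r_neg M.l_neg M.a_inv_closed M.r_zero)
      then show ?thesis using add_right by (simp add: simps)
    next
      case (smult_left z p m)
      then show ?thesis by (simp add: simps)
    next
      case (smult_right z u m)
      then show ?thesis by (simp add: simps)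
    next
      case (balance u p m)
      then show ?thesis by (simp add: simps bC_component_balanced)
    qed
  qed
  moreover have "bC_component 1 = 1"
    using bC_part_id[OF one_falg_bC] tw.nf_normal[OF tw.normal_Nil]
    by (simp add: bC_component.abs_eq flip: env_1 word_Nil)
  ultimately show ?thesis
    using ft[OF assms(1), of 1] falg_act_word[of "[]" m] assms(1) by (simp add: word_Nil)
qed

end


section \<open>Simplicity of the induced module\<close>

text \<open>The basis elements that span a complement of \<open>\<bb> \<oplus> \<complex>C\<close>.\<close>

definition cgens :: "gen set" where
  "cgens = {g. deg g \<le> 0 \<and> g \<noteq> Cg}"

lemma deg_nonpos: "deg g \<le> 0 \<Longrightarrow> g \<in> cgens \<or> g = Cg"
  by (simp add: cgens_def)

lemma finite_cgens: "finite {g \<in> cgens. - D \<le> deg g}"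
proof (rule finite_subset)
  show "{g \<in> cgens. - D \<le> deg g} \<subseteq> Lg ` {-D..0} \<union> Tg ` {-D-1..0} \<union> Gg ` {-D..0}"
  proof
    fix g assume "g \<in> {g \<in> cgens. - D \<le> deg g}"
    then show "g \<in> Lg ` {-D..0} \<union> Tg ` {-D-1..0} \<union> Gg ` {-D..0}"
      by (cases g) (auto simp: cgens_def)
  qed
qed simp

lemma gen_eqI: "deg g = deg h \<Longrightarrow> parity g = parity h \<Longrightarrow> g \<noteq> Cg \<Longrightarrow> h \<noteq> Cg \<Longrightarrow> g = h"
  by (cases g; cases h; simp; presburger)

text \<open>The weight of a word is minus its doubled degree; it is nonnegative in the complement.\<close>

definition weight :: "gen list \<Rightarrow> int" where
  "weight w = - (\<Sum>a\<leftarrow>w. deg a)"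

lemma weight_simps [simp]: "weight [] = 0" "weight (a # w) = weight w - deg a"
  by (simp_all add: weight_def)

lemma weight_nonneg: "set w \<subseteq> cgens \<Longrightarrow> 0 \<le> weight w"
  by (induction w) (auto simp: cgens_def)

lemma weight_letter: "set w \<subseteq> cgens \<Longrightarrow> a \<in> set w \<Longrightarrow> - weight w \<le> deg a"
proof (induction w)
  case (Cons b w)
  then show ?case using weight_nonneg[of w] by (auto simp: cgens_def)
qed simp

text \<open>
  The partner of \<open>y\<close> with respect to \<open>T\<^sub>u\<close>, \<open>u = k + 1/2\<close>: the bracket of the partner with
  \<open>y\<close> is a nonzero multiple of \<open>T\<^sub>u\<close>.
\<close>

fun partner :: "int \<Rightarrow> gen \<Rightarrow> gen" where
  "partner k (Lg m) = Tg (k - m)"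
| "partner k (Tg r) = Lg (k - r)"
| "partner k (Gg q) = Gg (2 * k + 1 - q)"
| "partner k Cg = Cg"

fun pairing :: "int \<Rightarrow> gen \<Rightarrow> complex" where
  "pairing k (Lg m) = hf (2 * (k - m) + 1)"
| "pairing k (Tg r) = - hf (2 * r + 1)"
| "pairing k (Gg q) = (-1) powi (2 * k + 2 - q) * (hf (2 * k + 1 - q) - hf q)"
| "pairing k Cg = 0"

lemma hf_odd: "hf (2 * i + 1) \<noteq> 0"
proof -
  have "2 * i + 1 \<noteq> 0" by presburger
  then have "of_int (2 * i + 1) \<noteq> (0 :: complex)" by (simp only: of_int_eq_0_iff not_False_eq_True)
  then show ?thesis by (simp add: hf_def)
qed

lemma partner_simps:
  assumes "y \<in> cgens"
  shows "parity (partner k y) = parity y" "deg (partner k y) = 2 * k + 1 - deg y"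
    "gbracket (partner k y) y = psmult (pairing k y) (basis (Tg k))" "pairing k y \<noteq> 0"
proof -
  have G: "hf (2 * k + 1 - q) - hf q \<noteq> 0" for q
    using hf_odd[of "k - q"] by (simp add: hf_def algebra_simps diff_divide_distrib add_divide_distrib)
  have odd: "odd (2 * k + 1 - q + q)" for q by simp
  show "parity (partner k y) = parity y" "deg (partner k y) = 2 * k + 1 - deg y" 
    using assms by (cases y; simp add: cgens_def)+
  show "gbracket (partner k y) y = psmult (pairing k y) (basis (Tg k))"
    using assms by (cases y) (auto simp: cgens_def algebra_simps)
  show "pairing k y \<noteq> 0"
  proof (cases y)
    case (Lg m)
    then show ?thesis using hf_odd[of "k - m"] by (simp only: pairing.simps not_False_eq_True)
  next
    case (Gg q)
    then show ?thesis using G[of q] by simp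
  qed (use assms hf_odd in \<open>auto simp: cgens_def\<close>)
qed

lemma partner_bracket_other:
  assumes "y \<in> cgens" "y' \<in> cgens" "Tg k \<in> Poly_Mapping.keys (gbracket (partner k y) y')"
  shows "y' = y"
proof -
  from key_gbracket[OF assms(3)] partner_simps(1,2)[OF assms(1), of k]
  have "deg y' = deg y" "parity y + parity y' = 0" by auto
  then have "parity y' = parity y" by (cases "parity y"; cases "parity y'") auto
  with \<open>deg y' = deg y\<close> assms(1,2) show ?thesis by (intro gen_eqI) (auto simp: cgens_def)
qed

text \<open>
  The properties of \<open>M\<close> from which simplicity follows: \<open>T\<^sub>u\<close> is a nonzero scalar, and the other basis
  elements of degree at least \<open>u\<close> vanish.
\<close>

locale whittaker_module = b_module M c for M :: "'v super_module" (structure) and c +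
  fixes k :: int and lam :: complex
  assumes simple: "simple_supermodule b_alg M" and k: "k \<ge> 1" and lam: "lam \<noteq> 0"
    and scalar: "v \<in> carrier M \<Longrightarrow> ga (Tg k) v = lam \<odot> v"
    and kills: "2 * k + 1 \<le> deg x \<Longrightarrow> x \<noteq> Tg k \<Longrightarrow> v \<in> carrier M \<Longrightarrow> ga x v = \<zero>"
begin

text \<open>The action of a basis element on representatives, and the tensor of a word applied to \<open>1 \<otimes> m\<close>.\<close>

abbreviation A :: "gen \<Rightarrow> ((U \<times> 'v) \<Rightarrow>\<^sub>0 complex) \<Rightarrow> ((U \<times> 'v) \<Rightarrow>\<^sub>0 complex)" where
  "A a \<equiv> left_mult (env (word [a]))"

abbreviation wv :: "gen list \<Rightarrow> 'v \<Rightarrow> ((U \<times> 'v) \<Rightarrow>\<^sub>0 complex)" where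
  "wv w m \<equiv> tens (env (word w)) m"

lemma A_wv: "A a (wv w m) = wv (a # w) m"
  by (simp add: word_mult flip: env_mult)

lemmas A_linear = left_mult_linear

lemma A_sum: "A a (\<Sum>i\<in>S. f i) = (\<Sum>i\<in>S. A a (f i))"
  by (induction S rule: infinite_finite_induct) (simp_all add: A_linear)

text \<open>The action of a linear combination of basis elements.\<close>

abbreviation act_lin :: "tw \<Rightarrow> ((U \<times> 'v) \<Rightarrow>\<^sub>0 complex) \<Rightarrow> ((U \<times> 'v) \<Rightarrow>\<^sub>0 complex)" where
  "act_lin x t \<equiv> lin_ext (\<lambda>g. A g t) x"

lemma act_lin_env:
  assumes t: "t \<in> tensors"
  shows "left_mult (env (tw_to_falg x)) t - act_lin x t \<in> rel_span"
proof -
  have "Poly_Mapping.keys x \<subseteq> UNIV" by simp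
  then show ?thesis
  proof (induction x rule: basis_induct)
    case zero
    then show ?case using left_mult_psmult_left[OF t, of 0 0] by (simp add: tw_to_falg_eq)
  next
    case (add x y)
    have "left_mult (env (tw_to_falg (x + y))) t - act_lin (x + y) t
      = (left_mult (env (tw_to_falg x + tw_to_falg y)) t - (left_mult (env (tw_to_falg x)) t + left_mult (env (tw_to_falg y)) t))
        + (left_mult (env (tw_to_falg x)) t - act_lin x t) + (left_mult (env (tw_to_falg y)) t - act_lin y t)"
      by (simp add: tw_to_falg_eq lin_ext_add)
    then show ?case using left_mult_env_add[OF t] add(3,4) by (metis pm.span_add)
  next
    case (smult z x)
    have "left_mult (env (tw_to_falg (psmult z x))) t - act_lin (psmult z x) t
      = (left_mult (env (psmult z (tw_to_falg x))) t - psmult z (left_mult (env (tw_to_falg x)) t))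
        + psmult z (left_mult (env (tw_to_falg x)) t - act_lin x t)"
      by (simp add: tw_to_falg_eq lin_ext_psmult pm.scale_right_diff_distrib)
    then show ?case using left_mult_psmult_left[OF t] smult(2) by (metis pm.span_add pm.span_scale)
  next
    case (basis a)
    then show ?case by (simp add: tw_to_falg_eq pm.span_zero)
  qed
qed

text \<open>The commutation rule for two basis elements, modulo the tensor relations.\<close>

lemma A_commute:
  assumes t: "t \<in> tensors"
  shows "A a (A b t) - (psmult (ssign (parity a) (parity b)) (A b (A a t)) + act_lin (gbracket a b) t) \<in> rel_span"
proof -
  let ?s = "ssign (parity a) (parity b)" and ?B = "tw_to_falg (gbracket a b)"
  have "env (word [a, b]) = env (psmult ?s (word [b, a]) + ?B)"
    using env_ideal.rel[of 1 a b 1] by (simp add: env_eq_iff env_rel_eq tw.rel_def tw_to_falg_eq diff_diff_add)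
  then have "A a (A b t) = left_mult (env (psmult ?s (word [b, a]) + ?B)) t"
    by (simp add: left_mult_mult word_mult flip: env_mult)
  then have "A a (A b t) - (psmult ?s (A b (A a t)) + act_lin (gbracket a b) t)
    = (left_mult (env (psmult ?s (word [b, a]) + ?B)) t - (left_mult (env (psmult ?s (word [b, a]))) t + left_mult (env ?B) t))
    + (left_mult (env (psmult ?s (word [b, a]))) t - psmult ?s (left_mult (env (word [b, a])) t))
    + (left_mult (env ?B) t - act_lin (gbracket a b) t)"
    by (simp add: left_mult_mult word_mult flip: env_mult)
  then show ?thesis
    using left_mult_env_add[OF t] left_mult_psmult_left[OF t] act_lin_env[OF t] by (metis pm.span_add)
qed

text \<open>
  The filtration by weight and, among words of the same weight, by length; \<open>Fw D\<close> restricts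
  the weight only.
\<close>

definition F :: "int \<Rightarrow> int \<Rightarrow> ((U \<times> 'v) \<Rightarrow>\<^sub>0 complex) set" where
  "F D n = pm.span (rel_span \<union> {wv w m | w m. set w \<subseteq> cgens \<and> m \<in> carrier M
     \<and> (weight w < D \<or> (weight w = D \<and> int (length w) \<le> n))})"

definition Fw :: "int \<Rightarrow> ((U \<times> 'v) \<Rightarrow>\<^sub>0 complex) set" where
  "Fw D = pm.span (rel_span \<union> {wv w m | w m. set w \<subseteq> cgens \<and> m \<in> carrier M \<and> weight w \<le> D})"

lemma F_subspace [simp]: "pm.subspace (F D n)" "pm.subspace (Fw D)"
  by (simp_all add: F_def Fw_def)

lemma F_rel: "t \<in> rel_span \<Longrightarrow> t \<in> F D n" "t \<in> rel_span \<Longrightarrow> t \<in> Fw D"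
  unfolding F_def Fw_def by (auto intro: pm.span_base)

lemma F_wv: "set w \<subseteq> cgens \<Longrightarrow> m \<in> carrier M \<Longrightarrow> weight w < D \<or> (weight w = D \<and> int (length w) \<le> n) \<Longrightarrow> wv w m \<in> F D n"
  unfolding F_def by (intro pm.span_base) blast

lemma Fw_wv: "set w \<subseteq> cgens \<Longrightarrow> m \<in> carrier M \<Longrightarrow> weight w \<le> D \<Longrightarrow> wv w m \<in> Fw D"
  unfolding Fw_def by (intro pm.span_base) blast

lemma F_mono: "D < D' \<or> (D = D' \<and> n \<le> n') \<Longrightarrow> t \<in> F D n \<Longrightarrow> t \<in> F D' n'"
  unfolding F_def by (erule rev_subsetD, rule pm.span_mono) force

lemma Fw_F: "D < D' \<Longrightarrow> t \<in> Fw D \<Longrightarrow> t \<in> F D' n"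
  unfolding F_def Fw_def by (erule rev_subsetD, rule pm.span_mono) force

lemma F_Fw: "D \<le> D' \<Longrightarrow> t \<in> F D n \<Longrightarrow> t \<in> Fw D'"
  unfolding F_def Fw_def by (erule rev_subsetD, rule pm.span_mono) force

lemma Fw_mono: "D \<le> D' \<Longrightarrow> t \<in> Fw D \<Longrightarrow> t \<in> Fw D'"
  unfolding Fw_def by (erule rev_subsetD, rule pm.span_mono) force

lemma F_image:
  assumes t: "t \<in> F D n" and T: "pm.subspace T"
    and h: "\<And>s t. h (s + t) = h s + h t" "\<And>z t. h (psmult z t) = psmult z (h t)"
    and rel: "\<And>t. t \<in> rel_span \<Longrightarrow> h t \<in> T"
    and wv: "\<And>w m. set w \<subseteq> cgens \<Longrightarrow> m \<in> carrier M \<Longrightarrow> weight w < D \<or> (weight w = D \<and> int (length w) \<le> n)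
       \<Longrightarrow> h (wv w m) \<in> T"
  shows "h t \<in> T"
  using t unfolding F_def
proof (induction rule: pm_span_induct)
  case zero
  then show ?case using h(2)[of 0 0] pm.subspace_0[OF T] by simp
next
  case (base t)
  then show ?case using rel wv by blast
qed (auto simp: h intro: pm.subspace_add[OF T] pm.subspace_scale[OF T])

lemma Fw_image:
  assumes t: "t \<in> Fw D" and T: "pm.subspace T"
    and h: "\<And>s t. h (s + t) = h s + h t" "\<And>z t. h (psmult z t) = psmult z (h t)"
    and rel: "\<And>t. t \<in> rel_span \<Longrightarrow> h t \<in> T"
    and wv: "\<And>w m. set w \<subseteq> cgens \<Longrightarrow> m \<in> carrier M \<Longrightarrow> weight w \<le> D \<Longrightarrow> h (wv w m) \<in> T"
  shows "h t \<in> T"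
  using t unfolding Fw_def
proof (induction rule: pm_span_induct)
  case zero
  then show ?case using h(2)[of 0 0] pm.subspace_0[OF T] by simp
next
  case (base t)
  then show ?case using rel wv by blast
qed (auto simp: h intro: pm.subspace_add[OF T] pm.subspace_scale[OF T])

lemma A_rel: "t \<in> rel_span \<Longrightarrow> A a t \<in> rel_span"
  by (rule left_mult_rel_span)

lemma subspace_mod:
  assumes "pm.subspace T" "rel_span \<subseteq> T" "s - t \<in> rel_span" "t \<in> T"
  shows "s \<in> T"
proof -
  have "(s - t) + t \<in> T" using assms by (intro pm.subspace_add) auto
  then show ?thesis by simp
qed

lemma F_mod: "s - t \<in> rel_span \<Longrightarrow> t \<in> F D n \<Longrightarrow> s \<in> F D n" "s - t \<in> rel_span \<Longrightarrow> t \<in> Fw D \<Longrightarrow> s \<in> Fw D"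
  using subspace_mod[OF F_subspace(1)] subspace_mod[OF F_subspace(2)] F_rel by blast+

lemma A_base:
  assumes "a \<in> bCgens" "m \<in> carrier M"
  shows "A a (wv [] m) - wv [] (ga a m) \<in> rel_span"
  using tensor_rels_I(5)[OF assms(2) word_bC[of "[a]"], of 1] assms
  by (simp add: word_Nil env_1)

lemma env_central: "env (word (Cg # w)) = env (word w) * env (word [Cg])"
proof (induction w)
  case (Cons a w)
  have "word [Cg, a] - word [a, Cg] \<in> env_ideal"
    using env_ideal.rel[of 1 Cg a 1] by (simp add: env_rel_eq tw.rel_def)
  then have "env (word [Cg, a]) = env (word [a, Cg])" by (simp only: env_eq_iff)
  have "env (word (Cg # a # w)) = env (word [Cg, a]) * env (word w)" by (simp add: word_mult flip: env_mult)
  also have "\<dots> = env (word [a]) * env (word (Cg # w))"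
    unfolding \<open>env (word [Cg, a]) = _\<close> by (simp add: word_mult flip: env_mult)
  also have "\<dots> = env (word (a # w)) * env (word [Cg])"
    unfolding Cons by (simp add: word_mult word_mult_left flip: env_mult mult.assoc)
  finally show ?case .
qed (simp add: word_Nil env_1)

lemma A_central:
  assumes "m \<in> carrier M"
  shows "A Cg (wv w m) - psmult c (wv w m) \<in> rel_span"
proof -
  have "falg_act c M (word [Cg]) m = c \<odot> m" using assms by (simp add: ga_Cg)
  then have "tens (env (word w) * env (word [Cg])) m - wv w (c \<odot> m) \<in> rel_span"
    using tensor_rels_I(5)[OF assms word_bC[of "[Cg]"], of "env (word w)"] by simp
  from pm.span_add[OF this tensor_rels_I(4)[OF assms, of "env (word w)" c]] show ?thesis
    unfolding A_wv env_central[of w] by simp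
qed

declare left_mult_tens [simp del]

lemma A_lower_F:
  assumes "deg a \<le> 0" "t \<in> F D n"
  shows "A a t \<in> F (D - deg a) (n + 1)"
proof (rule F_image[OF assms(2)])
  fix w m assume *: "set w \<subseteq> cgens" "m \<in> carrier M" "weight w < D \<or> (weight w = D \<and> int (length w) \<le> n)"
  show "A a (wv w m) \<in> F (D - deg a) (n + 1)"
  proof (cases "a = Cg")
    case True
    have "psmult c (wv w m) \<in> F (D - deg a) (n + 1)"
      using * True by (intro pm.subspace_scale[OF F_subspace(1)] F_wv) auto
    with A_central[OF *(2)] True show ?thesis by (metis F_mod(1))
  next
    case False
    with assms(1) deg_nonpos have "a \<in> cgens" by blast
    with * show ?thesis unfolding A_wv by (intro F_wv) auto
  qed
qed (auto simp: A_linear intro: F_rel A_rel)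

lemma A_lower_Fw:
  assumes "deg a \<le> 0" "t \<in> Fw D"
  shows "A a t \<in> Fw (D - deg a)"
proof (rule Fw_image[OF assms(2)])
  fix w m assume *: "set w \<subseteq> cgens" "m \<in> carrier M" "weight w \<le> D"
  have "A a (wv w m) \<in> F (weight w - deg a) (int (length w) + 1)"
    by (rule A_lower_F[OF assms(1)]) (use * in \<open>auto intro: F_wv\<close>)
  then show "A a (wv w m) \<in> Fw (D - deg a)"
    by (rule F_Fw[rotated]) (use * in simp)
qed (auto simp: A_linear intro: F_rel A_rel)

text \<open>Elements of positive degree do not raise the weight.\<close>

lemma A_positive:
  assumes "set w \<subseteq> cgens" "m \<in> carrier M" "0 < deg a"
  shows "A a (wv w m) \<in> Fw (weight w)"
  using assms
proof (induction w arbitrary: a)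
  case Nil
  then have a: "a \<in> bCgens" by (simp add: bgens_eq)
  have "wv [] (ga a m) \<in> Fw 0" using Nil a by (intro Fw_wv) auto
  with A_base[OF a Nil(2)] show ?case unfolding weight_simps by (rule F_mod(2))
next
  case (Cons y w)
  then have y: "deg y \<le> 0" "set w \<subseteq> cgens" by (auto simp: cgens_def)
  have IH: "A b (wv w m) \<in> Fw (weight w)" if "0 < deg b" for b
    using Cons.IH y(2) Cons.prems(2) that by blast
  have w: "wv w m \<in> Fw (weight w)" using y Cons.prems by (intro Fw_wv) auto
  have 1: "A y (A a (wv w m)) \<in> Fw (weight (y # w))"
    using A_lower_Fw[OF y(1) IH[OF Cons.prems(3)]] by simp
  have 2: "act_lin (gbracket a y) (wv w m) \<in> Fw (weight (y # w))"
  proof (rule lin_ext_in_subspace[OF F_subspace(2)])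
    fix g assume "g \<in> Poly_Mapping.keys (gbracket a y)"
    then have g: "deg g = deg a + deg y" using key_gbracket by blast
    show "A g (wv w m) \<in> Fw (weight (y # w))"
    proof (cases "0 < deg g")
      case True
      show ?thesis by (rule Fw_mono[OF _ IH[OF True]]) (use y in simp)
    next
      case False
      then have "deg g \<le> 0" by simp
      from A_lower_Fw[OF this w] show ?thesis by (rule Fw_mono[rotated]) (use g Cons.prems in simp)
    qed
  qed
  have "A a (A y (wv w m)) - (psmult (ssign (parity a) (parity y)) (A y (A a (wv w m))) + act_lin (gbracket a y) (wv w m)) \<in> rel_span"
    by (rule A_commute) (use Cons.prems in \<open>simp add: tens_tensors\<close>)
  moreover have "psmult (ssign (parity a) (parity y)) (A y (A a (wv w m))) + act_lin (gbracket a y) (wv w m) \<in> Fw (weight (y # w))"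
    using 1 2 by (intro pm.subspace_add[OF F_subspace(2)] pm.subspace_scale[OF F_subspace(2)])
  ultimately show ?case unfolding A_wv[symmetric, of y] by (rule F_mod(2))
qed

text \<open>
  For \<open>x\<close> of degree at least \<open>u\<close>, operators that annihilate the inducing module: basis elements of degree larger than \<open>u\<close>,
  odd ones of degree \<open>u\<close>, and \<open>T\<^sub>u\<close> shifted by its eigenvalue.
\<close>

definition K :: "gen \<Rightarrow> ((U \<times> 'v) \<Rightarrow>\<^sub>0 complex) \<Rightarrow> ((U \<times> 'v) \<Rightarrow>\<^sub>0 complex)" where
  "K x t = A x t - (if x = Tg k then psmult lam t else 0)"

lemma K_linear: "K x (s + t) = K x s + K x t" "K x (psmult z t) = psmult z (K x t)"
  by (auto simp: K_def A_linear pm.scale_right_distrib pm.scale_right_diff_distrib mult.commute)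

lemma K_rel: "t \<in> rel_span \<Longrightarrow> K x t \<in> rel_span"
  by (auto simp: K_def intro: pm.span_diff pm.span_scale A_rel)

lemma A_eq_K: "A x t = K x t + (if x = Tg k then psmult lam t else 0)"
  by (simp add: K_def)

lemma K_tensors: "t \<in> tensors \<Longrightarrow> K x t \<in> tensors"
  by (auto simp: K_def intro: pm.span_diff pm.span_scale left_mult_tensors)

text \<open>The commutator with a letter, apart from its component along \<open>T\<^sub>u\<close>, is of lower order.\<close>

lemma bracket_term:
  assumes w: "set w \<subseteq> cgens" "m \<in> carrier M" and y: "y \<in> cgens" and x: "2 * k + 1 \<le> deg x"
    and Kw: "\<And>x. 2 * k + 1 \<le> deg x \<Longrightarrow> K x (wv w m) \<in> F (weight w - (deg x - (2 * k + 1))) (int (length w) - 1)"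
    and g: "g \<in> Poly_Mapping.keys (gbracket x y)" "g \<noteq> Tg k"
  shows "A g (wv w m) \<in> F (weight w - (deg x - (2 * k + 1)) - deg y) (int (length w) - 1)"
proof -
  have dg: "deg g = deg x + deg y" using key_gbracket g(1) by blast
  have y0: "deg y \<le> 0" using y by (simp add: cgens_def)
  consider "2 * k + 1 \<le> deg g" | "0 < deg g" "deg g < 2 * k + 1" | "deg g \<le> 0" by linarith
  then show ?thesis
  proof cases
    case 1
    then show ?thesis using Kw[OF 1] g(2) dg by (simp add: A_eq_K algebra_simps)
  next
    case 2
    from A_positive[OF w 2(1)] show ?thesis by (rule Fw_F[rotated]) (use 2 dg in simp)
  next
    case 3
    have "wv w m \<in> Fw (weight w)" using w by (intro Fw_wv) auto
    from A_lower_Fw[OF 3 this] show ?thesis by (rule Fw_F[rotated]) (use k dg in simp)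
  qed
qed

text \<open>The operator \<open>K x\<close>, for \<open>x\<close> of degree \<open>u + d\<close>, \<open>d \<ge> 0\<close>, lowers the weight by \<open>d\<close> (by \<open>2d\<close> on the doubled scale) and the length by one.\<close>

lemma K_wv:
  assumes "set w \<subseteq> cgens" "m \<in> carrier M" "2 * k + 1 \<le> deg x"
  shows "K x (wv w m) \<in> F (weight w - (deg x - (2 * k + 1))) (int (length w) - 1)"
  using assms
proof (induction w arbitrary: x)
  case Nil
  then have x: "x \<in> bCgens" using k by (simp add: bgens_eq)
  have "K x (wv [] m) \<in> rel_span"
  proof (cases "x = Tg k")
    case True
    have "K x (wv [] m) = (A x (wv [] m) - wv [] (ga x m)) + (tens (env (word [])) (lam \<odot> m) - psmult lam (wv [] m))"
      using True scalar[OF Nil(2)] by (simp add: K_def)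
    then show ?thesis
      using A_base[OF x Nil(2)] tensor_rels_I(4)[OF Nil(2)] by (metis pm.span_add)
  next
    case False
    have "K x (wv [] m) = (A x (wv [] m) - wv [] (ga x m)) + (wv [] (0 \<odot> \<zero>) - psmult 0 (wv [] \<zero>))"
      using False kills[OF Nil(3) False Nil(2)] by (simp add: K_def)
    then show ?thesis
      using A_base[OF x Nil(2)] tensor_rels_I(4)[OF M.zero_closed] by (metis pm.span_add)
  qed
  then show ?case by (rule F_rel)
next
  case (Cons y w)
  then have y: "y \<in> cgens" "deg y \<le> 0" "set w \<subseteq> cgens" by (auto simp: cgens_def)
  let ?t = "wv w m" and ?T = "F (weight (y # w) - (deg x - (2 * k + 1))) (int (length (y # w)) - 1)"
  let ?s = "ssign (parity x) (parity y)"
  have Kw: "K b ?t \<in> F (weight w - (deg b - (2 * k + 1))) (int (length w) - 1)" if "2 * k + 1 \<le> deg b" for b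
    using Cons.IH y(3) Cons.prems(2) that by blast
  have 1: "A y (K x ?t) \<in> ?T"
    using A_lower_F[OF y(2) Kw[OF Cons.prems(3)]] by (simp add: algebra_simps)
  have 2: "act_lin (gbracket x y) ?t \<in> ?T"
  proof (rule lin_ext_in_subspace[OF F_subspace(1)])
    fix g assume g: "g \<in> Poly_Mapping.keys (gbracket x y)"
    show "A g ?t \<in> ?T"
    proof (cases "g = Tg k")
      case False
      from bracket_term[OF y(3) Cons.prems(2) y(1) Cons.prems(3) Kw g False]
      show ?thesis by (rule F_mono[rotated]) auto
    next
      case True
      then have dg: "deg x + deg y = 2 * k + 1" using key_gbracket[OF g] by simp
      have "psmult lam ?t \<in> ?T"
        using y Cons.prems(2) dg by (intro pm.subspace_scale[OF F_subspace(1)] F_wv) auto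
      moreover have "K g ?t \<in> ?T"
        by (rule F_mono[OF _ Kw]) (use True dg in auto)
      ultimately show ?thesis
        unfolding A_eq_K using True by (auto intro: pm.subspace_add[OF F_subspace(1)])
    qed
  qed
  have "A x (A y ?t) - (psmult ?s (A y (A x ?t)) + act_lin (gbracket x y) ?t) \<in> rel_span"
    by (rule A_commute) (use Cons.prems in \<open>simp add: tens_tensors\<close>)
  moreover have "K x (A y ?t) - (psmult ?s (A y (K x ?t)) + act_lin (gbracket x y) ?t)
     = A x (A y ?t) - (psmult ?s (A y (A x ?t)) + act_lin (gbracket x y) ?t)"
    by (auto simp: K_def A_linear ssign_def)
  ultimately have "K x (A y ?t) - (psmult ?s (A y (K x ?t)) + act_lin (gbracket x y) ?t) \<in> rel_span" by (simp only:)
  moreover have "psmult ?s (A y (K x ?t)) + act_lin (gbracket x y) ?t \<in> ?T"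
    using 1 2 by (intro pm.subspace_add[OF F_subspace(1)] pm.subspace_scale[OF F_subspace(1)])
  ultimately show ?case unfolding A_wv[symmetric, of y] by (rule F_mod(1))
qed

lemma K_F:
  assumes "2 * k + 1 \<le> deg x" "t \<in> F D n"
  shows "K x t \<in> F (D - (deg x - (2 * k + 1))) (n - 1)"
proof (rule F_image[OF assms(2)])
  fix w m assume *: "set w \<subseteq> cgens" "m \<in> carrier M" "weight w < D \<or> (weight w = D \<and> int (length w) \<le> n)"
  from K_wv[OF *(1,2) assms(1)] show "K x (wv w m) \<in> F (D - (deg x - (2 * k + 1))) (n - 1)"
    by (rule F_mono[rotated]) (use *(3) in auto)
qed (auto simp: K_linear intro: F_rel K_rel)

text \<open>The Euler operator counts letters, up to terms of lower order.\<close>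

definition euler_term :: "gen \<Rightarrow> ((U \<times> 'v) \<Rightarrow>\<^sub>0 complex) \<Rightarrow> ((U \<times> 'v) \<Rightarrow>\<^sub>0 complex)" where
  "euler_term y t = psmult (1 / (lam * pairing k y)) (A y (K (partner k y) t))"

definition euler :: "gen set \<Rightarrow> ((U \<times> 'v) \<Rightarrow>\<^sub>0 complex) \<Rightarrow> ((U \<times> 'v) \<Rightarrow>\<^sub>0 complex)" where
  "euler S t = (\<Sum>y\<in>S. euler_term y t)"

lemma euler_linear: "euler S (s + t) = euler S s + euler S t" "euler S (psmult z t) = psmult z (euler S t)"
  by (simp_all add: euler_def euler_term_def K_linear A_linear pm.scale_right_distrib sum.distrib
      pm.scale_sum_right mult.commute)

lemma euler_rel: "t \<in> rel_span \<Longrightarrow> euler S t \<in> rel_span"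
  unfolding euler_def euler_term_def by (intro pm.span_sum pm.span_scale A_rel K_rel)

text \<open>
  Moving one term of the Euler operator past a letter \<open>z\<close> reproduces \<open>z\<close> if it is the term of \<open>z\<close>, and
  costs nothing otherwise, up to lower order.
\<close>

lemma euler_term_Cons:
  assumes y: "y \<in> cgens" "z \<in> cgens" and w: "set w \<subseteq> cgens" "m \<in> carrier M"
  shows "euler_term y (A z (wv w m)) - A z (euler_term y (wv w m)) - (if y = z then A z (wv w m) else 0)
     \<in> F (weight (z # w)) (int (length w))"
proof -
  let ?T = "F (weight (z # w)) (int (length w))" and ?t = "wv w m" and ?x = "partner k y"
  let ?s = "ssign (parity y) (parity z)" and ?e = "1 / (lam * pairing k y)"
  note px = partner_simps[OF y(1), of k]
  have y0: "deg y \<le> 0" "deg z \<le> 0" using y by (auto simp: cgens_def)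
  have x: "2 * k + 1 \<le> deg ?x" using px(2) y0 by simp
  have t: "?t \<in> tensors" using w by (simp add: tens_tensors)
  have Kt: "K ?x ?t \<in> F (weight w + deg y) (int (length w) - 1)"
    using K_wv[OF w x] px(2) by simp
  define B R where "B = act_lin (gbracket ?x z) ?t" and "R = act_lin (gbracket y z) (K ?x ?t)"
  define r1 where "r1 = K ?x (A z ?t) - (psmult ?s (A z (K ?x ?t)) + B)"
  define r2 where "r2 = A y (A z (K ?x ?t)) - (psmult ?s (A z (A y (K ?x ?t))) + R)"
  have "A ?x (A z ?t) - (psmult ?s (A z (A ?x ?t)) + B) \<in> rel_span"
    using A_commute[OF t, of ?x z] px(1) by (simp add: B_def)
  moreover have "r1 = A ?x (A z ?t) - (psmult ?s (A z (A ?x ?t)) + B)"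
    using px(1) by (auto simp: r1_def K_def A_linear ssign_def)
  ultimately have r1: "r1 \<in> rel_span" by (simp only:)
  have r2: "r2 \<in> rel_span"
    using A_commute[OF K_tensors[OF t], of y z] by (simp add: r2_def R_def)
  have ss: "psmult ?s (psmult ?s v) = v" for v :: "(U \<times> 'v) \<Rightarrow>\<^sub>0 complex" by simp
  have eq: "A y (K ?x (A z ?t)) = A z (A y (K ?x ?t)) + psmult ?s R + A y B + (A y r1 + psmult ?s r2)"
    unfolding r1_def r2_def by (simp add: A_linear pm.scale_right_diff_distrib pm.scale_right_distrib ss del: ssign_simps pm.scale_scale)
  have R: "R \<in> ?T"
    unfolding R_def
  proof (rule lin_ext_in_subspace[OF F_subspace(1)])
    fix g assume "g \<in> Poly_Mapping.keys (gbracket y z)"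
    then have g: "deg g = deg y + deg z" using key_gbracket by blast
    then have "deg g \<le> 0" using y0 by simp
    from A_lower_F[OF this Kt] show "A g (K ?x ?t) \<in> ?T" using g by simp
  qed
  have low: "A g ?t \<in> F (weight w + deg y - deg z) (int (length w) - 1)"
    if "g \<in> Poly_Mapping.keys (gbracket ?x z)" "g \<noteq> Tg k" for g
    using bracket_term[OF w y(2) x K_wv[OF w] that] px(2) by simp
  have AB: "psmult ?e (A y B) - (if y = z then A z ?t else 0) \<in> ?T"
  proof (cases "y = z")
    case True
    have "B = psmult (pairing k y) (A (Tg k) ?t)"
      unfolding B_def using px(3) True by (simp add: lin_ext_psmult)
    then have "psmult ?e (A y B) - A z ?t = psmult (1 / lam) (A z (K (Tg k) ?t))"
      using px(4) lam True by (simp add: A_eq_K A_linear pm.scale_right_distrib)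
    moreover have "A z (K (Tg k) ?t) \<in> ?T"
      using A_lower_F[OF y0(2) K_wv[OF w, of "Tg k"]] by simp
    ultimately show ?thesis using True by (simp add: pm.subspace_scale)
  next
    case False
    have "B \<in> F (weight w + deg y - deg z) (int (length w) - 1)"
      unfolding B_def
      by (rule lin_ext_in_subspace[OF F_subspace(1)], rule low)
        (use partner_bracket_other[OF y] False in auto)
    from A_lower_F[OF y0(1) this] show ?thesis using False by (simp add: pm.subspace_scale)
  qed
  have parts: "psmult ?s R \<in> ?T" "A y r1 + psmult ?s r2 \<in> ?T"
    using R r1 r2 by (auto intro: pm.subspace_scale pm.subspace_add F_rel A_rel)
  have sum: "euler_term y (A z ?t) - A z (euler_term y ?t) - (if y = z then A z ?t else 0)
     = psmult ?e (psmult ?s R) + psmult ?e (A y r1 + psmult ?s r2) + (psmult ?e (A y B) - (if y = z then A z ?t else 0))"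
    unfolding euler_term_def eq by (simp add: A_linear pm.scale_right_distrib)
  show ?thesis
    unfolding sum
    by (rule pm.subspace_add[OF F_subspace(1) pm.subspace_add[OF F_subspace(1)
          pm.subspace_scale[OF F_subspace(1) parts(1)] pm.subspace_scale[OF F_subspace(1) parts(2)]] AB])
qed

lemma euler_wv:
  assumes S: "finite S" "S \<subseteq> cgens" and w: "set w \<subseteq> S" and m: "m \<in> carrier M"
  shows "euler S (wv w m) - psmult (of_nat (length w)) (wv w m) \<in> F (weight w) (int (length w) - 1)"
  using w
proof (induction w)
  case Nil
  have "K (partner k y) (wv [] m) \<in> rel_span" if "y \<in> S" for y
  proof -
    have y: "y \<in> cgens" "deg y \<le> 0" using that S by (auto simp: cgens_def)
    have "K (partner k y) (wv [] m) \<in> F (deg y) (- 1)"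
      using K_wv[of "[]" m "partner k y"] m partner_simps(2)[OF y(1), of k] y(2) by simp
    then show ?thesis unfolding F_def
      by (rule rev_subsetD, intro pm.span_minimal) (use y(2) weight_nonneg in force)+
  qed
  then have "euler S (wv [] m) \<in> rel_span"
    unfolding euler_def euler_term_def by (intro pm.span_sum pm.span_scale A_rel)
  then show ?case by (simp add: F_rel)
next
  case (Cons z w)
  then have z: "z \<in> S" "z \<in> cgens" "deg z \<le> 0" "set w \<subseteq> S" "set w \<subseteq> cgens" using S by (auto simp: cgens_def)
  let ?t = "wv w m" and ?T = "F (weight (z # w)) (int (length w))"
  have "(\<Sum>y\<in>S. euler_term y (A z ?t) - A z (euler_term y ?t) - (if y = z then A z ?t else 0)) \<in> ?T"
    using S z m by (intro pm.subspace_sum[OF F_subspace(1)] euler_term_Cons) auto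
  moreover have "(\<Sum>y\<in>S. euler_term y (A z ?t) - A z (euler_term y ?t) - (if y = z then A z ?t else 0))
     = euler S (A z ?t) - A z (euler S ?t) - A z ?t"
    using S(1) z(1) by (simp add: euler_def sum_subtractf A_sum)
  ultimately have 1: "euler S (A z ?t) - A z (euler S ?t) - A z ?t \<in> ?T" by (simp only:)
  have 2: "A z (euler S ?t - psmult (of_nat (length w)) ?t) \<in> ?T"
    using A_lower_F[OF z(3) Cons.IH[OF z(4)]] by simp
  note pm.subspace_add[OF F_subspace(1) 1 2]
  moreover have "(euler S (A z ?t) - A z (euler S ?t) - A z ?t) + A z (euler S ?t - psmult (of_nat (length w)) ?t)
     = euler S (wv (z # w) m) - psmult (of_nat (length (z # w))) (wv (z # w) m)"
    unfolding A_wv[symmetric, of z] by (simp add: A_linear pm.scale_left_distrib)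
  ultimately show ?case by (simp only: length_Cons of_nat_Suc add_diff_cancel_left')
qed

end


context whittaker_module
begin

lemma F_negative: "D < 0 \<Longrightarrow> t \<in> F D n \<Longrightarrow> t \<in> rel_span" "D < 0 \<Longrightarrow> t \<in> Fw D \<Longrightarrow> t \<in> rel_span"
  using F_image[of t D n rel_span "\<lambda>t. t"] Fw_image[of t D rel_span "\<lambda>t. t"] weight_nonneg
  by fastforce+

lemma Fw_bounded:
  assumes "t \<in> Fw D"
  shows "\<exists>n::nat. t \<in> F D (int n)"
  using assms unfolding Fw_def
proof (induction rule: pm_span_induct)
  case zero
  then show ?case using F_rel(1)[of 0] by (blast intro: pm.span_zero)
next
  case (add s t)
  then obtain n1 n2 where "s \<in> F D (int n1)" "t \<in> F D (int n2)" by blast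
  then have "s \<in> F D (int (n1 + n2))" "t \<in> F D (int (n1 + n2))" by (auto elim!: F_mono[rotated])
  then show ?case by (blast intro: pm.subspace_add[OF F_subspace(1)])
next
  case (smult z t)
  then show ?case by (blast intro: pm.subspace_scale[OF F_subspace(1)])
next
  case (base t)
  then consider "t \<in> rel_span" | w m where "t = wv w m" "set w \<subseteq> cgens" "m \<in> carrier M" "weight w \<le> D" by blast
  then show ?case
  proof cases
    case 1
    then show ?thesis by (blast intro: F_rel)
  next
    case (2 w m)
    then have "t \<in> F D (int (length w))" by (auto intro!: F_wv)
    then show ?thesis by blast
  qed
qed

text \<open>
  A submodule that meets the image of \<open>M\<close> trivially is trivial: a nonzero element of it of lowest order
  is killed by all the operators \<open>K\<close>, hence by the Euler operator, and so has even lower order.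
\<close>

lemma trivial_intersection:
  assumes W: "pm.subspace W" "rel_span \<subseteq> W" "\<And>a t. t \<in> W \<Longrightarrow> A a t \<in> W"
    and base: "\<And>t. t \<in> W \<Longrightarrow> t \<in> F 0 0 \<Longrightarrow> t \<in> rel_span"
  shows "t \<in> W \<Longrightarrow> t \<in> F (int D) (int n) \<Longrightarrow> t \<in> rel_span"
proof (induction "(D, n)" arbitrary: D n t rule: wf_induct_rule[OF wf_lex_prod[OF wf_less_than wf_less_than]])
  case (1 D n t)
  have IH: "s \<in> rel_span" if "s \<in> W" "s \<in> F (int D') (int n')" "D' < D \<or> (D' = D \<and> n' < n)" for s D' n'
    using 1(1)[of D' n' s] that by auto
  have low_w: "s \<in> rel_span" if "s \<in> W" "s \<in> Fw D'" "D' < int D" for s D'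
  proof (cases "D' < 0")
    case True
    with that show ?thesis by (blast intro: F_negative)
  next
    case False
    from Fw_bounded[OF that(2)] obtain n' where "s \<in> F D' (int n')" by blast
    moreover have "nat D' < D" using False that(3) by linarith
    ultimately show ?thesis using IH[OF that(1), of "nat D'" n'] False by simp
  qed
  have low: "s \<in> rel_span" if "s \<in> W" "s \<in> F D' n'" "D' < int D \<or> (D' = int D \<and> n' < int n)" for s D' n'
  proof (cases "D' < int D")
    case True
    then show ?thesis using low_w[OF that(1) F_Fw[OF order_refl that(2)]] by simp
  next
    case False
    then have D': "D' = int D" "n' < int n" using that(3) by auto
    show ?thesis
    proof (cases "n' < 0")
      case True
      have "s \<in> Fw (int D - 1)"
      proof (rule F_image[OF that(2) F_subspace(2), of "\<lambda>t. t"])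
        fix w m assume "set w \<subseteq> cgens" "m \<in> carrier M" "weight w < D' \<or> (weight w = D' \<and> int (length w) \<le> n')"
        then show "wv w m \<in> Fw (int D - 1)" using True D' by (intro Fw_wv) auto
      qed (auto intro: F_rel)
      then show ?thesis using low_w[OF that(1)] by simp
    next
      case False
      then show ?thesis using IH[OF that(1), of D "nat n'"] that(2) D' nat_less_iff[of n' n] by auto
    qed
  qed
  show ?case
  proof (cases "n = 0")
    case True
    show ?thesis
    proof (cases "D = 0")
      case True
      with \<open>n = 0\<close> 1(2,3) base show ?thesis by simp
    next
      case False
      have "t \<in> F (int D) (- 1)"
      proof (rule F_image[OF 1(3) F_subspace(1), of "\<lambda>t. t"])
        fix w m assume *: "set w \<subseteq> cgens" "m \<in> carrier M"
          "weight w < int D \<or> (weight w = int D \<and> int (length w) \<le> int n)"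
        then have "weight w < int D" using True False by auto
        with * show "wv w m \<in> F (int D) (- 1)" by (intro F_wv) auto
      qed (auto intro: F_rel)
      then show ?thesis by (rule low[OF 1(2)]) (use True in simp)
    qed
  next
    case False
    define S where "S = {g \<in> cgens. - int D \<le> deg g}"
    have S: "finite S" "S \<subseteq> cgens" using finite_cgens by (auto simp: S_def)
    have "K x t \<in> W" for x
      unfolding K_def using W 1(2)
      by (auto intro!: pm.subspace_diff[OF W(1)] pm.subspace_scale[OF W(1)] pm.subspace_0[OF W(1)])
    have Kt: "K (partner k y) t \<in> rel_span" if "y \<in> S" for y
    proof -
      have y: "y \<in> cgens" "deg y \<le> 0" using that by (auto simp: S_def cgens_def)
      have "2 * k + 1 \<le> deg (partner k y)" using partner_simps(2)[OF y(1), of k] y(2) by simp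
      from low[OF \<open>K (partner k y) t \<in> W\<close> K_F[OF this 1(3)]] show ?thesis
        using partner_simps(2)[OF y(1), of k] y(2) by linarith
    qed
    have E: "euler S t \<in> rel_span"
      unfolding euler_def euler_term_def by (intro pm.span_sum pm.span_scale A_rel Kt)
    have "euler S t - psmult (of_nat n) t \<in> F (int D) (int n - 1)"
    proof (rule F_image[OF 1(3) F_subspace(1), of "\<lambda>t. euler S t - psmult (of_nat n) t"])
      fix w m assume *: "set w \<subseteq> cgens" "m \<in> carrier M"
        "weight w < int D \<or> (weight w = int D \<and> int (length w) \<le> int n)"
      have "set w \<subseteq> S" using * weight_letter[OF *(1)] by (fastforce simp: S_def)
      from euler_wv[OF S this *(2)]
      have e: "euler S (wv w m) - psmult (of_nat (length w)) (wv w m) \<in> F (int D) (int n - 1)"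
        by (rule F_mono[rotated]) (use *(3) in auto)
      have "psmult (of_nat (length w) - of_nat n) (wv w m) \<in> F (int D) (int n - 1)"
      proof (cases "weight w = int D \<and> length w = n")
        case True
        then show ?thesis by (simp add: pm.subspace_0)
      next
        case False
        then show ?thesis using * by (intro pm.subspace_scale[OF F_subspace(1)] F_wv) auto
      qed
      from pm.subspace_add[OF F_subspace(1) e this]
      show "euler S (wv w m) - psmult (of_nat n) (wv w m) \<in> F (int D) (int n - 1)"
        by (simp add: pm.scale_left_diff_distrib)
    qed (auto simp: euler_linear pm.scale_right_distrib pm.scale_right_diff_distrib mult.commute
        intro!: F_rel pm.span_diff pm.span_scale euler_rel)
    from pm.subspace_diff[OF F_subspace(1) F_rel(1)[OF E] this]
    have "psmult (of_nat n) t \<in> F (int D) (int n - 1)" by simp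
    from pm.subspace_scale[OF F_subspace(1) this, of "1 / of_nat n"] False
    have "t \<in> F (int D) (int n - 1)" by simp
    then show ?thesis by (rule low[OF 1(2)]) simp
  qed
qed

lemma tens_in_subspace:
  assumes T: "pm.subspace T" "rel_span \<subseteq> T" and m: "m \<in> carrier M" and w: "\<And>w. wv w m \<in> T"
  shows "tens u m \<in> T"
proof -
  obtain p where u: "u = env p" by (rule env_cases)
  have "Poly_Mapping.keys p \<subseteq> UNIV" by simp
  then have "tens (env p) m \<in> T"
  proof (induction p rule: basis_induct)
    case zero
    then show ?case
      using subspace_mod[OF T tensor_rels_I(3)[OF m, of 0 0]] pm.subspace_0[OF T(1)] by simp
  next
    case (add p q)
    have "tens (env (p + q)) m - (tens (env p) m + tens (env q) m) \<in> rel_span"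
      using tensor_rels_I(1)[OF m, of "env p" "env q"] by (simp add: env_add diff_diff_add)
    from subspace_mod[OF T this pm.subspace_add[OF T(1) add(3,4)]] show ?case .
  next
    case (smult z p)
    from subspace_mod[OF T tensor_rels_I(3)[OF m] pm.subspace_scale[OF T(1) smult(2)]] show ?case .
  qed (rule w)
  then show ?thesis by (simp only: u)
qed

text \<open>The filtration exhausts the induced module.\<close>

lemma tensors_filtered:
  assumes "t \<in> tensors"
  shows "\<exists>D n::nat. t \<in> F (int D) (int n)"
proof -
  define T where "T = {t. \<exists>D::nat. t \<in> Fw (int D)}"
  have TI: "t \<in> Fw D \<Longrightarrow> t \<in> T" for t D
  proof -
    assume "t \<in> Fw D"
    then have "t \<in> Fw (int (nat D))" by (rule Fw_mono[rotated]) simp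
    then show "t \<in> T" unfolding T_def by blast
  qed
  have T: "pm.subspace T"
    unfolding pm.subspace_def
  proof (intro conjI ballI allI)
    show "0 \<in> T" using TI[of 0 0] by (simp add: pm.subspace_0)
    fix s t assume "s \<in> T" "t \<in> T"
    then obtain D1 D2 :: nat where "s \<in> Fw (int D1)" "t \<in> Fw (int D2)" by (auto simp: T_def)
    then have "s \<in> Fw (int (D1 + D2))" "t \<in> Fw (int (D1 + D2))" by (auto elim!: Fw_mono[rotated])
    then show "s + t \<in> T" by (intro TI pm.subspace_add[OF F_subspace(2)])
  next
    fix t z assume "t \<in> T"
    then show "psmult z t \<in> T" by (auto simp: T_def intro: pm.subspace_scale[OF F_subspace(2)])
  qed
  have rel: "rel_span \<subseteq> T" using TI F_rel(2) by blast
  have A_T: "A a t \<in> T" if t: "t \<in> T" for a t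
  proof -
    from t obtain D where D: "t \<in> Fw (int D)" by (auto simp: T_def)
    show ?thesis
    proof (cases "deg a \<le> 0")
      case True
      from TI[OF A_lower_Fw[OF this D]] show ?thesis .
    next
      case False
      have "A a (wv w m) \<in> T" if "set w \<subseteq> cgens" "m \<in> carrier M" for w m
        using TI[OF A_positive[OF that, of a]] False by simp
      then show ?thesis using rel A_rel
        by (intro Fw_image[OF D T, of "A a"]) (auto simp: A_linear)
    qed
  qed
  have wv_T: "wv w m \<in> T" if m: "m \<in> carrier M" for w m
  proof (induction w)
    case Nil
    show ?case by (rule TI[of _ 0]) (use m in \<open>auto intro: Fw_wv\<close>)
  next
    case (Cons a w)
    then show ?case using A_T A_wv by metis
  qed
  have "tensors \<subseteq> T"
    by (rule pm.span_minimal[OF _ T]) (auto intro!: tens_in_subspace[OF T rel] wv_T)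
  then obtain D :: nat where "t \<in> Fw (int D)" using assms by (auto simp: T_def)
  then show ?thesis using Fw_bounded by blast
qed

lemma base_space:
  assumes "t \<in> F 0 0"
  shows "\<exists>m\<in>carrier M. t - tens 1 m \<in> rel_span"
  using assms unfolding F_def
proof (induction rule: pm_span_induct)
  case zero
  have "tens 1 (0 \<odot> \<zero>) - psmult 0 (tens 1 \<zero>) \<in> rel_span" by (rule tensor_rels_I) simp
  then have "0 - tens 1 \<zero> \<in> rel_span" using pm.span_neg[of "tens 1 \<zero>"] by simp
  then show ?case by blast
next
  case (add s t)
  then obtain m m' where m: "m \<in> carrier M" "m' \<in> carrier M" "s - tens 1 m \<in> rel_span" "t - tens 1 m' \<in> rel_span"
    by blast
  have "(s + t) - tens 1 (m \<oplus> m') = (s - tens 1 m) + (t - tens 1 m') - (tens 1 (m \<oplus> m') - tens 1 m - tens 1 m')"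
    by simp
  also have "\<dots> \<in> rel_span"
    by (rule pm.span_diff[OF pm.span_add[OF m(3,4)] tensor_rels_I(2)[OF m(1,2)]])
  finally show ?case using m by blast
next
  case (smult z t)
  then obtain m where m: "m \<in> carrier M" "t - tens 1 m \<in> rel_span" by blast
  have "psmult z t - tens 1 (z \<odot> m) = psmult z (t - tens 1 m) - (tens 1 (z \<odot> m) - psmult z (tens 1 m))"
    by (simp add: pm.scale_right_diff_distrib)
  also have "\<dots> \<in> rel_span"
    by (rule pm.span_diff[OF pm.span_scale[OF m(2)] tensor_rels_I(4)[OF m(1)]])
  finally show ?case using m by blast
next
  case (base t)
  then consider "t \<in> rel_span" | w m where "t = wv w m" "set w \<subseteq> cgens" "m \<in> carrier M"
    "weight w < 0 \<or> (weight w = 0 \<and> int (length w) \<le> 0)" by blast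
  then show ?case
  proof cases
    case 1
    have "tens 1 (0 \<odot> \<zero>) - psmult 0 (tens 1 \<zero>) \<in> rel_span" by (rule tensor_rels_I) simp
    with 1 have "t - tens 1 \<zero> \<in> rel_span" by (intro pm.span_diff) simp_all
    then show ?thesis by blast
  next
    case (2 w m)
    then have "w = []" using weight_nonneg[of w] by auto
    with 2 show ?thesis by (intro bexI[of _ m]) (simp_all add: word_Nil env_1 pm.span_zero)
  qed
qed

theorem Ind_simple: "simple_supermodule UNIV (Ind c M)"
proof -
  interpret I: supermodule UNIV "Ind c M" by (rule Ind_supermodule)
  have T: "Tg k \<in> bgens" using k by (simp add: bgens_eq)
  obtain v where v: "v \<in> carrier M" "v \<noteq> \<zero>"
    using simple M.zero_closed unfolding simple_supermodule_def by blast
  have nz: "cls (tens 1 m) \<noteq> cls 0" if "m \<in> carrier M" "m \<noteq> \<zero>" for m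
    using tens_one_eq_zero[OF that(1)] that(2) by (auto simp: cls_eq_iff)
  have cl: "cls (tens 1 m) \<in> carrier (Ind c M)" if "m \<in> carrier M" for m
    using that by (auto simp: Ind_carrier tens_tensors)
  have ne: "carrier (Ind c M) \<noteq> {\<zero>\<^bsub>Ind c M\<^esub>}"
    using cl[OF v(1)] nz[OF v] by (auto simp: Ind_zero)
  have act_one: "act (Ind c M) x (cls (tens 1 m)) = cls (tens 1 (act M x m))"
    if "x \<in> b_alg" "m \<in> carrier M" for x m
  proof -
    have "tens (1 * env (tw_to_falg x)) m - tens 1 (falg_act c M (tw_to_falg x) m) \<in> rel_span"
      using that by (intro tensor_rels_I tw_to_falg_bC)
    then show ?thesis using that by (simp add: Ind_act cls_eq_iff act_expand left_mult_tens)
  qed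
  have nontrivial: "\<exists>x\<in>UNIV. \<exists>v\<in>carrier (Ind c M). act (Ind c M) x v \<noteq> \<zero>\<^bsub>Ind c M\<^esub>"
  proof -
    have "lam \<odot> v \<noteq> \<zero>" using smult_eq_zero v lam by blast
    moreover have "act M (basis (Tg k)) v = lam \<odot> v"
      using scalar[OF v(1)] ga_basis[OF T] by simp
    ultimately have "act (Ind c M) (basis (Tg k)) (cls (tens 1 v)) \<noteq> \<zero>\<^bsub>Ind c M\<^esub>"
      using act_one[OF basis_b_alg[OF T] v(1)] nz[of "lam \<odot> v"] v by (simp add: Ind_zero)
    then show ?thesis using cl[OF v(1)] by blast
  qed
  have "W = {\<zero>\<^bsub>Ind c M\<^esub>} \<or> W = carrier (Ind c M)" if W: "subsupermodule UNIV (Ind c M) W" for W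
  proof -
    from W have sub: "submodule W complex_field (Ind c M)"
      and actW: "\<And>x w. w \<in> W \<Longrightarrow> act (Ind c M) x w \<in> W"
      and grW: "W = (W \<inter> part (Ind c M) 0) <+>\<^bsub>Ind c M\<^esub> (W \<inter> part (Ind c M) 1)"
      unfolding subsupermodule_def by blast+
    note W_D = I.submodule_D[OF sub]
    define W' where "W' = {t \<in> tensors. cls t \<in> W}"
    have W'_sub: "pm.subspace W'"
      unfolding pm.subspace_def
    proof (intro conjI ballI allI)
      show "0 \<in> W'" using W_D(2) by (simp add: W'_def Ind_zero pm.span_zero)
      show "s + t \<in> W'" if "s \<in> W'" "t \<in> W'" for s t
        using that W_D(3)[of "cls s" "cls t"] by (auto simp: W'_def Ind_add intro: pm.span_add)
      show "psmult z t \<in> W'" if "t \<in> W'" for z t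
        using that W_D(4)[of "cls t" z] by (auto simp: W'_def Ind_smult intro: pm.span_scale)
    qed
    have W'_rel: "rel_span \<subseteq> W'"
    proof
      fix t assume t: "t \<in> rel_span"
      then have "cls t = cls 0" by (simp add: cls_eq_iff)
      then show "t \<in> W'" using t rel_span_tensors W_D(2) by (auto simp: W'_def Ind_zero)
    qed
    have W'_A: "A a t \<in> W'" if "t \<in> W'" for a t
      using that actW[of "cls t" "basis a"]
      by (auto simp: W'_def Ind_act tw_to_falg_eq left_mult_tensors)
    show ?thesis
    proof (cases "\<forall>t. t \<in> W' \<longrightarrow> t \<in> F 0 0 \<longrightarrow> t \<in> rel_span")
      case True
      have "w = \<zero>\<^bsub>Ind c M\<^esub>" if "w \<in> W" for w
      proof -
        from that W_D(1) obtain t where t: "w = cls t" "t \<in> tensors" by (auto simp: Ind_carrier)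
        from tensors_filtered[OF t(2)] obtain D n :: nat where "t \<in> F (int D) (int n)" by blast
        moreover have "t \<in> W'" using t that by (simp add: W'_def)
        ultimately have "t \<in> rel_span"
          using trivial_intersection[OF W'_sub W'_rel W'_A] True by blast
        then show ?thesis by (simp add: t(1) Ind_zero cls_eq_iff)
      qed
      then show ?thesis using W_D(2) by blast
    next
      case False
      then obtain t where t: "t \<in> W'" "t \<in> F 0 0" "t \<notin> rel_span" by blast
      obtain m where m: "m \<in> carrier M" "t - tens 1 m \<in> rel_span" using base_space[OF t(2)] by blast
      have tm: "tens 1 m \<in> W'"
        using pm.subspace_diff[OF W'_sub t(1), of "t - tens 1 m"] W'_rel m(2) by auto
      have "m \<noteq> \<zero>"
      proof
        assume "m = \<zero>"
        then have "tens 1 m \<in> rel_span"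
          using tensor_rels_I(4)[OF M.zero_closed, of 1 0] by simp
        from pm.span_add[OF m(2) this] t(3) show False by simp
      qed
      define MW where "MW = {m \<in> carrier M. tens 1 m \<in> W'}"
      have MW_iff: "m \<in> MW \<longleftrightarrow> m \<in> carrier M \<and> cls (tens 1 m) \<in> W" for m
        by (auto simp: MW_def W'_def tens_tensors)
      have cls_add: "cls (tens 1 (m \<oplus> m')) = cls (tens 1 m) \<oplus>\<^bsub>Ind c M\<^esub> cls (tens 1 m')"
        if "m \<in> carrier M" "m' \<in> carrier M" for m m'
        using tensor_rels_I(2)[OF that, of 1] by (simp add: Ind_add cls_eq_iff diff_diff_add)
      have "subsupermodule b_alg M MW"
      proof (rule subsupermodule_I)
        show "submodule MW complex_field M"
        proof (rule submodule_I)
          have "cls (tens 1 (0 \<odot> \<zero>)) = cls (psmult 0 (tens 1 \<zero>))"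
            unfolding cls_eq_iff by (rule tensor_rels_I) simp
          then show "\<zero> \<in> MW" using W_D(2) by (simp add: MW_iff Ind_zero)
          show "x \<oplus> y \<in> MW" if "x \<in> MW" "y \<in> MW" for x y
            using that W_D(3) by (auto simp: MW_iff cls_add)
          show "z \<odot> x \<in> MW" if "x \<in> MW" for z x
          proof -
            have x: "x \<in> carrier M" "cls (tens 1 x) \<in> W" using that by (auto simp: MW_iff)
            have "cls (tens 1 (z \<odot> x)) = z \<odot>\<^bsub>Ind c M\<^esub> cls (tens 1 x)"
              unfolding Ind_smult cls_eq_iff by (rule tensor_rels_I(4)[OF x(1)])
            with x W_D(4) show ?thesis by (simp add: MW_iff)
          qed
        qed (auto simp: MW_iff)
        show "act M x w \<in> MW" if "x \<in> b_alg" "w \<in> MW" for x w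
          using that actW[of "cls (tens 1 w)" x] act_one[of x w] by (auto simp: MW_iff act_closed)
        fix w assume w: "w \<in> MW"
        then have wc: "w \<in> carrier M" "cls (tens 1 w) \<in> W" by (auto simp: MW_iff)
        obtain w0 w1 where wd: "w0 \<in> part M 0" "w1 \<in> part M 1" "w = w0 \<oplus> w1"
          using part_decomp[OF wc(1)] by blast
        have "1 \<in> U_part 0"
          unfolding U_part_def env_1[symmetric] by (intro imageI) (simp flip: word_Nil)
        then have "tens 1 x \<in> tensor_part i" if "x \<in> part M i" for x i
          unfolding tensor_part_def using that by (intro pm.span_base) force
        then have p: "cls (tens 1 x) \<in> part (Ind c M) i" if "x \<in> part M i" for x i
          using that by (simp add: Ind_part)
        have "cls (tens 1 w) \<in> (W \<inter> part (Ind c M) 0) <+>\<^bsub>Ind c M\<^esub> (W \<inter> part (Ind c M) 1)"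
          using wc(2) grW by (rule back_subst[of "\<lambda>W. _ \<in> W"])
        then obtain a0 a1 where a: "a0 \<in> W" "a0 \<in> part (Ind c M) 0" "a1 \<in> W" "a1 \<in> part (Ind c M) 1"
          "cls (tens 1 w) = a0 \<oplus>\<^bsub>Ind c M\<^esub> a1"
          unfolding set_add_def' by blast
        have "cls (tens 1 w0) \<oplus>\<^bsub>Ind c M\<^esub> cls (tens 1 w1) = a0 \<oplus>\<^bsub>Ind c M\<^esub> a1"
          using a(5) wd cls_add[of w0 w1] by simp
        then have "cls (tens 1 w0) = a0" "cls (tens 1 w1) = a1"
          using I.part_unique[OF p[OF wd(1)] p[OF wd(2)] a(2) a(4)] by blast+
        with a wd have "w0 \<in> MW \<inter> part M 0" "w1 \<in> MW \<inter> part M 1" by (auto simp: MW_iff)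
        with wd(3) show "\<exists>v0\<in>MW \<inter> part M 0. \<exists>v1\<in>MW \<inter> part M 1. w = v0 \<oplus> v1" by blast
      qed
      moreover have "MW \<noteq> {\<zero>}" using tm m(1) \<open>m \<noteq> \<zero>\<close> by (auto simp: MW_def)
      ultimately have MW: "MW = carrier M" using simple unfolding simple_supermodule_def by blast
      have wv_W': "wv w x \<in> W'" if "x \<in> carrier M" for w x
      proof (induction w)
        case Nil
        have "x \<in> MW" using that MW by simp
        then show ?case by (simp add: MW_def word_Nil env_1)
      next
        case (Cons a w)
        then show ?case using W'_A A_wv by metis
      qed
      have "tensors \<subseteq> W'"
        by (rule pm.span_minimal[OF _ W'_sub]) (auto intro!: tens_in_subspace[OF W'_sub W'_rel] wv_W')
      then have "carrier (Ind c M) \<subseteq> W" by (auto simp: Ind_carrier W'_def)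
      then show ?thesis using W_D(1) by blast
    qed
  qed
  then show ?thesis
    unfolding simple_supermodule_def using Ind_supermodule ne nontrivial by blast
qed

end

section \<open>Consequences of the hypotheses\<close>

context b_module
begin

text \<open>If \<open>a\<close> vanishes on \<open>M\<close>, then so does every basis element that is a multiple of a bracket of \<open>a\<close> in \<open>\<bb>\<close>.\<close>

lemma kills_bracket:
  assumes "a \<in> bgens" "b \<in> bgens" "g \<in> bgens" "\<And>v. v \<in> carrier M \<Longrightarrow> ga a v = \<zero>"
    and "gbracket a b = psmult z (basis g)" "z \<noteq> 0" and v: "v \<in> carrier M"
  shows "ga g v = \<zero>"
proof -
  have z: "ga b \<zero> = \<zero>" using ga_smult[of b \<zero> 0] assms(2) by simp
  have "falg_act c M (tw_to_falg (gbracket a b)) v = z \<odot> ga g v"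
    using assms(3,5) v by (simp add: tw_to_falg_eq lin_ext_psmult falg_act_psmult word_bC)
  moreover have "falg_act c M (tw_to_falg (gbracket a b)) v = \<zero>"
    using assms(1,2,4) v z falg_act_gbracket[of a b v] by (simp add: diff_zero_iff)
  ultimately show ?thesis using smult_eq_zero[of z "ga g v"] assms(3,6) v by simp
qed

text \<open>If \<open>G\<^sub>u\<close> vanishes on \<open>M\<close>, then so do all basis elements of degree larger than \<open>u = k + 1/2\<close>.\<close>

lemma kills_high:
  assumes k: "k \<ge> 1" and G: "\<And>v. v \<in> carrier M \<Longrightarrow> ga (Gg (2 * k + 1)) v = \<zero>"
    and x: "2 * k + 1 \<le> deg x" "x \<noteq> Tg k" and v: "v \<in> carrier M"
  shows "ga x v = \<zero>"
proof -
  have step: "ga (Gg (2 * m + q)) v = \<zero>"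
    if "\<And>v. v \<in> carrier M \<Longrightarrow> ga (Gg q) v = \<zero>" "0 < q" "0 < m" "m \<noteq> q" "v \<in> carrier M" for m q v
  proof (rule kills_bracket[of "Gg q" "Lg m" "Gg (2 * m + q)" "- (of_int m / 2 - hf q)"])
    have "of_int m \<noteq> (of_int q :: complex)" using that(4) by simp
    then show "- (of_int m / 2 - hf q) \<noteq> 0" by (simp add: hf_def)
  qed (use that in \<open>auto simp: bgens_eq\<close>)
  have Godd: "ga (Gg (2 * k + 1 + 2 * m)) v = \<zero>" if m: "0 \<le> m" and v: "v \<in> carrier M" for m v
  proof -
    consider "m = 0" | "0 < m" "m \<noteq> 2 * k + 1" | "m = 2 * k + 1" using m by linarith
    then show ?thesis
    proof cases
      case 1
      then show ?thesis using G v by simp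
    next
      case 2
      then show ?thesis using step[of "2 * k + 1" m v] G v k by (simp add: algebra_simps)
    next
      case 3
      \<comment> \<open>\<open>L\<^sub>m\<close> commutes with \<open>G\<^sub>u\<close> when \<open>m = 2u\<close>; here the target is reached from \<open>G\<^sub>u\<^sub>+\<^sub>1\<close>.\<close>
      have "ga (Gg (2 * k + 3)) v = \<zero>" if "v \<in> carrier M" for v
        using step[of "2 * k + 1" 1 v] G k that by (simp add: algebra_simps)
      then show ?thesis using step[of "2 * k + 3" "2 * k" v] v k 3 by (simp add: algebra_simps)
    qed
  qed
  have kb: "Gg (2 * k + 1) \<in> bgens" using k by (simp add: bgens_eq)
  show ?thesis
  proof (cases x)
    case (Lg n)
    then have n: "k + 1 \<le> n" using x by simp
    show ?thesis unfolding Lg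
    proof (rule kills_bracket[OF kb, of "Gg (2 * n - 2 * k - 1)" _ "(-1) powi (2 * k + 1) * 2"])
      show "gbracket (Gg (2 * k + 1)) (Gg (2 * n - 2 * k - 1)) = psmult ((-1) powi (2 * k + 1) * 2) (basis (Lg n))"
        using n k by simp
    qed (use n k G v in \<open>auto simp: bgens_eq\<close>)
  next
    case (Tg r)
    then have r: "k + 1 \<le> r" using x by auto
    have d: "(2 * k + 1 + (2 * r - 2 * k)) div 2 = r" by simp
    have ne: "hf (2 * k + 1) - hf (2 * r - 2 * k) \<noteq> 0"
      using hf_odd[of "2 * k - r"] by (simp add: hf_def algebra_simps diff_divide_distrib add_divide_distrib)
    show ?thesis unfolding Tg
    proof (rule kills_bracket[OF kb, of "Gg (2 * r - 2 * k)" _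
          "(-1) powi (2 * k + 1 + 1) * (hf (2 * k + 1) - hf (2 * r - 2 * k))"])
      show "gbracket (Gg (2 * k + 1)) (Gg (2 * r - 2 * k))
        = psmult ((-1) powi (2 * k + 1 + 1) * (hf (2 * k + 1) - hf (2 * r - 2 * k))) (basis (Tg r))"
        by simp
    qed (use r k G v ne in \<open>auto simp: bgens_eq\<close>)
  next
    case (Gg q)
    show ?thesis
    proof (cases "even q")
      case False
      then obtain i where "q = 2 * i + 1" by (elim oddE)
      then show ?thesis using Godd[of "i - k" v] v x Gg by (simp add: algebra_simps)
    next
      case True
      then obtain i where i: "q = 2 * i" by (elim evenE)
      then have ik: "k + 1 \<le> i" using x Gg by simp
      show ?thesis unfolding Gg
      proof (rule kills_bracket[of "Gg (q - 1)" "Tg 0" _ "-1"])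
        show "ga (Gg (q - 1)) v = \<zero>" if "v \<in> carrier M" for v
          using Godd[of "i - 1 - k" v] that ik i by (simp add: algebra_simps)
      qed (use k ik i v in \<open>auto simp: bgens_eq\<close>)
    qed
  next
    case Cg
    then show ?thesis using x k by simp
  qed
qed

end

theorem theorem4p8:
  fixes c :: complex and M :: "'m super_module" and k :: int
  assumes "simple_supermodule b_alg M"
    and "k \<ge> 1"  (* u = k + 1/2 *)
    and "inj_on (act M (basis (Tg k))) (carrier M)"
    and "\<forall>m\<in>carrier M. act M (basis (Gg (2 * k + 1))) m = \<zero>\<^bsub>M\<^esub>"
  shows "simple_supermodule UNIV (Ind c M)"
proof -
  interpret b_module M c
    using assms(1) by (intro b_module.intro) (simp add: simple_supermodule_def)
  have T: "Tg k \<in> bgens" using assms(2) by (simp add: bgens_eq)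
  have G: "ga (Gg (2 * k + 1)) v = \<zero>\<^bsub>M\<^esub>" if "v \<in> carrier M" for v
    using assms(2,4) that ga_basis[of "Gg (2 * k + 1)" v] by (simp add: bgens_eq)
  note kills = kills_high[OF assms(2) G]
  have "ga (Tg k) (ga b v) = ga b (ga (Tg k) v)" if b: "b \<in> bCgens" and v: "v \<in> carrier M" for b v
  proof (cases "b = Cg")
    case True
    then show ?thesis using T v ga_smult[of "Tg k" v c] by (simp add: ga_Cg)
  next
    case False
    then have b0: "0 < deg b" using b by (simp add: bgens_eq)
    have br: "gbracket (Tg k) b \<in> b_alg" using T b by (intro gbracket_bC) auto
    have "act M (gbracket (Tg k) b) v = \<zero>\<^bsub>M\<^esub>"
      unfolding act_expand[OF br v] falg_act_eq
    proof (rule mlin_eq_zero)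
      fix w assume "w \<in> Poly_Mapping.keys (tw_to_falg (gbracket (Tg k) b))"
      then obtain g where g: "g \<in> Poly_Mapping.keys (gbracket (Tg k) b)" "w = [g]"
        unfolding tw_to_falg_eq using tw.keys_lt by blast
      then have "2 * k + 1 < deg g" using key_gbracket[OF g(1)] b0 by simp
      moreover from this have "g \<noteq> Tg k" by auto
      ultimately show "word_act c M w v = \<zero>\<^bsub>M\<^esub>" using kills[of g v] v g(2) by simp
    qed
    then have "ga (Tg k) (ga b v) \<ominus>\<^bsub>M\<^esub> ga b (ga (Tg k) v) = \<zero>\<^bsub>M\<^esub>"
      using falg_act_gbracket[of "Tg k" b v] T b v act_expand[OF br v] by simp
    then show ?thesis
      using diff_zero_iff[of "ga (Tg k) (ga b v)" "ga b (ga (Tg k) v)"] T b v by simp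
  qed
  then obtain z where z: "\<forall>v\<in>carrier M. ga (Tg k) v = z \<odot>\<^bsub>M\<^esub> v"
    using central_generator_scalar[OF assms(1) T] by auto
  obtain v where v: "v \<in> carrier M" "v \<noteq> \<zero>\<^bsub>M\<^esub>"
    using assms(1) M.zero_closed unfolding simple_supermodule_def by blast
  have "z \<noteq> 0"
  proof
    assume "z = 0"
    then have "act M (basis (Tg k)) v = act M (basis (Tg k)) \<zero>\<^bsub>M\<^esub>"
      using z v ga_basis[OF T] by (metis M.zero_closed smult_0)
    then show False using inj_onD[OF assms(3)] v by blast
  qed
  then interpret whittaker_module M c k z
    using assms(1,2) z kills by unfold_locales auto
  show ?thesis by (rule Ind_simple)
qed

end
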